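(* Let $k>1$ and $\gamma\in(1/2,1)$ with $\frac12+\frac1{2k}<\gamma$, and let $c>0$. Let $(X_t)_{t\ge1}$ be the solution of $$\mathrm{d}X_t=c|X_t|^k\,\mathrm{d}t+t^{-\frac{\gamma}{2(1-\gamma)}}\,\mathrm{d}B_t$$ with $X_1<0$. Then $X_t$ converges to $0$ as $t\to\infty$ with positive probability.
   Context: $(B_t)$ is a standard one-dimensional Brownian motion. The solution may explode to $+\infty$ in finite time; $X_t$ is the solution up to its (possibly infinite) explosion time, with $X_t=+\infty$ afterwards. *)

theory Defs
  imports "HOL-Probability.Probability"
begin

text \<open>Standard one-dimensional Brownian motion on the time set \<open>[0, \<infinity>)\<close> relative to a filtration
  \<open>F\<close>. The library's \<^locale>\<open>filtration\<close> is indexed by a whole type; the members of \<open>F\<close> at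
  negative times play no role.\<close>

definition brownian_motion ::
  "'a measure \<Rightarrow> (real \<Rightarrow> 'a measure) \<Rightarrow> (real \<Rightarrow> 'a \<Rightarrow> real) \<Rightarrow> bool" where
  "brownian_motion M F B \<longleftrightarrow>
     prob_space M \<and> filtration (space M) F \<and> (\<forall>t. subalgebra M (F t)) \<and>
     (\<forall>t\<ge>0. B t \<in> borel_measurable (F t)) \<and>
     (AE \<omega> in M. B 0 \<omega> = 0) \<and>
     (AE \<omega> in M. continuous_on {0..} (\<lambda>t. B t \<omega>)) \<and>
     (\<forall>s t. 0 \<le> s \<and> s < t \<longrightarrow>
        distributed M lborel (\<lambda>\<omega>. B t \<omega> - B s \<omega>) (normal_density 0 (sqrt (t - s))) \<and>
        prob_space.indep_set M (sets (F s))
          (sets (vimage_algebra (space M) (\<lambda>\<omega>. B t \<omega> - B s \<omega>) borel)))"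

text \<open>Elementary integrands on \<open>[S, T]\<close>: the grid \<open>S = p 0 < \<dots> < p n = T\<close> with bounded
  coefficients \<open>e i\<close> known at time \<open>p i\<close> encodes the process \<open>elementary_process n p e\<close>.\<close>

definition elementary_integrand ::
  "(real \<Rightarrow> 'a measure) \<Rightarrow> real \<Rightarrow> real \<Rightarrow> nat \<Rightarrow> (nat \<Rightarrow> real) \<Rightarrow> (nat \<Rightarrow> 'a \<Rightarrow> real) \<Rightarrow> bool" where
  "elementary_integrand F S T n p e \<longleftrightarrow>
     p 0 = S \<and> p n = T \<and>
     (\<forall>i<n. p i < p (Suc i) \<and> e i \<in> borel_measurable (F (p i)) \<and>
            bounded (e i ` space (F (p i))))"

definition elementary_process ::
  "nat \<Rightarrow> (nat \<Rightarrow> real) \<Rightarrow> (nat \<Rightarrow> 'a \<Rightarrow> real) \<Rightarrow> real \<Rightarrow> 'a \<Rightarrow> real" where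
  "elementary_process n p e s \<omega> = (\<Sum>i<n. e i \<omega> * indicator {p i..<p (Suc i)} s)"

definition elementary_integral ::
  "(real \<Rightarrow> 'a \<Rightarrow> real) \<Rightarrow> nat \<Rightarrow> (nat \<Rightarrow> real) \<Rightarrow> (nat \<Rightarrow> 'a \<Rightarrow> real) \<Rightarrow> 'a \<Rightarrow> real" where
  "elementary_integral B n p e \<omega> = (\<Sum>i<n. e i \<omega> * (B (p (Suc i)) \<omega> - B (p i) \<omega>))"

text \<open>\<open>J\<close> is (a version of) the Ito integral of \<open>H\<close> against \<open>B\<close> over \<open>[S, T]\<close>: the limit in
  \<open>L\<^sup>2(M)\<close> of the integrals of elementary integrands that converge to \<open>H\<close> in
  \<open>L\<^sup>2([S, T] \<times> M)\<close>.\<close>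

definition has_ito_integral ::
  "'a measure \<Rightarrow> (real \<Rightarrow> 'a measure) \<Rightarrow> (real \<Rightarrow> 'a \<Rightarrow> real) \<Rightarrow> (real \<Rightarrow> 'a \<Rightarrow> real) \<Rightarrow>
     real \<Rightarrow> real \<Rightarrow> ('a \<Rightarrow> real) \<Rightarrow> bool" where
  "has_ito_integral M F B H S T J \<longleftrightarrow>
     (\<lambda>(s, \<omega>). H s \<omega>) \<in> borel_measurable (restrict_space lborel {S..T} \<Otimes>\<^sub>M M) \<and>
     J \<in> borel_measurable M \<and>
     (\<exists>n p e. (\<forall>m. elementary_integrand F S T (n m) (p m) (e m)) \<and>
        (\<lambda>m. \<integral>\<^sup>+\<omega>. (\<integral>\<^sup>+s\<in>{S..T}.
            ennreal ((H s \<omega> - elementary_process (n m) (p m) (e m) s \<omega>)\<^sup>2) \<partial>lborel) \<partial>M)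
          \<longlonglongrightarrow> 0 \<and>
        (\<lambda>m. \<integral>\<^sup>+\<omega>. ennreal ((J \<omega> - elementary_integral B (n m) (p m) (e m) \<omega>)\<^sup>2) \<partial>M)
          \<longlonglongrightarrow> 0)"

definition explosion_time :: "real \<Rightarrow> (real \<Rightarrow> ereal) \<Rightarrow> ereal" where
  "explosion_time t0 x = Inf {ereal t | t. t0 \<le> t \<and> x t = \<infinity>}"

text \<open>The integral equation for a single path \<open>x\<close> started at time \<open>t0\<close>, with drift \<open>b\<close> and noise
  path \<open>y\<close>: \<open>x\<close> is real-valued and solves the equation before its explosion time, explodes to
  \<open>+\<infinity>\<close> there if that time is finite (without the left limit, a path could be killed at an
  arbitrary time), and is \<open>+\<infinity>\<close> from then on. If \<open>x\<close> never takes the value \<open>+\<infinity>\<close>, its explosion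
  time is the infimum of the empty set, that is \<open>\<infinity>\<close>.\<close>

definition solution_path ::
  "(real \<Rightarrow> real) \<Rightarrow> real \<Rightarrow> (real \<Rightarrow> real) \<Rightarrow> (real \<Rightarrow> ereal) \<Rightarrow> bool" where
  "solution_path b t0 y x \<longleftrightarrow>
     \<bar>x t0\<bar> \<noteq> \<infinity> \<and>
     continuous_on {t. t0 \<le> t \<and> ereal t < explosion_time t0 x} x \<and>
     (\<forall>t\<ge>t0. ereal t < explosion_time t0 x \<longrightarrow>
        \<bar>x t\<bar> \<noteq> \<infinity> \<and>
        real_of_ereal (x t) = real_of_ereal (x t0)
          + (LINT s:{t0..t}|lborel. b (real_of_ereal (x s))) + y t) \<and>
     (\<forall>t. explosion_time t0 x = ereal t \<longrightarrow> (x \<longlongrightarrow> \<infinity>) (at_left t)) \<and>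
     (\<forall>t\<ge>t0. explosion_time t0 x \<le> ereal t \<longrightarrow> x t = \<infinity>)"

text \<open>\<open>X\<close> solves \<open>dX\<^sub>t = b(X\<^sub>t) dt + \<sigma>(t) dB\<^sub>t\<close> on \<open>[t0, \<infinity>)\<close> up to explosion to \<open>+\<infinity>\<close>. Since \<open>\<sigma>\<close> does
  not depend on the state, the stochastic integral \<open>I\<close> (in a continuous version) is defined for
  all times, and no localisation at the explosion time is needed.\<close>

definition sde_solution ::
  "'a measure \<Rightarrow> (real \<Rightarrow> 'a measure) \<Rightarrow> (real \<Rightarrow> 'a \<Rightarrow> real) \<Rightarrow>
     (real \<Rightarrow> real) \<Rightarrow> (real \<Rightarrow> real) \<Rightarrow> real \<Rightarrow> (real \<Rightarrow> 'a \<Rightarrow> ereal) \<Rightarrow> bool" where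
  "sde_solution M F B b \<sigma> t0 X \<longleftrightarrow>
     (\<forall>t\<ge>t0. X t \<in> borel_measurable (F t)) \<and>
     (\<exists>I. (\<forall>t\<ge>t0. has_ito_integral M F B (\<lambda>s \<omega>. \<sigma> s) t0 t (I t)) \<and>
          (AE \<omega> in M. continuous_on {t0..} (\<lambda>t. I t \<omega>)) \<and>
          (AE \<omega> in M. solution_path b t0 (\<lambda>t. I t \<omega>) (\<lambda>t. X t \<omega>)))"

text \<open>Path properties are only required almost surely and \<open>M\<close> need not be complete, so an event
  about a whole path may be measurable only up to a null set. Its probability is therefore taken
  in the completion of \<open>M\<close>; for events in \<open>sets M\<close> this is the probability under \<open>M\<close>.\<close>

definition path_prob :: "'a measure \<Rightarrow> ('a \<Rightarrow> bool) \<Rightarrow> real" where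
  "path_prob M P = measure (completion M) {\<omega> \<in> space M. P \<omega>}"

end

theory Submission
  imports Defs
begin

text \<open>Write \<open>\<sigma>(t) = t powr - \<beta>\<close> with \<open>\<beta> = \<gamma> / (2 (1 - \<gamma>))\<close> for the noise coefficient, \<open>I\<close> for its stochastic integral and
\<open>r = 1 / (k - 1)\<close>. Without noise the equation \<open>x' = c \<bar>x\<bar>\<^sup>k\<close>, started below zero, creeps up to zero like
a negative multiple of \<open>t powr - r\<close>. The noise that is still to come after time \<open>t\<close> has standard deviation of
order \<open>t powr (- (2\<beta> - 1) / 2)\<close>, and the hypothesis on \<open>\<gamma>\<close> says exactly that \<open>2\<beta> - 1 > 2r\<close>: the noise
to come is negligible compared with the distance of the deterministic solution from zero. So a path
that is below the curve \<open>- A t powr - r\<close> at a late time has a good chance to stay below zero for ever, and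
a solution that is bounded above, driven by a convergent noise path, can only converge to the zero of the
drift.

The pathwise part (\<open>barrier_comparison\<close>, \<open>solution_stays_below_barrier\<close>, \<open>solution_tends_to_zero\<close>):
for small \<open>A\<close> the curve \<open>- A t powr - r\<close> rises faster than the drift can push a path whose noise has moved
by at most \<open>A t powr - r\<close>, so the path minus its noise cannot cross that curve.

The probabilistic part has two phases. Let \<open>T\<close> be a late time. To be below the curve with \<open>A = 2a\<close> at time
\<open>T\<close> has positive probability (\<open>prob_below_propagates\<close>): cut \<open>[1, T]\<close> into short blocks, and in each
block ask that the noise oscillates little and essentially does not increase. The oscillation is
controlled by the maximal inequality. The sign of the increment comes
from \<open>B\<close>, whose increment is nonpositive with probability at least one half given the past:
on a block \<open>[s, u]\<close> the increment of \<open>I\<close> differs from \<open>\<sigma>(s) (B\<^sub>u - B\<^sub>s)\<close> by an error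
of variance of order \<open>(u - s)\<^sup>3\<close>, so the total loss over all blocks can be made arbitrarily small. After time
\<open>T\<close>, the maximal inequality on the dyadic blocks \<open>[T 2\<^sup>n, T 2\<^bsup>n+1\<^esup>]\<close> and a union bound show that
\<open>I\<close> stays within \<open>a t powr - r\<close> of its limit with large probability (\<open>tail_noise_small\<close>). All
these estimates hold relative to an event \<open>D\<close> of the past, with the bound multiplied by
the probability of \<open>D\<close>, and this is how the blocks are chained together.

The maximal inequality needs that \<open>I\<close> has orthogonal increments. The Ito integral is given only as a limit of
integrals of random elementary integrands on unrelated grids, one sequence for each end point. Replacing the
coefficients by their expectations makes the approximants deterministic (\<open>derandomize\<close>), and after that they
can be cut and subtracted (\<open>wiener_integral_diff\<close>).\<close>

section \<open>Brownian increments\<close>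

locale brownian = prob_space M for M :: "'a measure" +
  fixes F :: "real \<Rightarrow> 'a measure" and B :: "real \<Rightarrow> 'a \<Rightarrow> real"
  assumes bm: "brownian_motion M F B"
begin

lemma space_F [simp]: "space (F t) = space M"
  using bm by (auto simp: brownian_motion_def subalgebra_def)

lemma sets_F_subset: "sets (F t) \<subseteq> sets M"
  using bm by (auto simp: brownian_motion_def subalgebra_def)

lemma sets_F_mono: "s \<le> t \<Longrightarrow> sets (F s) \<subseteq> sets (F t)"
  using bm unfolding brownian_motion_def filtration_def by blast

lemma measurable_F_M: "f \<in> borel_measurable (F t) \<Longrightarrow> f \<in> borel_measurable M"
  using bm measurable_from_subalg[of M "F t" f borel] by (auto simp: brownian_motion_def)

lemma measurable_F_mono:
  assumes "f \<in> borel_measurable (F s)" "s \<le> t" shows "f \<in> borel_measurable (F t)"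
  using measurable_from_subalg[of "F t" "F s" f borel] sets_F_mono[OF assms(2)] assms(1)
  by (auto simp: subalgebra_def)

lemma measurable_B: "0 \<le> s \<Longrightarrow> s \<le> t \<Longrightarrow> B s \<in> borel_measurable (F t)"
  using bm measurable_F_mono[of "B s" s t] by (auto simp: brownian_motion_def)

lemma measurable_B_M: "0 \<le> s \<Longrightarrow> B s \<in> borel_measurable M"
  using measurable_F_M[OF measurable_B[of s s]] by auto

lemma increment_distributed:
  "0 \<le> s \<Longrightarrow> s < t \<Longrightarrow>
    distributed M lborel (\<lambda>\<omega>. B t \<omega> - B s \<omega>) (normal_density 0 (sqrt (t - s)))"
  using bm by (auto simp: brownian_motion_def)

lemma increment_indep_set:
  "0 \<le> s \<Longrightarrow> s < t \<Longrightarrow>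
    indep_set (sets (F s)) (sets (vimage_algebra (space M) (\<lambda>\<omega>. B t \<omega> - B s \<omega>) borel))"
  using bm by (auto simp: brownian_motion_def)

lemma increment_indep_var:
  assumes "0 \<le> s" "s < t" and Z: "Z \<in> borel_measurable (F s)"
  shows "indep_var borel Z borel (\<lambda>\<omega>. B t \<omega> - B s \<omega>)"
proof -
  have m: "(\<lambda>\<omega>. B t \<omega> - B s \<omega>) \<in> borel_measurable M"
    using measurable_B_M assms by auto
  have sub: "sigma_sets (space M) {Z -` A \<inter> space M |A. A \<in> sets borel} \<subseteq> sets (F s)"
    by (rule sets.sigma_sets_subset[of _ "F s", simplified]) (use measurable_sets[OF Z] in auto)
  have eq: "sigma_sets (space M) {(\<lambda>\<omega>. B t \<omega> - B s \<omega>) -` A \<inter> space M |A. A \<in> sets borel}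
      = sets (vimage_algebra (space M) (\<lambda>\<omega>. B t \<omega> - B s \<omega>) borel)"
    by (simp add: sets_vimage_algebra)
  show ?thesis
    unfolding indep_var_eq eq
    using increment_indep_set[OF assms(1,2)] measurable_F_M[OF Z] m sub
    unfolding indep_sets2_eq by blast
qed

lemma
  assumes "0 \<le> s" "s \<le> t"
  shows increment_integrable: "integrable M (\<lambda>\<omega>. B t \<omega> - B s \<omega>)"
    and increment_mean: "expectation (\<lambda>\<omega>. B t \<omega> - B s \<omega>) = 0"
    and increment_sq_integrable: "integrable M (\<lambda>\<omega>. (B t \<omega> - B s \<omega>)\<^sup>2)"
    and increment_second_moment: "expectation (\<lambda>\<omega>. (B t \<omega> - B s \<omega>)\<^sup>2) = t - s"
proof -
  have "integrable M (\<lambda>\<omega>. B t \<omega> - B s \<omega>) \<and> expectation (\<lambda>\<omega>. B t \<omega> - B s \<omega>) = 0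
    \<and> integrable M (\<lambda>\<omega>. (B t \<omega> - B s \<omega>)\<^sup>2) \<and> expectation (\<lambda>\<omega>. (B t \<omega> - B s \<omega>)\<^sup>2) = t - s"
  proof (cases "s = t")
    case False
    hence st: "s < t" using assms by auto
    note d = increment_distributed[OF assms(1) st]
    have pos: "sqrt (t - s) > 0" using st by auto
    have 1: "integrable M (\<lambda>\<omega>. B t \<omega> - B s \<omega>)"
      using distributed_integrable[OF d, of "\<lambda>x. x"] integrable_normal_moment_nz_1[OF pos, of 0] by simp
    have 2: "integrable M (\<lambda>\<omega>. (B t \<omega> - B s \<omega>)\<^sup>2)"
      using distributed_integrable[OF d, of "\<lambda>x. x\<^sup>2"] integrable_normal_moment[OF pos, of 0 2] by simp
    have 3: "expectation (\<lambda>\<omega>. B t \<omega> - B s \<omega>) = 0"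
      using distributed_integral[OF d, of "\<lambda>x. x"] integral_normal_moment_nz_1[OF pos, of 0] by simp
    have 4: "expectation (\<lambda>\<omega>. (B t \<omega> - B s \<omega>)\<^sup>2) = t - s"
      using distributed_integral[OF d, of "\<lambda>x. x\<^sup>2"] integral_normal_moment_even[OF pos, of 0 1] st
      by (simp add: fact_numeral)
    show ?thesis using 1 2 3 4 by auto
  qed simp
  then show "integrable M (\<lambda>\<omega>. B t \<omega> - B s \<omega>)" "expectation (\<lambda>\<omega>. B t \<omega> - B s \<omega>) = 0"
    "integrable M (\<lambda>\<omega>. (B t \<omega> - B s \<omega>)\<^sup>2)" "expectation (\<lambda>\<omega>. (B t \<omega> - B s \<omega>)\<^sup>2) = t - s" by auto
qed

lemma
  assumes "0 \<le> s" "s \<le> t" and Z: "Z \<in> borel_measurable (F s)" "integrable M Z"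
  shows integrable_mult_increment: "integrable M (\<lambda>\<omega>. Z \<omega> * (B t \<omega> - B s \<omega>))"
    and expectation_mult_increment: "expectation (\<lambda>\<omega>. Z \<omega> * (B t \<omega> - B s \<omega>)) = 0"
    and integrable_mult_increment_sq: "integrable M (\<lambda>\<omega>. Z \<omega> * (B t \<omega> - B s \<omega>)\<^sup>2)"
    and expectation_mult_increment_sq:
      "expectation (\<lambda>\<omega>. Z \<omega> * (B t \<omega> - B s \<omega>)\<^sup>2) = expectation Z * (t - s)"
proof -
  have "integrable M (\<lambda>\<omega>. Z \<omega> * (B t \<omega> - B s \<omega>)) \<and> expectation (\<lambda>\<omega>. Z \<omega> * (B t \<omega> - B s \<omega>)) = 0 \<and>
     integrable M (\<lambda>\<omega>. Z \<omega> * (B t \<omega> - B s \<omega>)\<^sup>2) \<and>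
     expectation (\<lambda>\<omega>. Z \<omega> * (B t \<omega> - B s \<omega>)\<^sup>2) = expectation Z * (t - s)"
  proof (cases "s = t")
    case False
    hence st: "s < t" using assms by auto
    note i = increment_indep_var[OF assms(1) st Z(1)]
    have i2: "indep_var borel Z borel (\<lambda>\<omega>. (B t \<omega> - B s \<omega>)\<^sup>2)"
      using indep_var_compose[OF i, of "\<lambda>x. x" borel "\<lambda>x. x\<^sup>2" borel] by (simp add: comp_def)
    show ?thesis
      using indep_var_lebesgue_integral[OF i Z(2) increment_integrable[OF assms(1,2)]]
        indep_var_integrable[OF i Z(2) increment_integrable[OF assms(1,2)]]
        indep_var_lebesgue_integral[OF i2 Z(2) increment_sq_integrable[OF assms(1,2)]]
        indep_var_integrable[OF i2 Z(2) increment_sq_integrable[OF assms(1,2)]]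
        increment_mean[OF assms(1,2)] increment_second_moment[OF assms(1,2)]
      by simp
  qed simp
  then show "integrable M (\<lambda>\<omega>. Z \<omega> * (B t \<omega> - B s \<omega>))"
    "expectation (\<lambda>\<omega>. Z \<omega> * (B t \<omega> - B s \<omega>)) = 0"
    "integrable M (\<lambda>\<omega>. Z \<omega> * (B t \<omega> - B s \<omega>)\<^sup>2)"
    "expectation (\<lambda>\<omega>. Z \<omega> * (B t \<omega> - B s \<omega>)\<^sup>2) = expectation Z * (t - s)" by auto
qed

text \<open>The normal density is even.\<close>

lemma half_le_prob_increment_nonpos:
  assumes "0 \<le> s" "s < t" shows "1/2 \<le> prob {\<omega> \<in> space M. B t \<omega> - B s \<omega> \<le> 0}"
proof -
  let ?X = "\<lambda>\<omega>. B t \<omega> - B s \<omega>" and ?f = "normal_density 0 (sqrt (t - s))"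
  note d = increment_distributed[OF assms]
  have m: "?X \<in> borel_measurable M" using measurable_B_M assms by auto
  have e: "emeasure M (?X -` A \<inter> space M) = (\<integral>\<^sup>+x. ennreal (?f x) * indicator A x \<partial>lborel)"
    if "A \<in> sets borel" for A
    using distributed_emeasure[OF d, of A] that by simp
  have "emeasure M (?X -` {..0} \<inter> space M) = (\<integral>\<^sup>+x. ennreal (?f x) * indicator {..0} x \<partial>lborel)"
    by (rule e) simp
  also have "\<dots> = (\<integral>\<^sup>+x. ennreal (?f (- x)) * indicator {..0} (- x) \<partial>lborel)"
    by (subst nn_integral_real_affine[where c="-1" and t=0]) auto
  also have "\<dots> = (\<integral>\<^sup>+x. ennreal (?f x) * indicator {0..} x \<partial>lborel)"
    by (intro nn_integral_cong) (auto simp: normal_density_def indicator_def)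
  also have "\<dots> = emeasure M (?X -` {0..} \<inter> space M)"
    by (rule e[symmetric]) simp
  finally have eq: "prob (?X -` {..0} \<inter> space M) = prob (?X -` {0..} \<inter> space M)"
    by (simp add: measure_def)
  have "1 = prob ((?X -` {..0} \<inter> space M) \<union> (?X -` {0..} \<inter> space M))"
    by (subst prob_space[symmetric], rule arg_cong[of _ _ prob]) auto
  also have "\<dots> \<le> prob (?X -` {..0} \<inter> space M) + prob (?X -` {0..} \<inter> space M)"
    using m by (intro measure_Un_le) auto
  finally have "1/2 \<le> prob (?X -` {..0} \<inter> space M)" using eq by auto
  also have "?X -` {..0} \<inter> space M = {\<omega> \<in> space M. ?X \<omega> \<le> 0}" by auto
  finally show ?thesis .
qed

lemma half_le_prob_Int_increment_nonpos:
  assumes "0 \<le> s" "s < t" "D \<in> sets (F s)"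
  shows "prob D / 2 \<le> prob (D \<inter> {\<omega> \<in> space M. B t \<omega> - B s \<omega> \<le> 0})"
proof -
  have "{\<omega> \<in> space M. B t \<omega> - B s \<omega> \<le> 0}
      \<in> sets (vimage_algebra (space M) (\<lambda>\<omega>. B t \<omega> - B s \<omega>) borel)"
    using in_vimage_algebra[of "{..0::real}" borel "\<lambda>\<omega>. B t \<omega> - B s \<omega>" "space M"]
    by (simp add: vimage_def Int_def conj_commute)
  from indep_setD[OF increment_indep_set[OF assms(1,2)] assms(3) this]
  show ?thesis
    using mult_left_mono[OF half_le_prob_increment_nonpos[OF assms(1,2)], of "prob D"] by simp
qed

end

section \<open>Mean-square approximation by step functions\<close>

definition sq_norm :: "'b measure \<Rightarrow> ('b \<Rightarrow> real) \<Rightarrow> ennreal" where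
  "sq_norm N f = (\<integral>\<^sup>+x. ennreal ((f x)\<^sup>2) \<partial>N)"

lemma sq_norm_add_le:
  assumes [measurable]: "f \<in> borel_measurable N" "g \<in> borel_measurable N"
  shows "sq_norm N (\<lambda>x. f x + g x) \<le> 2 * sq_norm N f + 2 * sq_norm N g"
proof -
  have "(f x + g x)\<^sup>2 \<le> 2 * (f x)\<^sup>2 + 2 * (g x)\<^sup>2" for x
    using sum_squares_bound[of "f x" "g x"] by (simp add: power2_sum)
  then have "sq_norm N (\<lambda>x. f x + g x)
      \<le> (\<integral>\<^sup>+x. ennreal (2 * (f x)\<^sup>2 + 2 * (g x)\<^sup>2) \<partial>N)"
    unfolding sq_norm_def by (intro nn_integral_mono ennreal_leI)
  also have "\<dots> = (\<integral>\<^sup>+x. 2 * ennreal ((f x)\<^sup>2) + 2 * ennreal ((g x)\<^sup>2) \<partial>N)"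
    by (intro nn_integral_cong) (simp add: ennreal_plus ennreal_mult)
  also have "\<dots> = 2 * sq_norm N f + 2 * sq_norm N g"
    unfolding sq_norm_def by (simp add: nn_integral_add nn_integral_cmult)
  finally show ?thesis .
qed

lemma sq_norm_cong: "(\<And>x. x \<in> space N \<Longrightarrow> (f x)\<^sup>2 = (g x)\<^sup>2) \<Longrightarrow> sq_norm N f = sq_norm N g"
  unfolding sq_norm_def by (intro nn_integral_cong) auto

lemma sq_norm_triangle:
  assumes [measurable]: "f \<in> borel_measurable N" "g \<in> borel_measurable N" "h \<in> borel_measurable N"
  shows "sq_norm N (\<lambda>x. f x - h x)
    \<le> 2 * sq_norm N (\<lambda>x. f x - g x) + 2 * sq_norm N (\<lambda>x. g x - h x)"
  using sq_norm_add_le[of "\<lambda>x. f x - g x" N "\<lambda>x. g x - h x"] by simp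

lemma tendsto_two_mult_add_zero_ennreal:
  assumes "(f \<longlongrightarrow> (0::ennreal)) G" "(g \<longlongrightarrow> 0) G"
  shows "((\<lambda>x. 2 * f x + 2 * g x) \<longlongrightarrow> 0) G"
  using tendsto_add[OF ennreal_tendsto_cmult[OF _ assms(1), of 2] ennreal_tendsto_cmult[OF _ assms(2), of 2]]
  by simp

lemma tendsto_zero_le_ennreal:
  assumes "(f \<longlongrightarrow> (0::ennreal)) G" "\<And>x. g x \<le> f x"
  shows "(g \<longlongrightarrow> 0) G"
  by (rule tendsto_sandwich[OF _ _ tendsto_const assms(1)]) (auto simp: assms(2))

lemma sq_integrable_mult:
  fixes f g :: "'b \<Rightarrow> real"
  assumes "f \<in> borel_measurable M" "g \<in> borel_measurable M"
    "integrable M (\<lambda>x. (f x)\<^sup>2)" "integrable M (\<lambda>x. (g x)\<^sup>2)"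
  shows "integrable M (\<lambda>x. f x * g x)"
proof (rule Bochner_Integration.integrable_bound)
  show "integrable M (\<lambda>x. (f x)\<^sup>2 + (g x)\<^sup>2)" using assms by auto
  show "AE x in M. norm (f x * g x) \<le> norm ((f x)\<^sup>2 + (g x)\<^sup>2)"
  proof (intro AE_I2)
    fix x
    have "2 * (\<bar>f x\<bar> * \<bar>g x\<bar>) \<le> (f x)\<^sup>2 + (g x)\<^sup>2"
      using sum_squares_bound[of "\<bar>f x\<bar>" "\<bar>g x\<bar>"] by simp
    moreover have "0 \<le> \<bar>f x\<bar> * \<bar>g x\<bar>" by simp
    ultimately have "\<bar>f x\<bar> * \<bar>g x\<bar> \<le> (f x)\<^sup>2 + (g x)\<^sup>2" by linarith
    then show "norm (f x * g x) \<le> norm ((f x)\<^sup>2 + (g x)\<^sup>2)" by (simp add: abs_mult)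
  qed
qed (use assms in auto)

lemma sq_integrable_diff:
  fixes f g :: "'b \<Rightarrow> real"
  assumes "f \<in> borel_measurable M" "g \<in> borel_measurable M"
    "integrable M (\<lambda>x. (f x)\<^sup>2)" "integrable M (\<lambda>x. (g x)\<^sup>2)"
  shows "integrable M (\<lambda>x. (f x - g x)\<^sup>2)"
  using assms sq_integrable_mult[OF assms]
  by (simp add: power2_diff mult.assoc)

text \<open>A pair \<open>(d, b)\<close> of the list stands for the function \<open>d\<close> times the indicator of \<open>[s, b)\<close>. With
  this encoding sums are concatenations and no two functions need a common grid; cutting at \<open>t\<close> turns
  \<open>b\<close> into \<open>min b t\<close> and \<open>max b t\<close>.\<close>

definition step_fun :: "real \<Rightarrow> (real \<times> real) list \<Rightarrow> real \<Rightarrow> real" where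
  "step_fun s xs t = (\<Sum>(d, b)\<leftarrow>xs. d * indicator {s..<b} t)"

definition nodes_in :: "real \<Rightarrow> real \<Rightarrow> (real \<times> real) list \<Rightarrow> bool" where
  "nodes_in s u xs \<longleftrightarrow> (\<forall>(d, b)\<in>set xs. s \<le> b \<and> b \<le> u)"

abbreviation leb :: "real \<Rightarrow> real \<Rightarrow> real measure" where
  "leb s u \<equiv> restrict_space lborel {s..<u}"

lemma step_fun_simps [simp]:
  "step_fun s [] t = 0"
  "step_fun s ((d, b) # xs) t = d * indicator {s..<b} t + step_fun s xs t"
  "step_fun s (xs @ ys) t = step_fun s xs t + step_fun s ys t"
  by (simp_all add: step_fun_def)

lemma step_fun_uminus [simp]: "step_fun s (map (\<lambda>(d, b). (- d, b)) xs) t = - step_fun s xs t"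
  by (induction xs) auto

lemma nodes_in_simps [simp]:
  "nodes_in s u []"
  "nodes_in s u ((d, b) # xs) \<longleftrightarrow> s \<le> b \<and> b \<le> u \<and> nodes_in s u xs"
  "nodes_in s u (xs @ ys) \<longleftrightarrow> nodes_in s u xs \<and> nodes_in s u ys"
  by (auto simp: nodes_in_def)

lemma nodes_in_uminus [simp]: "nodes_in s u (map (\<lambda>(d, b). (- d, b)) xs) = nodes_in s u xs"
  by (induction xs) auto

lemma borel_measurable_step_fun [measurable]: "step_fun s xs \<in> borel_measurable borel"
proof (induction xs)
  case (Cons x xs)
  then show ?case by (cases x) simp
qed simp

lemma measurable_leb: "f \<in> borel_measurable borel \<Longrightarrow> f \<in> borel_measurable (leb s u)"
  by (simp add: measurable_restrict_space1)

lemma sq_norm_leb: "sq_norm (leb s u) f = (\<integral>\<^sup>+x\<in>{s..<u}. ennreal ((f x)\<^sup>2) \<partial>lborel)"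
  unfolding sq_norm_def by (subst nn_integral_restrict_space) auto

lemma sq_norm_leb_mono: "s' \<le> s \<Longrightarrow> u \<le> u' \<Longrightarrow> sq_norm (leb s u) f \<le> sq_norm (leb s' u') f"
  unfolding sq_norm_leb by (intro nn_integral_mono) (auto simp: indicator_def)

lemma step_fun_outside: "nodes_in s u xs \<Longrightarrow> t \<notin> {s..<u} \<Longrightarrow> step_fun s xs t = 0"
  by (induction xs) (auto simp: indicator_def)

lemma nodes_in_max: "nodes_in s u xs \<Longrightarrow> t \<le> u \<Longrightarrow> nodes_in t u (map (\<lambda>(d, b). (d, max b t)) xs)"
  by (induction xs) auto

lemma nodes_in_min: "nodes_in s u xs \<Longrightarrow> s \<le> t \<Longrightarrow> nodes_in s t (map (\<lambda>(d, b). (d, min b t)) xs)"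
  by (induction xs) auto

lemma step_fun_max:
  "s \<le> t \<Longrightarrow> t \<le> r \<Longrightarrow> step_fun t (map (\<lambda>(d, b). (d, max b t)) xs) r = step_fun s xs r"
  by (induction xs) (auto simp: indicator_def)

lemma step_fun_min:
  "r < t \<Longrightarrow> step_fun s (map (\<lambda>(d, b). (d, min b t)) xs) r = step_fun s xs r"
  by (induction xs) (auto simp: indicator_def)

lemma grid_mono:
  fixes p :: "nat \<Rightarrow> real"
  assumes p: "\<And>i. i < n \<Longrightarrow> p i < p (Suc i)" and "i \<le> j" "j \<le> n"
  shows "p i \<le> p j"
  using assms(2,3)
proof (induction j rule: dec_induct)
  case (step m)
  then show ?case using p[of m] by simp
qed simp

lemma sum_indicator_grid:
  fixes p c :: "nat \<Rightarrow> real"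
  assumes p: "\<And>i. i < n \<Longrightarrow> p i < p (Suc i)" and j: "j < n" "r \<in> {p j..<p (Suc j)}"
  shows "(\<Sum>i<n. c i * indicator {p i..<p (Suc i)} r) = c j"
proof -
  note mono = grid_mono[of n p, OF p]
  have "indicator {p i..<p (Suc i)} r = (0::real)" if "i < n" "i \<noteq> j" for i
    using mono[of "Suc i" j] mono[of "Suc j" i] that j by (cases "i < j") (auto simp: indicator_def)
  then have "(\<Sum>i<n. c i * indicator {p i..<p (Suc i)} r) = (\<Sum>i<n. if i = j then c j else 0)"
    using j by (intro sum.cong) auto
  then show ?thesis using j by simp
qed

lemma grid_interval:
  fixes p :: "nat \<Rightarrow> real"
  assumes "p 0 \<le> r" "r < p n"
  obtains j where "j < n" "r \<in> {p j..<p (Suc j)}"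
  using assms
proof (induction n arbitrary: thesis)
  case (Suc n)
  show ?case
  proof (cases "r < p n")
    case True
    show ?thesis
      by (rule Suc.IH) (use Suc.prems True in \<open>auto intro: less_SucI\<close>)
  next
    case False
    then show ?thesis using Suc.prems by (intro Suc.prems(1)[of n]) auto
  qed
qed simp

section \<open>Wiener integrals\<close>

context brownian
begin

definition wiener_sum :: "real \<Rightarrow> (real \<times> real) list \<Rightarrow> 'a \<Rightarrow> real" where
  "wiener_sum s xs \<omega> = (\<Sum>(d, b)\<leftarrow>xs. d * (B b \<omega> - B s \<omega>))"

lemma wiener_sum_simps [simp]:
  "wiener_sum s [] \<omega> = 0"
  "wiener_sum s ((d, b) # xs) \<omega> = d * (B b \<omega> - B s \<omega>) + wiener_sum s xs \<omega>"
  "wiener_sum s (xs @ ys) \<omega> = wiener_sum s xs \<omega> + wiener_sum s ys \<omega>"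
  by (simp_all add: wiener_sum_def)

lemma wiener_sum_Nil: "wiener_sum s [] = (\<lambda>_. 0)"
  by auto

lemma wiener_sum_Cons:
  "wiener_sum s ((d, b) # xs) = (\<lambda>\<omega>. d * (B b \<omega> - B s \<omega>) + wiener_sum s xs \<omega>)"
  by auto

lemma wiener_sum_uminus [simp]:
  "wiener_sum s (map (\<lambda>(d, b). (- d, b)) xs) \<omega> = - wiener_sum s xs \<omega>"
  by (induction xs) auto

lemma measurable_wiener_sum:
  assumes "0 \<le> s" "s \<le> u" "nodes_in s u xs"
  shows "wiener_sum s xs \<in> borel_measurable (F u)"
  using assms(3)
proof (induction xs)
  case (Cons x xs)
  then show ?case using measurable_B[of _ u] assms(1,2)
    by (cases x) (auto simp: wiener_sum_Cons intro!: borel_measurable_add borel_measurable_times borel_measurable_diff)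
qed (simp add: wiener_sum_Nil)

lemma expectation_mult_wiener_sum:
  assumes "0 \<le> s" "nodes_in s u xs" "Z \<in> borel_measurable (F s)" "integrable M Z"
  shows "has_bochner_integral M (\<lambda>\<omega>. Z \<omega> * wiener_sum s xs \<omega>) 0"
  using assms(2)
proof (induction xs)
  case (Cons x xs)
  obtain d b where x: "x = (d, b)" by force
  have "has_bochner_integral M (\<lambda>\<omega>. Z \<omega> * (B b \<omega> - B s \<omega>)) 0"
    using integrable_mult_increment[OF assms(1) _ assms(3,4), of b]
      expectation_mult_increment[OF assms(1) _ assms(3,4), of b] Cons.prems
    by (auto simp: x has_bochner_integral_iff)
  from has_bochner_integral_add[OF has_bochner_integral_mult_right[OF this, of d] Cons.IH]
  show ?case using Cons.prems by (simp add: x algebra_simps)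
qed (simp add: has_bochner_integral_zero)

text \<open>The covariance of Brownian increments from \<open>s\<close> is the length of the overlap of \<open>[s, a)\<close> and
\<open>[s, b)\<close>, also after restriction to an event known at time \<open>s\<close>. It is the source of the isometry for
arbitrary, possibly overlapping, step functions.\<close>

lemma increments_covariance:
  assumes "0 \<le> s" "s \<le> a" "s \<le> b" and D: "D \<in> sets (F s)"
  shows "has_bochner_integral M (\<lambda>\<omega>. indicator D \<omega> * (B a \<omega> - B s \<omega>) * (B b \<omega> - B s \<omega>))
    (prob D * (min a b - s))"
proof -
  have *: "has_bochner_integral M (\<lambda>\<omega>. indicator D \<omega> * (B a \<omega> - B s \<omega>) * (B b \<omega> - B s \<omega>))
    (prob D * (a - s))" if ab: "s \<le> a" "a \<le> b" for a b
  proof -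
    have DM: "D \<in> sets M" using D sets_F_subset by auto
    have mD: "indicator D \<in> borel_measurable (F s)" using D by simp
    have iD: "integrable M (indicator D :: 'a \<Rightarrow> real)" using DM by (simp add: emeasure_eq_measure)
    have mZ: "(\<lambda>\<omega>. indicator D \<omega> * (B a \<omega> - B s \<omega>)) \<in> borel_measurable (F a)"
      using measurable_F_mono[OF mD ab(1)] measurable_B[of a a] measurable_B[of s a] assms(1) ab
      by (intro borel_measurable_times borel_measurable_diff) auto
    have 1: "has_bochner_integral M (\<lambda>\<omega>. indicator D \<omega> * (B a \<omega> - B s \<omega>)\<^sup>2) (prob D * (a - s))"
      using integrable_mult_increment_sq[OF assms(1) ab(1) mD iD]
        expectation_mult_increment_sq[OF assms(1) ab(1) mD iD] DM
      by (simp add: has_bochner_integral_iff)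
    have 2: "has_bochner_integral M
        (\<lambda>\<omega>. (indicator D \<omega> * (B a \<omega> - B s \<omega>)) * (B b \<omega> - B a \<omega>)) 0"
      using integrable_mult_increment[OF _ ab(2) mZ] expectation_mult_increment[OF _ ab(2) mZ]
        integrable_mult_increment[OF assms(1) ab(1) mD iD] assms(1) ab
      by (simp add: has_bochner_integral_iff)
    show ?thesis
      using has_bochner_integral_add[OF 1 2] by (simp add: algebra_simps power2_eq_square)
  qed
  show ?thesis
  proof (cases "a \<le> b")
    case True then show ?thesis using *[OF assms(2) True] by simp
  next
    case False then show ?thesis using *[OF assms(3), of a] by (simp add: ac_simps)
  qed
qed

text \<open>Both sides of the isometry are bilinear, so both are equal to the same double sum.\<close>

lemma wiener_sum_covariance:
  assumes "0 \<le> s" and D: "D \<in> sets (F s)" and xs: "nodes_in s u xs" and ys: "nodes_in s u ys"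
  shows "has_bochner_integral M (\<lambda>\<omega>. indicator D \<omega> * wiener_sum s xs \<omega> * wiener_sum s ys \<omega>)
      (prob D * (\<Sum>(d, b)\<leftarrow>ys. d * (\<Sum>(c, a)\<leftarrow>xs. c * (min a b - s))))"
    and "has_bochner_integral lborel (\<lambda>t. step_fun s xs t * step_fun s ys t)
      (\<Sum>(d, b)\<leftarrow>ys. d * (\<Sum>(c, a)\<leftarrow>xs. c * (min a b - s)))"
proof -
  have 1: "has_bochner_integral M (\<lambda>\<omega>. indicator D \<omega> * wiener_sum s xs \<omega> * (B b \<omega> - B s \<omega>))
      (prob D * (\<Sum>(c, a)\<leftarrow>xs. c * (min a b - s))) \<and>
    has_bochner_integral lborel (\<lambda>t. step_fun s xs t * indicator {s..<b} t)
      (\<Sum>(c, a)\<leftarrow>xs. c * (min a b - s))" if b: "s \<le> b" for b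
    using xs
  proof (induction xs)
    case (Cons x xs)
    obtain c a where x: "x = (c, a)" by force
    have sa: "s \<le> a" using Cons.prems by (simp add: x)
    have i: "has_bochner_integral lborel (indicator {s..<min a b}) (measure lborel {s..<min a b})"
      by (rule has_bochner_integral_real_indicator) (use sa b in auto)
    have "indicator {s..<min a b} t = (indicator {s..<a} t * indicator {s..<b} t :: real)" for t
      by (auto simp: indicator_def)
    with i have i': "has_bochner_integral lborel (\<lambda>t. indicator {s..<a} t * indicator {s..<b} t :: real)
        (min a b - s)"
      by (subst has_bochner_integral_cong[OF refl _ refl]) (use sa b in auto)
    have IH: "has_bochner_integral M (\<lambda>\<omega>. indicator D \<omega> * wiener_sum s xs \<omega> * (B b \<omega> - B s \<omega>))
      (prob D * (\<Sum>(c, a)\<leftarrow>xs. c * (min a b - s)))"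
      "has_bochner_integral lborel (\<lambda>t. step_fun s xs t * indicator {s..<b} t)
      (\<Sum>(c, a)\<leftarrow>xs. c * (min a b - s))"
      using Cons by (auto simp: x)
    show ?case
      using has_bochner_integral_add[OF has_bochner_integral_mult_right[OF
            increments_covariance[OF assms(1) sa b D], of c] IH(1)]
        has_bochner_integral_add[OF has_bochner_integral_mult_right[OF i', of c] IH(2)]
      by (simp add: x algebra_simps)
  qed (simp add: has_bochner_integral_zero)
  show "has_bochner_integral M (\<lambda>\<omega>. indicator D \<omega> * wiener_sum s xs \<omega> * wiener_sum s ys \<omega>)
      (prob D * (\<Sum>(d, b)\<leftarrow>ys. d * (\<Sum>(c, a)\<leftarrow>xs. c * (min a b - s))))"
    using ys
  proof (induction ys)
    case (Cons y ys)
    obtain d b where y: "y = (d, b)" by force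
    have b: "s \<le> b" using Cons.prems by (simp add: y)
    have IH: "has_bochner_integral M (\<lambda>\<omega>. indicator D \<omega> * wiener_sum s xs \<omega> * wiener_sum s ys \<omega>)
      (prob D * (\<Sum>(d, b)\<leftarrow>ys. d * (\<Sum>(c, a)\<leftarrow>xs. c * (min a b - s))))"
      using Cons by (auto simp: y)
    show ?case
      using has_bochner_integral_add[OF has_bochner_integral_mult_right[OF 1[OF b, THEN conjunct1], of d] IH]
      by (simp add: y algebra_simps)
  qed (simp add: has_bochner_integral_zero)
  show "has_bochner_integral lborel (\<lambda>t. step_fun s xs t * step_fun s ys t)
      (\<Sum>(d, b)\<leftarrow>ys. d * (\<Sum>(c, a)\<leftarrow>xs. c * (min a b - s)))"
    using ys
  proof (induction ys)
    case (Cons y ys)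
    obtain d b where y: "y = (d, b)" by force
    have b: "s \<le> b" using Cons.prems by (simp add: y)
    have IH: "has_bochner_integral lborel (\<lambda>t. step_fun s xs t * step_fun s ys t)
      (\<Sum>(d, b)\<leftarrow>ys. d * (\<Sum>(c, a)\<leftarrow>xs. c * (min a b - s)))"
      using Cons by (auto simp: y)
    show ?case
      using has_bochner_integral_add[OF has_bochner_integral_mult_right[OF 1[OF b, THEN conjunct2], of d] IH]
      by (simp add: y algebra_simps)
  qed (simp add: has_bochner_integral_zero)
qed

lemma wiener_sum_isometry:
  assumes "0 \<le> s" and D: "D \<in> sets (F s)" and xs: "nodes_in s u xs"
  shows "(\<integral>\<^sup>+\<omega>\<in>D. ennreal ((wiener_sum s xs \<omega>)\<^sup>2) \<partial>M) = emeasure M D * sq_norm (leb s u) (step_fun s xs)"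
proof -
  let ?q = "\<Sum>(d, b)\<leftarrow>xs. d * (\<Sum>(c, a)\<leftarrow>xs. c * (min a b - s))"
  note c = wiener_sum_covariance[OF assms(1) D xs xs]
  have "(\<integral>\<^sup>+\<omega>\<in>D. ennreal ((wiener_sum s xs \<omega>)\<^sup>2) \<partial>M)
      = (\<integral>\<^sup>+\<omega>. ennreal (indicator D \<omega> * wiener_sum s xs \<omega> * wiener_sum s xs \<omega>) \<partial>M)"
    by (intro nn_integral_cong) (auto simp: indicator_def power2_eq_square)
  also have "\<dots> = ennreal (prob D * ?q)"
    using c(1) by (subst nn_integral_eq_integral)
      (auto simp: has_bochner_integral_iff mult.assoc intro!: AE_I2 mult_nonneg_nonneg)
  also have "\<dots> = emeasure M D * ennreal ?q"
    by (simp add: emeasure_eq_measure ennreal_mult')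
  also have "ennreal ?q = (\<integral>\<^sup>+t. ennreal (step_fun s xs t * step_fun s xs t) \<partial>lborel)"
    using c(2) by (subst nn_integral_eq_integral) (auto simp: has_bochner_integral_iff)
  also have "\<dots> = sq_norm (leb s u) (step_fun s xs)"
    unfolding sq_norm_leb using step_fun_outside[OF xs]
    by (intro nn_integral_cong) (auto simp: indicator_def power2_eq_square)
  finally show ?thesis .
qed

text \<open>The Wiener integral of a deterministic function: as the Ito integral, but with approximants that
  are deterministic too. These can be cut and subtracted freely.\<close>

definition wiener_integral :: "real \<Rightarrow> real \<Rightarrow> (real \<Rightarrow> real) \<Rightarrow> ('a \<Rightarrow> real) \<Rightarrow> bool" where
  "wiener_integral s u f J \<longleftrightarrow> J \<in> borel_measurable M \<and>
    (\<exists>xs. (\<forall>m. nodes_in s u (xs m)) \<and>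
      (\<lambda>m. sq_norm (leb s u) (\<lambda>t. f t - step_fun s (xs m) t)) \<longlonglongrightarrow> 0 \<and>
      (\<lambda>m. sq_norm M (\<lambda>\<omega>. J \<omega> - wiener_sum s (xs m) \<omega>)) \<longlonglongrightarrow> 0)"

lemma measurable_wiener_sum_M:
  assumes "0 \<le> s" "nodes_in s u xs" shows "wiener_sum s xs \<in> borel_measurable M"
  using assms(2)
proof (induction xs)
  case (Cons x xs)
  then show ?case using measurable_B_M assms(1)
    by (cases x) (auto simp: wiener_sum_Cons intro!: borel_measurable_add borel_measurable_times borel_measurable_diff)
qed (simp add: wiener_sum_Nil)

text \<open>Equality without the factor \<open>4\<close> holds as well. The factor comes from using \<open>(x + y)\<^sup>2 \<le> 2 x\<^sup>2 + 2 y\<^sup>2\<close>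
in place of Minkowski's inequality and is harmless in all applications.\<close>

lemma wiener_integral_second_moment:
  assumes J: "wiener_integral s u f J" and s: "0 \<le> s" and D: "D \<in> sets (F s)"
    and f: "f \<in> borel_measurable borel"
  shows "(\<integral>\<^sup>+\<omega>\<in>D. ennreal ((J \<omega>)\<^sup>2) \<partial>M) \<le> 4 * (emeasure M D * sq_norm (leb s u) f)"
proof -
  obtain xs where xs: "\<And>m. nodes_in s u (xs m)"
    and 1: "(\<lambda>m. sq_norm (leb s u) (\<lambda>t. f t - step_fun s (xs m) t)) \<longlonglongrightarrow> 0"
    and 2: "(\<lambda>m. sq_norm M (\<lambda>\<omega>. J \<omega> - wiener_sum s (xs m) \<omega>)) \<longlonglongrightarrow> 0"
    using J unfolding wiener_integral_def by blast
  have [measurable]: "J \<in> borel_measurable M" "D \<in> sets M"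
    using J D sets_F_subset by (auto simp: wiener_integral_def)
  have [measurable]: "wiener_sum s (xs m) \<in> borel_measurable M" for m
    using measurable_wiener_sum_M[OF s xs] .
  let ?e = "\<lambda>m. sq_norm (leb s u) (\<lambda>t. f t - step_fun s (xs m) t)"
  let ?d = "\<lambda>m. sq_norm M (\<lambda>\<omega>. J \<omega> - wiener_sum s (xs m) \<omega>)"
  have le: "(\<integral>\<^sup>+\<omega>\<in>D. ennreal ((J \<omega>)\<^sup>2) \<partial>M)
      \<le> 2 * ?d m + 2 * (emeasure M D * (2 * ?e m + 2 * sq_norm (leb s u) f))" for m
  proof -
    let ?W = "wiener_sum s (xs m)"
    have "(\<integral>\<^sup>+\<omega>\<in>D. ennreal ((J \<omega>)\<^sup>2) \<partial>M) = sq_norm M (\<lambda>\<omega>. indicator D \<omega> * (J \<omega> - ?W \<omega>) + indicator D \<omega> * ?W \<omega>)"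
      unfolding sq_norm_def by (intro nn_integral_cong) (auto simp: indicator_def)
    also have "\<dots> \<le> 2 * sq_norm M (\<lambda>\<omega>. indicator D \<omega> * (J \<omega> - ?W \<omega>)) + 2 * sq_norm M (\<lambda>\<omega>. indicator D \<omega> * ?W \<omega>)"
      by (rule sq_norm_add_le) auto
    also have "sq_norm M (\<lambda>\<omega>. indicator D \<omega> * (J \<omega> - ?W \<omega>)) \<le> ?d m"
      unfolding sq_norm_def by (intro nn_integral_mono) (auto simp: indicator_def)
    also have "sq_norm M (\<lambda>\<omega>. indicator D \<omega> * ?W \<omega>) = (\<integral>\<^sup>+\<omega>\<in>D. ennreal ((?W \<omega>)\<^sup>2) \<partial>M)"
      unfolding sq_norm_def by (intro nn_integral_cong) (auto simp: indicator_def)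
    also have "\<dots> = emeasure M D * sq_norm (leb s u) (step_fun s (xs m))"
      by (rule wiener_sum_isometry[OF s D xs])
    also have "sq_norm (leb s u) (step_fun s (xs m)) \<le> 2 * ?e m + 2 * sq_norm (leb s u) f"
    proof -
      have "sq_norm (leb s u) (step_fun s (xs m)) =
          sq_norm (leb s u) (\<lambda>t. (step_fun s (xs m) t - f t) + f t)" by simp
      also have "\<dots> \<le> 2 * sq_norm (leb s u) (\<lambda>t. step_fun s (xs m) t - f t) + 2 * sq_norm (leb s u) f"
        by (rule sq_norm_add_le) (intro measurable_leb borel_measurable_diff borel_measurable_step_fun f)+
      also have "sq_norm (leb s u) (\<lambda>t. step_fun s (xs m) t - f t) = ?e m"
        by (rule sq_norm_cong) (simp add: power2_commute)
      finally show ?thesis .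
    qed
    finally show ?thesis by (simp add: mult_left_mono add_mono)
  qed
  have "(\<lambda>m. 2 * ?d m + 2 * (emeasure M D * (2 * ?e m + 2 * sq_norm (leb s u) f)))
      \<longlonglongrightarrow> 2 * 0 + 2 * (emeasure M D * (2 * 0 + 2 * sq_norm (leb s u) f))"
    by (intro tendsto_add ennreal_tendsto_cmult tendsto_const 1 2) (auto simp: emeasure_eq_measure)
  from tendsto_lowerbound[OF this, of "\<integral>\<^sup>+\<omega>\<in>D. ennreal ((J \<omega>)\<^sup>2) \<partial>M"] le
  have "(\<integral>\<^sup>+\<omega>\<in>D. ennreal ((J \<omega>)\<^sup>2) \<partial>M) \<le> 2 * (emeasure M D * (2 * sq_norm (leb s u) f))"
    by auto
  also have "\<dots> = (2 * 2) * (emeasure M D * sq_norm (leb s u) f)"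
    by (simp only: ac_simps)
  finally show ?thesis by simp
qed

lemma wiener_integral_sq_integrable:
  assumes J: "wiener_integral s u f J" and s: "0 \<le> s" and f: "f \<in> borel_measurable borel"
    and fin: "sq_norm (leb s u) f < \<infinity>"
  shows "integrable M (\<lambda>\<omega>. (J \<omega>)\<^sup>2)"
proof -
  have [measurable]: "J \<in> borel_measurable M" using J by (auto simp: wiener_integral_def)
  have sp: "space M \<in> sets (F s)" using sets.top[of "F s"] by simp
  have "(\<integral>\<^sup>+\<omega>. ennreal ((J \<omega>)\<^sup>2) \<partial>M) = (\<integral>\<^sup>+\<omega>\<in>space M. ennreal ((J \<omega>)\<^sup>2) \<partial>M)"
    by (intro nn_integral_cong) auto
  also have "\<dots> \<le> 4 * (emeasure M (space M) * sq_norm (leb s u) f)"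
    by (rule wiener_integral_second_moment[OF J s sp f])
  also have "\<dots> < \<infinity>" using fin by (simp add: emeasure_space_1 ennreal_mult_less_top)
  finally show ?thesis by (intro integrableI_bounded) auto
qed

lemma wiener_sum_sq_integrable:
  assumes "0 \<le> s" "nodes_in s u xs" shows "integrable M (\<lambda>\<omega>. (wiener_sum s xs \<omega>)\<^sup>2)"
proof -
  have sp: "space M \<in> sets (F s)" using sets.top[of "F s"] by simp
  have "integrable M (\<lambda>\<omega>. indicator (space M) \<omega> * wiener_sum s xs \<omega> * wiener_sum s xs \<omega>)"
    using wiener_sum_covariance(1)[OF assms(1) sp assms(2) assms(2)] by (simp add: has_bochner_integral_iff)
  then show ?thesis
    by (rule Bochner_Integration.integrable_cong[THEN iffD1, rotated 2]) (auto simp: power2_eq_square)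
qed

lemma wiener_integral_orthogonal:
  assumes J: "wiener_integral s u f J" and s: "0 \<le> s" and f: "f \<in> borel_measurable borel"
    and fin: "sq_norm (leb s u) f < \<infinity>"
    and Z: "Z \<in> borel_measurable (F s)" "integrable M (\<lambda>\<omega>. (Z \<omega>)\<^sup>2)"
  shows "expectation (\<lambda>\<omega>. Z \<omega> * J \<omega>) = 0"
proof -
  obtain xs where xs: "\<And>m. nodes_in s u (xs m)"
    and lim: "(\<lambda>m. sq_norm M (\<lambda>\<omega>. J \<omega> - wiener_sum s (xs m) \<omega>)) \<longlonglongrightarrow> 0"
    using J unfolding wiener_integral_def by blast
  have [measurable]: "J \<in> borel_measurable M" "Z \<in> borel_measurable M"
    using J measurable_F_M Z by (auto simp: wiener_integral_def)
  have [measurable]: "wiener_sum s (xs m) \<in> borel_measurable M" for m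
    using measurable_wiener_sum_M[OF s xs] .
  note J2 = wiener_integral_sq_integrable[OF J s f fin]
  have Zi: "integrable M Z"
    by (rule square_integrable_imp_integrable) (use Z in auto)
  have iJ: "integrable M (\<lambda>\<omega>. Z \<omega> * J \<omega>)" by (intro sq_integrable_mult Z J2) auto
  have le: "(ennreal \<bar>expectation (\<lambda>\<omega>. Z \<omega> * J \<omega>)\<bar>)\<^sup>2
      \<le> sq_norm M Z * sq_norm M (\<lambda>\<omega>. J \<omega> - wiener_sum s (xs m) \<omega>)" for m
  proof -
    let ?W = "wiener_sum s (xs m)"
    note w = expectation_mult_wiener_sum[OF s xs Z(1) Zi, of m]
    have "expectation (\<lambda>\<omega>. Z \<omega> * J \<omega>) = expectation (\<lambda>\<omega>. Z \<omega> * J \<omega> - Z \<omega> * ?W \<omega>)"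
      using w iJ by (simp add: has_bochner_integral_iff)
    also have "\<bar>\<dots>\<bar> \<le> expectation (\<lambda>\<omega>. \<bar>Z \<omega>\<bar> * \<bar>J \<omega> - ?W \<omega>\<bar>)"
      using integral_abs_bound[of M "\<lambda>\<omega>. Z \<omega> * J \<omega> - Z \<omega> * ?W \<omega>"]
      by (simp add: abs_mult right_diff_distrib[symmetric])
    finally have "ennreal \<bar>expectation (\<lambda>\<omega>. Z \<omega> * J \<omega>)\<bar> \<le> ennreal (expectation (\<lambda>\<omega>. \<bar>Z \<omega>\<bar> * \<bar>J \<omega> - ?W \<omega>\<bar>))"
      by (rule ennreal_leI)
    also have "\<dots> = (\<integral>\<^sup>+\<omega>. ennreal (\<bar>Z \<omega>\<bar> * \<bar>J \<omega> - ?W \<omega>\<bar>) \<partial>M)"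
    proof (rule nn_integral_eq_integral[symmetric])
      have "integrable M (\<lambda>\<omega>. norm (Z \<omega> * J \<omega> - Z \<omega> * ?W \<omega>))"
        using iJ w by (intro integrable_norm Bochner_Integration.integrable_diff) (auto simp: has_bochner_integral_iff)
      then show "integrable M (\<lambda>\<omega>. \<bar>Z \<omega>\<bar> * \<bar>J \<omega> - ?W \<omega>\<bar>)"
        by (simp add: abs_mult right_diff_distrib[symmetric])
    qed auto
    also have "\<dots> = (\<integral>\<^sup>+\<omega>. ennreal \<bar>Z \<omega>\<bar> * ennreal \<bar>J \<omega> - ?W \<omega>\<bar> \<partial>M)"
      by (simp add: ennreal_mult)
    finally have "(ennreal \<bar>expectation (\<lambda>\<omega>. Z \<omega> * J \<omega>)\<bar>)\<^sup>2 \<le> (\<integral>\<^sup>+\<omega>. ennreal \<bar>Z \<omega>\<bar> * ennreal \<bar>J \<omega> - ?W \<omega>\<bar> \<partial>M)\<^sup>2"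
      by (rule power_mono) auto
    also have "\<dots> \<le> (\<integral>\<^sup>+\<omega>. ennreal \<bar>Z \<omega>\<bar> ^ 2 \<partial>M) * (\<integral>\<^sup>+\<omega>. ennreal \<bar>J \<omega> - ?W \<omega>\<bar> ^ 2 \<partial>M)"
      by (rule Cauchy_Schwarz_nn_integral) auto
    also have "\<dots> = sq_norm M Z * sq_norm M (\<lambda>\<omega>. J \<omega> - ?W \<omega>)"
      unfolding sq_norm_def by (simp add: ennreal_power)
    finally show ?thesis .
  qed
  have finZ: "sq_norm M Z < \<infinity>"
    unfolding sq_norm_def using Z(2) by (subst nn_integral_eq_integral) auto
  have "(\<lambda>m. sq_norm M Z * sq_norm M (\<lambda>\<omega>. J \<omega> - wiener_sum s (xs m) \<omega>)) \<longlonglongrightarrow> sq_norm M Z * 0"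
    by (rule ennreal_tendsto_cmult[OF _ lim]) (use finZ in simp)
  from tendsto_lowerbound[OF this, of "(ennreal \<bar>expectation (\<lambda>\<omega>. Z \<omega> * J \<omega>)\<bar>)\<^sup>2"] le
  have "(ennreal \<bar>expectation (\<lambda>\<omega>. Z \<omega> * J \<omega>)\<bar>)\<^sup>2 \<le> 0" by auto
  then show ?thesis by (simp add: power2_eq_square)
qed

text \<open>A mean-square limit is an almost sure limit along a subsequence. The filtration need not contain the
null sets, so only a version of the integral is known at time \<open>u\<close>.\<close>

lemma wiener_integral_adapted:
  assumes J: "wiener_integral s u f J" and s: "0 \<le> s" "s \<le> u" and f: "f \<in> borel_measurable borel"
    and fin: "sq_norm (leb s u) f < \<infinity>"
  obtains J' where "J' \<in> borel_measurable (F u)" "AE \<omega> in M. J' \<omega> = J \<omega>"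
proof -
  obtain xs where xs: "\<And>m. nodes_in s u (xs m)"
    and lim: "(\<lambda>m. sq_norm M (\<lambda>\<omega>. J \<omega> - wiener_sum s (xs m) \<omega>)) \<longlonglongrightarrow> 0"
    using J unfolding wiener_integral_def by blast
  have [measurable]: "J \<in> borel_measurable M" using J by (auto simp: wiener_integral_def)
  have [measurable]: "wiener_sum s (xs m) \<in> borel_measurable M" for m
    using measurable_wiener_sum_M[OF s(1) xs] .
  have i: "integrable M (\<lambda>\<omega>. (J \<omega> - wiener_sum s (xs m) \<omega>)\<^sup>2)" for m
    by (intro sq_integrable_diff wiener_integral_sq_integrable[OF J s(1) f fin] wiener_sum_sq_integrable[OF s(1) xs]) auto
  have "(\<lambda>m. ennreal (expectation (\<lambda>\<omega>. (J \<omega> - wiener_sum s (xs m) \<omega>)\<^sup>2))) \<longlonglongrightarrow> 0"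
    using lim nn_integral_eq_integral[OF i] by (simp add: sq_norm_def)
  then have "(\<lambda>m. expectation (\<lambda>\<omega>. (J \<omega> - wiener_sum s (xs m) \<omega>)\<^sup>2)) \<longlonglongrightarrow> 0"
    by (subst (asm) ennreal_0[symmetric], subst (asm) tendsto_ennreal_iff) auto
  then obtain r where r: "AE \<omega> in M. (\<lambda>m. (J \<omega> - wiener_sum s (xs (r m)) \<omega>)\<^sup>2) \<longlonglongrightarrow> 0"
    using tendsto_L1_AE_subseq[of M "\<lambda>m \<omega>. (J \<omega> - wiener_sum s (xs m) \<omega>)\<^sup>2"] i by auto
  have "(\<lambda>\<omega>. lim (\<lambda>m. wiener_sum s (xs (r m)) \<omega>)) \<in> borel_measurable (F u)"
    by (intro borel_measurable_lim_metric measurable_wiener_sum[OF s xs])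
  moreover have "AE \<omega> in M. lim (\<lambda>m. wiener_sum s (xs (r m)) \<omega>) = J \<omega>"
    using r
  proof eventually_elim
    case (elim \<omega>)
    then have "(\<lambda>m. sqrt ((J \<omega> - wiener_sum s (xs (r m)) \<omega>)\<^sup>2)) \<longlonglongrightarrow> sqrt 0" by (rule tendsto_real_sqrt)
    then have "(\<lambda>m. J \<omega> - wiener_sum s (xs (r m)) \<omega>) \<longlonglongrightarrow> 0" by (simp add: tendsto_rabs_zero_iff)
    from tendsto_diff[OF tendsto_const[of "J \<omega>"] this]
    have "(\<lambda>m. wiener_sum s (xs (r m)) \<omega>) \<longlonglongrightarrow> J \<omega>" by simp
    then show ?case by (rule limI)
  qed
  ultimately show thesis by (rule that)
qed

text \<open>The identity \<open>B\<^sub>b + B\<^sub>t = B\<^bsub>max b t\<^esub> + B\<^bsub>min b t\<^esub>\<close>, summed over the list.\<close>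

lemma wiener_sum_max_min:
  "wiener_sum t (map (\<lambda>(d, b). (d, max b t)) xs) \<omega> =
    wiener_sum s xs \<omega> - wiener_sum s (map (\<lambda>(d, b). (d, min b t)) xs) \<omega>"
  by (induction xs) (auto simp: max_def min_def algebra_simps)

text \<open>The integrals up to \<open>s \<le> t\<close> and \<open>u\<close> may come with different approximants. Cutting the approximants on
\<open>[s, u]\<close> at \<open>t\<close> leaves two sequences that approximate \<open>f\<close> on \<open>[s, t]\<close>, and by the isometry their
sums have the same limit.\<close>

lemma wiener_integral_diff:
  assumes J: "wiener_integral s t f J" and J': "wiener_integral s u f J'"
    and s: "0 \<le> s" "s \<le> t" "t \<le> u" and f: "f \<in> borel_measurable borel"
  shows "wiener_integral t u f (\<lambda>\<omega>. J' \<omega> - J \<omega>)"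
proof -
  obtain zs where zs: "\<And>m. nodes_in s t (zs m)"
    and z1: "(\<lambda>m. sq_norm (leb s t) (\<lambda>t. f t - step_fun s (zs m) t)) \<longlonglongrightarrow> 0"
    and z2: "(\<lambda>m. sq_norm M (\<lambda>\<omega>. J \<omega> - wiener_sum s (zs m) \<omega>)) \<longlonglongrightarrow> 0"
    using J unfolding wiener_integral_def by blast
  obtain xs where xs: "\<And>m. nodes_in s u (xs m)"
    and x1: "(\<lambda>m. sq_norm (leb s u) (\<lambda>t. f t - step_fun s (xs m) t)) \<longlonglongrightarrow> 0"
    and x2: "(\<lambda>m. sq_norm M (\<lambda>\<omega>. J' \<omega> - wiener_sum s (xs m) \<omega>)) \<longlonglongrightarrow> 0"
    using J' unfolding wiener_integral_def by blast
  have [measurable]: "J \<in> borel_measurable M" "J' \<in> borel_measurable M"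
    using J J' by (auto simp: wiener_integral_def)
  \<comment> \<open>\<open>ys\<close> is the part of \<open>xs\<close> before \<open>t\<close>, \<open>ws\<close> the part after \<open>t\<close>.\<close>
  define ys where "ys m = map (\<lambda>(d, b). (d, min b t)) (xs m)" for m
  define ws where "ws m = map (\<lambda>(d, b). (d, max b t)) (xs m)" for m
  have ys: "nodes_in s t (ys m)" and ws: "nodes_in t u (ws m)" for m
    using nodes_in_min[OF xs s(2)] nodes_in_max[OF xs s(3)] by (auto simp: ys_def ws_def)
  have [measurable]: "wiener_sum s (xs m) \<in> borel_measurable M" "wiener_sum s (ys m) \<in> borel_measurable M"
    "wiener_sum s (zs m) \<in> borel_measurable M" for m
    using measurable_wiener_sum_M[OF s(1)] xs ys zs by auto
  have 1: "(\<lambda>m. sq_norm (leb t u) (\<lambda>t'. f t' - step_fun t (ws m) t')) \<longlonglongrightarrow> 0"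
  proof (rule tendsto_zero_le_ennreal[OF x1])
    fix m
    have "sq_norm (leb t u) (\<lambda>t'. f t' - step_fun t (ws m) t') = sq_norm (leb t u) (\<lambda>t. f t - step_fun s (xs m) t)"
      by (rule sq_norm_cong) (auto simp: ws_def step_fun_max[OF s(2)])
    also have "\<dots> \<le> sq_norm (leb s u) (\<lambda>t. f t - step_fun s (xs m) t)"
      by (rule sq_norm_leb_mono) (use s in auto)
    finally show "sq_norm (leb t u) (\<lambda>t'. f t' - step_fun t (ws m) t') \<le> \<dots>" .
  qed
  have yz: "(\<lambda>m. sq_norm M (\<lambda>\<omega>. wiener_sum s (ys m) \<omega> - wiener_sum s (zs m) \<omega>)) \<longlonglongrightarrow> 0"
  proof (rule tendsto_zero_le_ennreal[OF tendsto_two_mult_add_zero_ennreal[OF x1 z1]])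
    fix m
    let ?v = "ys m @ map (\<lambda>(d, b). (- d, b)) (zs m)"
    have sp: "space M \<in> sets (F s)" using sets.top[of "F s"] by simp
    have "sq_norm M (\<lambda>\<omega>. wiener_sum s (ys m) \<omega> - wiener_sum s (zs m) \<omega>)
        = (\<integral>\<^sup>+\<omega>\<in>space M. ennreal ((wiener_sum s ?v \<omega>)\<^sup>2) \<partial>M)"
      unfolding sq_norm_def by (intro nn_integral_cong) simp
    also have "\<dots> = emeasure M (space M) * sq_norm (leb s t) (step_fun s ?v)"
      by (rule wiener_sum_isometry[OF s(1) sp]) (use ys zs in simp)
    also have "\<dots> = sq_norm (leb s t) (\<lambda>r. step_fun s (xs m) r - step_fun s (zs m) r)"
      by (simp add: emeasure_space_1 ys_def)
        (rule sq_norm_cong, simp add: step_fun_min)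
    also have "\<dots> \<le> 2 * sq_norm (leb s t) (\<lambda>r. step_fun s (xs m) r - f r)
        + 2 * sq_norm (leb s t) (\<lambda>r. f r - step_fun s (zs m) r)"
      by (rule sq_norm_triangle) (intro measurable_leb borel_measurable_step_fun f)+
    also have "sq_norm (leb s t) (\<lambda>r. step_fun s (xs m) r - f r) = sq_norm (leb s t) (\<lambda>r. f r - step_fun s (xs m) r)"
      by (rule sq_norm_cong) (simp add: power2_commute)
    also have "\<dots> \<le> sq_norm (leb s u) (\<lambda>r. f r - step_fun s (xs m) r)"
      by (rule sq_norm_leb_mono) (use s in auto)
    finally show "sq_norm M (\<lambda>\<omega>. wiener_sum s (ys m) \<omega> - wiener_sum s (zs m) \<omega>)
      \<le> 2 * sq_norm (leb s u) (\<lambda>t. f t - step_fun s (xs m) t)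
        + 2 * sq_norm (leb s t) (\<lambda>t. f t - step_fun s (zs m) t)"
      by (simp add: mult_left_mono add_mono)
  qed
  have 2: "(\<lambda>m. sq_norm M (\<lambda>\<omega>. (J' \<omega> - J \<omega>) - wiener_sum t (ws m) \<omega>)) \<longlonglongrightarrow> 0"
  proof (rule tendsto_zero_le_ennreal[OF tendsto_two_mult_add_zero_ennreal[OF x2
        tendsto_two_mult_add_zero_ennreal[OF yz z2]]])
    fix m
    have "sq_norm M (\<lambda>\<omega>. (J' \<omega> - J \<omega>) - wiener_sum t (ws m) \<omega>) =
      sq_norm M (\<lambda>\<omega>. (J' \<omega> - wiener_sum s (xs m) \<omega>) + (wiener_sum s (ys m) \<omega> - J \<omega>))"
      by (rule sq_norm_cong) (simp add: ws_def ys_def wiener_sum_max_min[of t _ _ s] algebra_simps)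
    also have "\<dots> \<le> 2 * sq_norm M (\<lambda>\<omega>. J' \<omega> - wiener_sum s (xs m) \<omega>) + 2 * sq_norm M (\<lambda>\<omega>. wiener_sum s (ys m) \<omega> - J \<omega>)"
      by (rule sq_norm_add_le) auto
    also have "sq_norm M (\<lambda>\<omega>. wiener_sum s (ys m) \<omega> - J \<omega>) \<le>
        2 * sq_norm M (\<lambda>\<omega>. wiener_sum s (ys m) \<omega> - wiener_sum s (zs m) \<omega>) +
        2 * sq_norm M (\<lambda>\<omega>. wiener_sum s (zs m) \<omega> - J \<omega>)"
      by (rule sq_norm_triangle) auto
    also have "sq_norm M (\<lambda>\<omega>. wiener_sum s (zs m) \<omega> - J \<omega>) = sq_norm M (\<lambda>\<omega>. J \<omega> - wiener_sum s (zs m) \<omega>)"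
      by (rule sq_norm_cong) (simp add: power2_commute)
    finally show "sq_norm M (\<lambda>\<omega>. (J' \<omega> - J \<omega>) - wiener_sum t (ws m) \<omega>) \<le>
      2 * sq_norm M (\<lambda>\<omega>. J' \<omega> - wiener_sum s (xs m) \<omega>) +
      2 * (2 * sq_norm M (\<lambda>\<omega>. wiener_sum s (ys m) \<omega> - wiener_sum s (zs m) \<omega>) +
        2 * sq_norm M (\<lambda>\<omega>. J \<omega> - wiener_sum s (zs m) \<omega>))"
      by (simp add: mult_left_mono add_mono)
  qed
  show ?thesis
    unfolding wiener_integral_def using ws 1 2 by auto
qed

lemma wiener_integral_minus_const:
  assumes J: "wiener_integral s u f J" and s: "0 \<le> s" "s \<le> u"
  shows "wiener_integral s u (\<lambda>t. f t - \<alpha>) (\<lambda>\<omega>. J \<omega> - \<alpha> * (B u \<omega> - B s \<omega>))"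
proof -
  obtain xs where xs: "\<And>m. nodes_in s u (xs m)"
    and x1: "(\<lambda>m. sq_norm (leb s u) (\<lambda>t. f t - step_fun s (xs m) t)) \<longlonglongrightarrow> 0"
    and x2: "(\<lambda>m. sq_norm M (\<lambda>\<omega>. J \<omega> - wiener_sum s (xs m) \<omega>)) \<longlonglongrightarrow> 0"
    using J unfolding wiener_integral_def by blast
  have "J \<in> borel_measurable M" using J by (auto simp: wiener_integral_def)
  moreover have "sq_norm (leb s u) (\<lambda>t. f t - \<alpha> - step_fun s ((- \<alpha>, u) # xs m) t)
      = sq_norm (leb s u) (\<lambda>t. f t - step_fun s (xs m) t)" for m
    by (rule sq_norm_cong) auto
  moreover have "sq_norm M (\<lambda>\<omega>. J \<omega> - \<alpha> * (B u \<omega> - B s \<omega>) - wiener_sum s ((- \<alpha>, u) # xs m) \<omega>)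
      = sq_norm M (\<lambda>\<omega>. J \<omega> - wiener_sum s (xs m) \<omega>)" for m
    by (rule sq_norm_cong) auto
  ultimately show ?thesis
    unfolding wiener_integral_def using xs x1 x2 s measurable_B_M
    by (intro conjI exI[of _ "\<lambda>m. (- \<alpha>, u) # xs m"]) (auto simp del: step_fun_simps wiener_sum_simps)
qed

lemma bounded_imp_sq_integrable:
  fixes g :: "'a \<Rightarrow> real"
  assumes "g \<in> borel_measurable M" "bounded (g ` space M)"
  shows "integrable M (\<lambda>\<omega>. (g \<omega>)\<^sup>2)"
proof -
  obtain C where C: "\<And>\<omega>. \<omega> \<in> space M \<Longrightarrow> \<bar>g \<omega>\<bar> \<le> C"
    using assms(2) by (auto simp: bounded_iff)
  have "(g \<omega>)\<^sup>2 \<le> C\<^sup>2" if "\<omega> \<in> space M" for \<omega>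
    using power_mono[OF C[OF that], of 2] by simp
  then show ?thesis
    using assms(1) by (intro integrable_const_bound[of _ "C\<^sup>2"] AE_I2) auto
qed

text \<open>The terms of an elementary integral are orthogonal, because every increment of \<open>B\<close> is independent of
the past, which contains its own coefficient and all earlier terms.\<close>

lemma elementary_integral_second_moment:
  assumes p: "\<And>i. i < n \<Longrightarrow> p i < p (Suc i)" and p0: "0 \<le> p 0"
    and a: "\<And>i. i < n \<Longrightarrow> a i \<in> borel_measurable (F (p i))"
    and bd: "\<And>i. i < n \<Longrightarrow> bounded (a i ` space M)" and "k \<le> n"
  shows "(\<lambda>\<omega>. elementary_integral B k p a \<omega>) \<in> borel_measurable (F (p k)) \<and>
    has_bochner_integral M (\<lambda>\<omega>. (elementary_integral B k p a \<omega>)\<^sup>2)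
      (\<Sum>i<k. expectation (\<lambda>\<omega>. (a i \<omega>)\<^sup>2) * (p (Suc i) - p i))"
  using \<open>k \<le> n\<close>
proof (induction k)
  case 0
  then show ?case by (simp add: elementary_integral_def has_bochner_integral_zero)
next
  case (Suc k)
  note mono = grid_mono[of n p, OF p]
  let ?S = "\<lambda>\<omega>. elementary_integral B k p a \<omega>" and ?D = "\<lambda>\<omega>. B (p (Suc k)) \<omega> - B (p k) \<omega>"
  have pk: "0 \<le> p k" "p k \<le> p (Suc k)" using mono[of 0 k] p[of k] p0 Suc.prems by auto
  have S: "?S \<in> borel_measurable (F (p k))" "integrable M (\<lambda>\<omega>. (?S \<omega>)\<^sup>2)"
    and hS: "has_bochner_integral M (\<lambda>\<omega>. (?S \<omega>)\<^sup>2) (\<Sum>i<k. expectation (\<lambda>\<omega>. (a i \<omega>)\<^sup>2) * (p (Suc i) - p i))"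
    using Suc by (auto simp: has_bochner_integral_iff)
  have ak: "a k \<in> borel_measurable (F (p k))" using a Suc.prems by auto
  note akM = measurable_F_M[OF ak]
  have a2: "integrable M (\<lambda>\<omega>. (a k \<omega>)\<^sup>2)"
    by (rule bounded_imp_sq_integrable) (use akM bd Suc.prems in auto)
  have Sa: "integrable M (\<lambda>\<omega>. ?S \<omega> * a k \<omega>)"
    by (intro sq_integrable_mult S a2 akM measurable_F_M[OF S(1)])
  have eq: "elementary_integral B (Suc k) p a \<omega> = ?S \<omega> + a k \<omega> * ?D \<omega>" for \<omega>
    by (simp add: elementary_integral_def)
  have m: "(\<lambda>\<omega>. ?S \<omega> + a k \<omega> * ?D \<omega>) \<in> borel_measurable (F (p (Suc k)))"
    using measurable_F_mono[OF S(1) pk(2)] measurable_F_mono[OF ak pk(2)]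
      measurable_B[of "p k" "p (Suc k)"] measurable_B[of "p (Suc k)" "p (Suc k)"] pk by auto
  have cross: "has_bochner_integral M (\<lambda>\<omega>. (?S \<omega> * a k \<omega>) * ?D \<omega>) 0"
    using integrable_mult_increment[OF pk _ Sa] expectation_mult_increment[OF pk _ Sa] S(1) ak
    by (auto simp: has_bochner_integral_iff)
  have quad: "has_bochner_integral M (\<lambda>\<omega>. (a k \<omega>)\<^sup>2 * (?D \<omega>)\<^sup>2)
      (expectation (\<lambda>\<omega>. (a k \<omega>)\<^sup>2) * (p (Suc k) - p k))"
    using integrable_mult_increment_sq[OF pk _ a2] expectation_mult_increment_sq[OF pk _ a2] ak
    by (auto simp: has_bochner_integral_iff)
  have "(?S \<omega> + a k \<omega> * ?D \<omega>)\<^sup>2 =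
      (?S \<omega>)\<^sup>2 + 2 * (?S \<omega> * a k \<omega> * ?D \<omega>) + (a k \<omega>)\<^sup>2 * (?D \<omega>)\<^sup>2" for \<omega>
    by (simp add: power2_eq_square algebra_simps)
  with has_bochner_integral_add[OF has_bochner_integral_add[OF hS
      has_bochner_integral_mult_right[OF cross, of 2]] quad] m
  show ?case by (simp add: eq)
qed

text \<open>Replacing the coefficients of an elementary integrand by their expectations keeps the grid and
  splits the squared distance to a deterministic \<open>f\<close> into the squared distance of \<open>f\<close> to the
  new step function plus the variances, which are also the squared change of the stochastic
  integral. So neither error exceeds the old one.\<close>

lemma derandomize:
  assumes S: "0 \<le> S" and el: "elementary_integrand F S T n p e" and f [measurable]: "f \<in> borel_measurable borel"
  obtains xs where "nodes_in S T xs"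
    "sq_norm (leb S T) (\<lambda>t. f t - step_fun S xs t)
      \<le> (\<integral>\<^sup>+\<omega>. (\<integral>\<^sup>+s\<in>{S..T}. ennreal ((f s - elementary_process n p e s \<omega>)\<^sup>2) \<partial>lborel) \<partial>M)"
    "sq_norm M (\<lambda>\<omega>. elementary_integral B n p e \<omega> - wiener_sum S xs \<omega>)
      \<le> (\<integral>\<^sup>+\<omega>. (\<integral>\<^sup>+s\<in>{S..T}. ennreal ((f s - elementary_process n p e s \<omega>)\<^sup>2) \<partial>lborel) \<partial>M)"
proof -
  have p0: "p 0 = S" and pn: "p n = T" and p: "\<And>i. i < n \<Longrightarrow> p i < p (Suc i)"
    and e: "\<And>i. i < n \<Longrightarrow> e i \<in> borel_measurable (F (p i))"
    and bd: "\<And>i. i < n \<Longrightarrow> bounded (e i ` space M)"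
    using el by (auto simp: elementary_integrand_def)
  note mono = grid_mono[of n p, OF p]
  have eM: "e i \<in> borel_measurable M" if "i < n" for i using measurable_F_M[OF e[OF that]] .
  define d where "d i = expectation (e i)" for i
  define v where "v i = expectation (\<lambda>\<omega>. (e i \<omega> - d i)\<^sup>2)" for i
  define xs where "xs = concat (map (\<lambda>i. [(d i, p (Suc i)), (- d i, p i)]) [0..<n])"
  have nodes: "nodes_in S T xs"
    unfolding nodes_in_def xs_def using mono[of 0] mono[of _ n] p0 pn
    by (auto simp: Suc_le_eq)
  have sf: "step_fun S xs r = (\<Sum>i<n. d i * indicator {p i..<p (Suc i)} r)" for r
  proof -
    have "step_fun S (concat (map (\<lambda>i. [(d i, p (Suc i)), (- d i, p i)]) [0..<k])) r
       = (\<Sum>i<k. d i * indicator {p i..<p (Suc i)} r)" if "k \<le> n" for k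
      using that
    proof (induction k)
      case (Suc k)
      have "S \<le> p k" "p k \<le> p (Suc k)" using mono[of 0 k] mono[of k "Suc k"] p0 Suc.prems by auto
      then show ?case using Suc by (auto simp: indicator_def)
    qed simp
    then show ?thesis unfolding xs_def by simp
  qed
  have ws: "wiener_sum S xs \<omega> = (\<Sum>i<n. d i * (B (p (Suc i)) \<omega> - B (p i) \<omega>))" for \<omega>
  proof -
    have "wiener_sum S (concat (map (\<lambda>i. [(d i, p (Suc i)), (- d i, p i)]) [0..<k])) \<omega>
       = (\<Sum>i<k. d i * (B (p (Suc i)) \<omega> - B (p i) \<omega>))" for k
      by (induction k) (auto simp: algebra_simps)
    then show ?thesis unfolding xs_def by simp
  qed
  have v0: "0 \<le> v i" for i unfolding v_def by simp
  have ei: "integrable M (e i)" "integrable M (\<lambda>\<omega>. (e i \<omega>)\<^sup>2)" if "i < n" for i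
  proof -
    show "integrable M (\<lambda>\<omega>. (e i \<omega>)\<^sup>2)"
      by (rule bounded_imp_sq_integrable) (use eM bd that in auto)
    then show "integrable M (e i)" using eM[OF that] by (rule square_integrable_imp_integrable[rotated])
  qed
  let ?A = "\<integral>\<^sup>+\<omega>. (\<integral>\<^sup>+s\<in>{S..T}. ennreal ((f s - elementary_process n p e s \<omega>)\<^sup>2) \<partial>lborel) \<partial>M"
  have meas [measurable]: "(\<lambda>(\<omega>, s). elementary_process n p e s \<omega>) \<in> borel_measurable (M \<Otimes>\<^sub>M lborel)"
    unfolding elementary_process_def case_prod_beta
  proof (intro borel_measurable_sum borel_measurable_times)
    fix i assume "i \<in> {..<n}"
    then show "(\<lambda>x. e i (fst x)) \<in> borel_measurable (M \<Otimes>\<^sub>M lborel)"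
      using measurable_compose[OF measurable_fst eM[of i]] by auto
    show "(\<lambda>x. indicator {p i..<p (Suc i)} (snd x) :: real) \<in> borel_measurable (M \<Otimes>\<^sub>M lborel)"
      by measurable
  qed
  have pw: "(\<integral>\<^sup>+\<omega>. ennreal ((f s - elementary_process n p e s \<omega>)\<^sup>2) \<partial>M)
      = ennreal ((f s - step_fun S xs s)\<^sup>2) + ennreal (\<Sum>i<n. v i * indicator {p i..<p (Suc i)} s)"
    if s: "s \<in> {S..<T}" for s
  proof -
    obtain j where j: "j < n" "s \<in> {p j..<p (Suc j)}"
      using grid_interval[of p s n] s p0 pn by auto
    have j0: "step_fun S xs s = d j" "(\<Sum>i<n. v i * indicator {p i..<p (Suc i)} s) = v j"
      unfolding sf using sum_indicator_grid[OF p j, where c = d] sum_indicator_grid[OF p j, where c = v] by blast+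
    have i1: "integrable M (\<lambda>\<omega>. (e j \<omega> - d j)\<^sup>2)"
      by (intro sq_integrable_diff eM ei) (use j in auto)
    have "(\<integral>\<^sup>+\<omega>. ennreal ((f s - elementary_process n p e s \<omega>)\<^sup>2) \<partial>M)
        = (\<integral>\<^sup>+\<omega>. ennreal ((f s - e j \<omega>)\<^sup>2) \<partial>M)"
      unfolding elementary_process_def using sum_indicator_grid[OF p j, of "\<lambda>i. e i _"] by simp
    also have "\<dots> = (\<integral>\<^sup>+\<omega>. ennreal ((f s - d j)\<^sup>2 - 2 * (f s - d j) * (e j \<omega> - d j) + (e j \<omega> - d j)\<^sup>2) \<partial>M)"
      by (intro nn_integral_cong arg_cong[of _ _ ennreal]) (simp add: power2_eq_square algebra_simps)
    also have "\<dots> = ennreal (expectation (\<lambda>\<omega>. (f s - d j)\<^sup>2 - 2 * (f s - d j) * (e j \<omega> - d j) + (e j \<omega> - d j)\<^sup>2))"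
    proof (rule nn_integral_eq_integral)
      show "AE \<omega> in M. 0 \<le> (f s - d j)\<^sup>2 - 2 * (f s - d j) * (e j \<omega> - d j) + (e j \<omega> - d j)\<^sup>2"
      proof (intro AE_I2)
        fix \<omega>
        have "0 \<le> ((f s - d j) - (e j \<omega> - d j))\<^sup>2" by simp
        also have "\<dots> = (f s - d j)\<^sup>2 - 2 * (f s - d j) * (e j \<omega> - d j) + (e j \<omega> - d j)\<^sup>2"
          by (subst power2_diff) (simp add: algebra_simps)
        finally show "0 \<le> \<dots>" .
      qed
    qed (use i1 ei[OF j(1)] in simp)
    also have "expectation (\<lambda>\<omega>. (f s - d j)\<^sup>2 - 2 * (f s - d j) * (e j \<omega> - d j) + (e j \<omega> - d j)\<^sup>2) = (f s - d j)\<^sup>2 + v j"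
      using i1 ei[OF j(1)] by (simp add: v_def d_def[symmetric] prob_space)
    finally show ?thesis
      using v0 j0 by (simp only: ennreal_plus zero_le_power2)
  qed
  have intv: "(\<integral>\<^sup>+s\<in>{S..<T}. ennreal (\<Sum>i<n. v i * indicator {p i..<p (Suc i)} s) \<partial>lborel)
      = ennreal (\<Sum>i<n. v i * (p (Suc i) - p i))"
  proof -
    have "(\<integral>\<^sup>+s\<in>{S..<T}. ennreal (\<Sum>i<n. v i * indicator {p i..<p (Suc i)} s) \<partial>lborel)
        = (\<integral>\<^sup>+s. (\<Sum>i<n. ennreal (v i) * indicator {p i..<p (Suc i)} s) \<partial>lborel)"
    proof (intro nn_integral_cong)
      fix s
      have "S \<le> p i" "p (Suc i) \<le> T" if "i < n" for i
        using mono[of 0 i] mono[of "Suc i" n] p0 pn that by auto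
      then have "indicator {p i..<p (Suc i)} s * indicator {S..<T} s = (indicator {p i..<p (Suc i)} s :: ennreal)" if "i < n" for i
        using that by (fastforce simp: indicator_def)
      moreover have "ennreal (\<Sum>i<n. v i * indicator {p i..<p (Suc i)} s)
          = (\<Sum>i<n. ennreal (v i) * indicator {p i..<p (Suc i)} s)"
        using v0 by (subst sum_ennreal[symmetric]) (auto simp: ennreal_mult ennreal_indicator intro!: mult_nonneg_nonneg)
      ultimately show "ennreal (\<Sum>i<n. v i * indicator {p i..<p (Suc i)} s) * indicator {S..<T} s
          = (\<Sum>i<n. ennreal (v i) * indicator {p i..<p (Suc i)} s)"
        by (simp only: sum_distrib_right mult.assoc) (intro sum.cong, auto)
    qed
    also have "\<dots> = (\<Sum>i<n. ennreal (v i) * ennreal (p (Suc i) - p i))"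
      using p by (subst nn_integral_sum) (auto simp: nn_integral_cmult less_imp_le)
    also have "\<dots> = ennreal (\<Sum>i<n. v i * (p (Suc i) - p i))"
      using v0 p by (subst sum_ennreal[symmetric]) (auto simp: ennreal_mult less_imp_le intro!: mult_nonneg_nonneg)
    finally show ?thesis .
  qed
  have "sq_norm (leb S T) (\<lambda>t. f t - step_fun S xs t) + ennreal (\<Sum>i<n. v i * (p (Suc i) - p i))
    = (\<integral>\<^sup>+s\<in>{S..<T}. (ennreal ((f s - step_fun S xs s)\<^sup>2) + ennreal (\<Sum>i<n. v i * indicator {p i..<p (Suc i)} s)) \<partial>lborel)"
    unfolding sq_norm_leb intv[symmetric] by (simp only: distrib_right) (rule nn_integral_add[symmetric]; measurable)
  also have "\<dots> \<le> (\<integral>\<^sup>+s. (\<integral>\<^sup>+\<omega>. ennreal ((f s - elementary_process n p e s \<omega>)\<^sup>2) * indicator {S..T} s \<partial>M) \<partial>lborel)"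
  proof (intro nn_integral_mono)
    fix s
    show "(ennreal ((f s - step_fun S xs s)\<^sup>2) + ennreal (\<Sum>i<n. v i * indicator {p i..<p (Suc i)} s)) * indicator {S..<T} s
      \<le> (\<integral>\<^sup>+\<omega>. ennreal ((f s - elementary_process n p e s \<omega>)\<^sup>2) * indicator {S..T} s \<partial>M)"
      using pw[of s] by (cases "s \<in> {S..<T}") auto
  qed
  also have "\<dots> = ?A"
  proof (rule pair_sigma_finite.Fubini')
    show "pair_sigma_finite M lborel" by unfold_locales
    show "(\<lambda>(\<omega>, s). ennreal ((f s - elementary_process n p e s \<omega>)\<^sup>2) * indicator {S..T} s) \<in> borel_measurable (M \<Otimes>\<^sub>M lborel)"
      using meas by (simp add: case_prod_beta)
  qed
  finally have tot: "sq_norm (leb S T) (\<lambda>t. f t - step_fun S xs t) + ennreal (\<Sum>i<n. v i * (p (Suc i) - p i)) \<le> ?A" .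
  have "sq_norm M (\<lambda>\<omega>. elementary_integral B n p e \<omega> - wiener_sum S xs \<omega>)
      = sq_norm M (\<lambda>\<omega>. elementary_integral B n p (\<lambda>i \<omega>. e i \<omega> - d i) \<omega>)"
    by (rule sq_norm_cong) (simp add: ws elementary_integral_def sum_subtractf left_diff_distrib)
  also have "\<dots> = ennreal (\<Sum>i<n. v i * (p (Suc i) - p i))"
  proof -
    have "bounded ((\<lambda>\<omega>. e i \<omega> - d i) ` space M)" if i: "i < n" for i
    proof -
      obtain C where "\<And>\<omega>. \<omega> \<in> space M \<Longrightarrow> \<bar>e i \<omega>\<bar> \<le> C"
        using bd[of i] i by (auto simp: bounded_iff)
      then show ?thesis by (intro boundedI[of _ "C + \<bar>d i\<bar>"]) (force intro: order_trans[OF abs_triangle_ineq4])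
    qed
    then have "has_bochner_integral M (\<lambda>\<omega>. (elementary_integral B n p (\<lambda>i \<omega>. e i \<omega> - d i) \<omega>)\<^sup>2) (\<Sum>i<n. v i * (p (Suc i) - p i))"
      using elementary_integral_second_moment[of n p "\<lambda>i \<omega>. e i \<omega> - d i" n] p p0 S e unfolding v_def by auto
    then show ?thesis
      unfolding sq_norm_def by (subst nn_integral_eq_integral) (auto simp: has_bochner_integral_iff)
  qed
  finally have "sq_norm M (\<lambda>\<omega>. elementary_integral B n p e \<omega> - wiener_sum S xs \<omega>) \<le> ?A"
    using order_trans[OF add_increasing[OF zero_le order_refl] tot] by simp
  moreover have "sq_norm (leb S T) (\<lambda>t. f t - step_fun S xs t) \<le> ?A"
    using order_trans[OF add_increasing2[OF zero_le order_refl] tot] by simp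
  ultimately show thesis using that nodes by blast
qed

lemma wiener_integral_of_ito:
  assumes J: "has_ito_integral M F B (\<lambda>s \<omega>. f s) S T J" and S: "0 \<le> S" and f: "f \<in> borel_measurable borel"
  shows "wiener_integral S T f J"
proof -
  have Jm [measurable]: "J \<in> borel_measurable M" using J by (auto simp: has_ito_integral_def)
  obtain n p e where el: "\<And>m. elementary_integrand F S T (n m) (p m) (e m)"
    and 1: "(\<lambda>m. \<integral>\<^sup>+\<omega>. (\<integral>\<^sup>+s\<in>{S..T}. ennreal ((f s - elementary_process (n m) (p m) (e m) s \<omega>)\<^sup>2) \<partial>lborel) \<partial>M) \<longlonglongrightarrow> 0"
    and 2: "(\<lambda>m. sq_norm M (\<lambda>\<omega>. J \<omega> - elementary_integral B (n m) (p m) (e m) \<omega>)) \<longlonglongrightarrow> 0"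
    using J unfolding has_ito_integral_def sq_norm_def by (elim conjE exE) (rule that, simp_all add: sq_norm_def)
  let ?A = "\<lambda>m. \<integral>\<^sup>+\<omega>. (\<integral>\<^sup>+s\<in>{S..T}. ennreal ((f s - elementary_process (n m) (p m) (e m) s \<omega>)\<^sup>2) \<partial>lborel) \<partial>M"
  define P where "P m xs \<longleftrightarrow> nodes_in S T xs \<and> sq_norm (leb S T) (\<lambda>t. f t - step_fun S xs t) \<le> ?A m \<and>
     sq_norm M (\<lambda>\<omega>. elementary_integral B (n m) (p m) (e m) \<omega> - wiener_sum S xs \<omega>) \<le> ?A m" for m xs
  have "\<exists>xs. P m xs" for m
    by (rule derandomize[OF S el[of m] f]) (auto simp: P_def)
  then obtain xs where P: "\<And>m. P m (xs m)" using choice[of P] by blast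
  have xs: "nodes_in S T (xs m)"
    and x1: "sq_norm (leb S T) (\<lambda>t. f t - step_fun S (xs m) t) \<le> ?A m"
    and x2: "sq_norm M (\<lambda>\<omega>. elementary_integral B (n m) (p m) (e m) \<omega> - wiener_sum S (xs m) \<omega>) \<le> ?A m" for m
    using P[of m] unfolding P_def by auto
  have "(\<lambda>m. sq_norm (leb S T) (\<lambda>t. f t - step_fun S (xs m) t)) \<longlonglongrightarrow> 0"
    by (rule tendsto_zero_le_ennreal[OF 1 x1])
  moreover have "(\<lambda>m. sq_norm M (\<lambda>\<omega>. J \<omega> - wiener_sum S (xs m) \<omega>)) \<longlonglongrightarrow> 0"
  proof (rule tendsto_zero_le_ennreal[OF tendsto_two_mult_add_zero_ennreal[OF 2 1]])
    fix m
    have p: "0 \<le> p m i" if "i \<le> n m" for i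
      using that
    proof (induction i)
      case 0 then show ?case using el[of m] S by (simp add: elementary_integrand_def)
    next
      case (Suc i)
      moreover have "p m i < p m (Suc i)" using el[of m] Suc.prems by (simp add: elementary_integrand_def)
      ultimately show ?case by simp
    qed
    have "e m i \<in> borel_measurable M" if "i < n m" for i
      using el[of m] that measurable_F_M by (auto simp: elementary_integrand_def)
    then have [measurable]: "elementary_integral B (n m) (p m) (e m) \<in> borel_measurable M"
      unfolding elementary_integral_def[abs_def] using measurable_B_M p
      by (intro borel_measurable_sum borel_measurable_times borel_measurable_diff) auto
    have [measurable]: "wiener_sum S (xs m) \<in> borel_measurable M" by (rule measurable_wiener_sum_M[OF S xs])
    have "sq_norm M (\<lambda>\<omega>. J \<omega> - wiener_sum S (xs m) \<omega>) \<le>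
      2 * sq_norm M (\<lambda>\<omega>. J \<omega> - elementary_integral B (n m) (p m) (e m) \<omega>) +
      2 * sq_norm M (\<lambda>\<omega>. elementary_integral B (n m) (p m) (e m) \<omega> - wiener_sum S (xs m) \<omega>)"
      by (rule sq_norm_triangle) auto
    also have "\<dots> \<le> 2 * sq_norm M (\<lambda>\<omega>. J \<omega> - elementary_integral B (n m) (p m) (e m) \<omega>) + 2 * ?A m"
      using x2 by (intro add_mono mult_left_mono) auto
    finally show "sq_norm M (\<lambda>\<omega>. J \<omega> - wiener_sum S (xs m) \<omega>) \<le> \<dots>" .
  qed
  ultimately show ?thesis unfolding wiener_integral_def using xs Jm by blast
qed

end

section \<open>The maximal inequality\<close>

text \<open>Kolmogorov's inequality for a square integrable martingale, restricted to an event \<open>D\<close> of the initial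
\<open>\<sigma>\<close>-algebra. The restriction is free: after a first passage the remaining increment is still
orthogonal to everything known, so the second moment on each first-passage event can only grow.\<close>

lemma (in prob_space) kolmogorov_maximal_inequality:
  fixes S :: "nat \<Rightarrow> 'a \<Rightarrow> real" and G :: "nat \<Rightarrow> 'a measure"
  assumes space_G: "\<And>j. space (G j) = space M" and sets_G: "\<And>j. sets (G j) \<subseteq> sets M"
    and G_mono: "\<And>i j. i \<le> j \<Longrightarrow> sets (G i) \<subseteq> sets (G j)"
    and S: "\<And>j. j \<le> n \<Longrightarrow> S j \<in> borel_measurable (G j)"
    and S2: "\<And>j. j \<le> n \<Longrightarrow> integrable M (\<lambda>\<omega>. (S j \<omega>)\<^sup>2)"
    and orth: "\<And>j Z. j \<le> n \<Longrightarrow> Z \<in> borel_measurable (G j) \<Longrightarrow> integrable M (\<lambda>\<omega>. (Z \<omega>)\<^sup>2) \<Longrightarrow>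
      expectation (\<lambda>\<omega>. Z \<omega> * (S n \<omega> - S j \<omega>)) = 0"
    and D: "D \<in> sets (G 0)" and pos: "0 < \<epsilon>"
  shows "\<epsilon>\<^sup>2 * prob (D \<inter> {\<omega> \<in> space M. \<exists>j\<le>n. \<epsilon> < \<bar>S j \<omega>\<bar>})
    \<le> expectation (\<lambda>\<omega>. indicator D \<omega> * (S n \<omega>)\<^sup>2)"
proof -
  have GG: "f \<in> borel_measurable (G j)" if "f \<in> borel_measurable (G i)" "i \<le> j" for f :: "'a \<Rightarrow> real" and i j
    using measurable_from_subalg[of "G j" "G i" f borel] that space_G G_mono by (auto simp: subalgebra_def)
  have GM: "f \<in> borel_measurable M" if "f \<in> borel_measurable (G j)" for f :: "'a \<Rightarrow> real" and j
    using measurable_from_subalg[of M "G j" f borel] that space_G sets_G by (auto simp: subalgebra_def)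
  \<comment> \<open>\<open>T j\<close>: the level is exceeded for the first time at \<open>j\<close>.\<close>
  define T where "T j = D \<inter> ({\<omega> \<in> space M. \<epsilon> < \<bar>S j \<omega>\<bar>} \<inter> {\<omega> \<in> space M. \<forall>i<j. \<bar>S i \<omega>\<bar> \<le> \<epsilon>})" for j
  have TG: "T j \<in> sets (G j)" if "j \<le> n" for j
  proof -
    note S[OF that, measurable]
    have [measurable]: "S i \<in> borel_measurable (G j)" if "i \<in> {..<j}" for i
      using that \<open>j \<le> n\<close> by (intro GG[OF S, of i]) auto
    have "{\<omega> \<in> space (G j). \<epsilon> < \<bar>S j \<omega>\<bar>} \<in> sets (G j)" by measurable
    moreover have "{\<omega> \<in> space (G j). \<forall>i\<in>{..<j}. \<bar>S i \<omega>\<bar> \<le> \<epsilon>} \<in> sets (G j)"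
    proof (rule sets.sets_Collect_finite_All)
      fix i assume "i \<in> {..<j}"
      then have [measurable]: "S i \<in> borel_measurable (G j)" by fact
      show "{\<omega> \<in> space (G j). \<bar>S i \<omega>\<bar> \<le> \<epsilon>} \<in> sets (G j)" by measurable
    qed simp
    moreover have "D \<in> sets (G j)" using D G_mono[of 0 j] by auto
    ultimately have "D \<inter> ({\<omega> \<in> space (G j). \<epsilon> < \<bar>S j \<omega>\<bar>} \<inter>
        {\<omega> \<in> space (G j). \<forall>i\<in>{..<j}. \<bar>S i \<omega>\<bar> \<le> \<epsilon>}) \<in> sets (G j)"
      by (intro sets.Int)
    then show ?thesis unfolding T_def space_G by (simp add: Ball_def)
  qed
  have TM: "T j \<in> sets M" if "j \<le> n" for j using TG[OF that] sets_G by auto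
  have DM: "D \<in> sets M" using D sets_G by auto
  have disj: "disjoint_family_on T {..n}"
  proof (unfold disjoint_family_on_def, intro ballI impI)
    have *: "T i \<inter> T j = {}" if "i < j" for i j
      using that by (auto simp: T_def not_less[symmetric])
    fix i j :: nat assume "i \<noteq> j"
    then show "T i \<inter> T j = {}"
      using *[of i j] *[of j i] by (cases "i < j") (auto simp: Int_commute)
  qed
  have un: "D \<inter> {\<omega> \<in> space M. \<exists>j\<le>n. \<epsilon> < \<bar>S j \<omega>\<bar>} = (\<Union>j\<in>{..n}. T j)"
  proof (intro equalityI subsetI)
    fix \<omega> assume w: "\<omega> \<in> D \<inter> {\<omega> \<in> space M. \<exists>j\<le>n. \<epsilon> < \<bar>S j \<omega>\<bar>}"
    define j where "j = (LEAST j. \<epsilon> < \<bar>S j \<omega>\<bar>)"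
    obtain j0 where j0: "j0 \<le> n" "\<epsilon> < \<bar>S j0 \<omega>\<bar>" using w by auto
    have "\<epsilon> < \<bar>S j \<omega>\<bar>" unfolding j_def by (rule LeastI[of "\<lambda>j. \<epsilon> < \<bar>S j \<omega>\<bar>", OF j0(2)])
    moreover have "j \<le> j0" unfolding j_def by (rule Least_le[of "\<lambda>j. \<epsilon> < \<bar>S j \<omega>\<bar>", OF j0(2)])
    moreover have "\<bar>S i \<omega>\<bar> \<le> \<epsilon>" if "i < j" for i
      using not_less_Least[OF that[unfolded j_def]] by simp
    ultimately show "\<omega> \<in> (\<Union>j\<in>{..n}. T j)" using w j0 unfolding T_def by auto
  qed (auto simp: T_def)
  have iT: "integrable M (\<lambda>\<omega>. indicator (T j) \<omega> * (S n \<omega>)\<^sup>2)" if "j \<le> n" for j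
    using integrable_real_mult_indicator[OF TM[OF that] S2[OF order_refl]] by (simp add: mult.commute)
  have one: "\<epsilon>\<^sup>2 * prob (T j) \<le> expectation (\<lambda>\<omega>. indicator (T j) \<omega> * (S n \<omega>)\<^sup>2)" if j: "j \<le> n" for j
  proof -
    let ?Z = "\<lambda>\<omega>. indicator (T j) \<omega> * S j \<omega>"
    have mZ: "?Z \<in> borel_measurable (G j)" using TG[OF j] S[OF j] by auto
    have "integrable M (\<lambda>\<omega>. (S j \<omega>)\<^sup>2 * indicator (T j) \<omega>)"
      by (rule integrable_real_mult_indicator[OF TM[OF j] S2[OF j]])
    then have iZ: "integrable M (\<lambda>\<omega>. (?Z \<omega>)\<^sup>2)"
      by (rule Bochner_Integration.integrable_cong[THEN iffD1, rotated 2]) (auto simp: indicator_def)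
    have iZS: "integrable M (\<lambda>\<omega>. ?Z \<omega> * S i \<omega>)" if "i \<le> n" for i
      by (rule sq_integrable_mult[OF GM[OF mZ] GM[OF S[OF that]] iZ S2[OF that]])
    have o: "expectation (\<lambda>\<omega>. ?Z \<omega> * (S n \<omega> - S j \<omega>)) = 0" by (rule orth[OF j mZ iZ])
    have io: "integrable M (\<lambda>\<omega>. ?Z \<omega> * (S n \<omega> - S j \<omega>))"
      using Bochner_Integration.integrable_diff[OF iZS[OF order_refl] iZS[OF j]] by (simp add: algebra_simps)
    have iI: "integrable M (indicator (T j) :: 'a \<Rightarrow> real)" using TM[OF j] by (simp add: emeasure_eq_measure)
    have "\<epsilon>\<^sup>2 * prob (T j) = expectation (\<lambda>\<omega>. \<epsilon>\<^sup>2 * indicator (T j) \<omega> + 2 * (?Z \<omega> * (S n \<omega> - S j \<omega>)))"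
      using o io iI TM[OF j] by (simp del: mult_eq_0_iff)
    also have "\<dots> \<le> expectation (\<lambda>\<omega>. indicator (T j) \<omega> * (S n \<omega>)\<^sup>2)"
    proof (rule integral_mono)
      show "integrable M (\<lambda>\<omega>. \<epsilon>\<^sup>2 * indicator (T j) \<omega> + 2 * (?Z \<omega> * (S n \<omega> - S j \<omega>)))"
        using io iI by simp
      show "integrable M (\<lambda>\<omega>. indicator (T j) \<omega> * (S n \<omega>)\<^sup>2)" by (rule iT[OF j])
      fix \<omega>
      show "\<epsilon>\<^sup>2 * indicator (T j) \<omega> + 2 * (?Z \<omega> * (S n \<omega> - S j \<omega>)) \<le> indicator (T j) \<omega> * (S n \<omega>)\<^sup>2"
      proof (cases "\<omega> \<in> T j")
        case True
        then have "\<epsilon>\<^sup>2 \<le> \<bar>S j \<omega>\<bar>\<^sup>2" using pos unfolding T_def by (intro power_mono) auto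
        moreover have "(S n \<omega>)\<^sup>2 = (S j \<omega>)\<^sup>2 + 2 * (S j \<omega> * (S n \<omega> - S j \<omega>)) + (S n \<omega> - S j \<omega>)\<^sup>2"
          by (simp add: power2_eq_square algebra_simps)
        moreover have "0 \<le> (S n \<omega> - S j \<omega>)\<^sup>2" by simp
        ultimately have "\<epsilon>\<^sup>2 + 2 * (S j \<omega> * (S n \<omega> - S j \<omega>)) \<le> (S n \<omega>)\<^sup>2"
          unfolding power2_abs by linarith
        with True show ?thesis by simp
      qed simp
    qed
    finally show ?thesis .
  qed
  have "\<epsilon>\<^sup>2 * prob (D \<inter> {\<omega> \<in> space M. \<exists>j\<le>n. \<epsilon> < \<bar>S j \<omega>\<bar>}) = (\<Sum>j\<le>n. \<epsilon>\<^sup>2 * prob (T j))"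
    unfolding un using disj TM
    by (subst finite_measure_finite_Union) (auto simp: sum_distrib_left)
  also have "\<dots> \<le> (\<Sum>j\<le>n. expectation (\<lambda>\<omega>. indicator (T j) \<omega> * (S n \<omega>)\<^sup>2))"
    by (intro sum_mono one) auto
  also have "\<dots> = expectation (\<lambda>\<omega>. \<Sum>j\<le>n. indicator (T j) \<omega> * (S n \<omega>)\<^sup>2)"
    using iT by (subst Bochner_Integration.integral_sum) auto
  also have "\<dots> \<le> expectation (\<lambda>\<omega>. indicator D \<omega> * (S n \<omega>)\<^sup>2)"
  proof (rule integral_mono)
    show "integrable M (\<lambda>\<omega>. \<Sum>j\<le>n. indicator (T j) \<omega> * (S n \<omega>)\<^sup>2)"
      using iT by (intro Bochner_Integration.integrable_sum) auto
    show "integrable M (\<lambda>\<omega>. indicator D \<omega> * (S n \<omega>)\<^sup>2)"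
      using integrable_real_mult_indicator[OF DM S2[OF order_refl]] by (simp add: mult.commute)
    fix \<omega>
    have "(\<Sum>j\<le>n. indicator (T j) \<omega>) = (indicator (\<Union>j\<in>{..n}. T j) \<omega> :: real)"
      by (rule indicator_UN_disjoint[symmetric]) (use disj in auto)
    also have "\<dots> \<le> indicator D \<omega>" by (auto simp: indicator_def T_def)
    finally show "(\<Sum>j\<le>n. indicator (T j) \<omega> * (S n \<omega>)\<^sup>2) \<le> indicator D \<omega> * (S n \<omega>)\<^sup>2"
      unfolding sum_distrib_right[symmetric] by (rule mult_right_mono) simp
  qed
  finally show ?thesis .
qed

text \<open>\<open>I\<close> is a continuous version of the process of Wiener integrals of \<open>f\<close> from \<open>t0\<close>.\<close>

locale wiener_process = brownian +
  fixes t0 :: real and f :: "real \<Rightarrow> real" and I :: "real \<Rightarrow> 'a \<Rightarrow> real"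
  assumes t0: "0 \<le> t0" and f: "f \<in> borel_measurable borel"
    and fin: "\<And>u. sq_norm (leb t0 u) f < \<infinity>"
    and wiener: "\<And>t. t0 \<le> t \<Longrightarrow> wiener_integral t0 t f (I t)"
    and cont: "AE \<omega> in M. continuous_on {t0..} (\<lambda>t. I t \<omega>)"
begin

lemma wiener_increment:
  "t0 \<le> s \<Longrightarrow> s \<le> t \<Longrightarrow> wiener_integral s t f (\<lambda>\<omega>. I t \<omega> - I s \<omega>)"
  using wiener_integral_diff[OF wiener[of s] wiener[of t] t0] f by auto

lemma sq_norm_finite: "t0 \<le> s \<Longrightarrow> sq_norm (leb s u) f < \<infinity>"
  using sq_norm_leb_mono[of t0 s u u f] fin[of u] order_le_less_trans by blast

lemma measurable_I: "t0 \<le> t \<Longrightarrow> I t \<in> borel_measurable M"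
  using wiener[of t] by (auto simp: wiener_integral_def)

text \<open>Kolmogorov's inequality on the dyadic grids of \<open>[s, u]\<close>. The exceptional events increase with the grid,
and for a continuous path the supremum over all grids is the supremum over \<open>[s, u]\<close>. The event is stated through a measurable cover
\<open>K\<close> because continuity is only almost sure.\<close>

lemma maximal_inequality:
  assumes s: "t0 \<le> s" "s < u" and D: "D \<in> sets (F s)" and pos: "0 < \<epsilon>"
    and V: "sq_norm (leb s u) f \<le> ennreal V" "0 \<le> V"
  obtains K where "K \<in> sets M" "prob (D \<inter> K) \<le> 4 * prob D * V / \<epsilon>\<^sup>2"
    "AE \<omega> in M. \<omega> \<notin> K \<longrightarrow> (\<forall>t\<in>{s..u}. \<bar>I t \<omega> - I s \<omega>\<bar> \<le> \<epsilon>)"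
proof -
  have s0: "0 \<le> s" using s t0 by simp
  have DM: "D \<in> sets M" using D sets_F_subset by auto
  define P where "P t J \<longleftrightarrow> (t \<in> {s..u} \<longrightarrow> J \<in> borel_measurable (F t) \<and> (AE \<omega> in M. J \<omega> = I t \<omega> - I s \<omega>))"
    for t J
  have "\<exists>J. P t J" for t
  proof (cases "t \<in> {s..u}")
    case True
    then show ?thesis
      using wiener_integral_adapted[OF wiener_increment[of s t] s0 _ f sq_norm_finite] s unfolding P_def by auto
  qed (auto simp: P_def)
  then obtain J where J: "\<And>t. P t (J t)" using choice[of P] by blast
  have J1: "J t \<in> borel_measurable (F t)" and J2: "AE \<omega> in M. J t \<omega> = I t \<omega> - I s \<omega>" if "t \<in> {s..u}" for t
    using J[of t] that by (auto simp: P_def)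
  have J3: "J t \<in> borel_measurable M" if "t \<in> {s..u}" for t using measurable_F_M[OF J1[OF that]] .
  have Jsq: "integrable M (\<lambda>\<omega>. (J t \<omega>)\<^sup>2)" if t: "t \<in> {s..u}" for t
  proof -
    have "integrable M (\<lambda>\<omega>. (I t \<omega> - I s \<omega>)\<^sup>2)"
      by (rule wiener_integral_sq_integrable[OF wiener_increment s0 f sq_norm_finite]) (use s t in auto)
    then show ?thesis
      by (rule integrable_cong_AE_imp) (use J2[OF t] J3[OF t] in auto)
  qed
  define q where "q m j = s + (u - s) * (real j / 2 ^ m)" for m j :: nat
  have q: "q m j \<in> {s..u}" if "j \<le> 2 ^ m" for m j
  proof -
    have "(u - s) * (real j / 2 ^ m) \<le> (u - s) * 1"
      using that s by (intro mult_left_mono) (auto simp: divide_le_eq)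
    then show ?thesis using s by (auto simp: q_def)
  qed
  have qmono: "i \<le> j \<Longrightarrow> q m i \<le> q m j" for i j m
    unfolding q_def using s by (intro add_left_mono mult_left_mono divide_right_mono) auto
  define Km where "Km m = {\<omega> \<in> space M. \<exists>j\<le>2 ^ m. \<epsilon> < \<bar>J (q m j) \<omega>\<bar>}" for m :: nat
  have KmM: "Km m \<in> sets M" for m
  proof -
    have "{\<omega> \<in> space M. \<epsilon> < \<bar>J (q m j) \<omega>\<bar>} \<in> sets M" if "j \<in> {..2 ^ m}" for j
      using borel_measurable_less[OF borel_measurable_const[of \<epsilon>] borel_measurable_abs[OF J3[OF q]], of j m] that
      by simp
    then have "(\<Union>j\<in>{..2 ^ m}. {\<omega> \<in> space M. \<epsilon> < \<bar>J (q m j) \<omega>\<bar>}) \<in> sets M"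
      by (intro sets.finite_UN) auto
    also have "(\<Union>j\<in>{..2 ^ m}. {\<omega> \<in> space M. \<epsilon> < \<bar>J (q m j) \<omega>\<bar>}) = Km m"
      unfolding Km_def by blast
    finally show ?thesis .
  qed
  have bound: "prob (D \<inter> Km m) \<le> 4 * prob D * V / \<epsilon>\<^sup>2" for m
  proof -
    let ?n = "2 ^ m :: nat"
    have qn: "q m ?n = u" by (simp add: q_def)
    have "\<epsilon>\<^sup>2 * prob (D \<inter> {\<omega> \<in> space M. \<exists>j\<le>?n. \<epsilon> < \<bar>J (q m j) \<omega>\<bar>})
      \<le> expectation (\<lambda>\<omega>. indicator D \<omega> * (J (q m ?n) \<omega>)\<^sup>2)"
    proof (rule kolmogorov_maximal_inequality[where G = "\<lambda>j. F (q m j)"])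
      fix j :: nat and Z :: "'a \<Rightarrow> real"
      assume j: "j \<le> ?n" and Z: "Z \<in> borel_measurable (F (q m j))" "integrable M (\<lambda>\<omega>. (Z \<omega>)\<^sup>2)"
      have "expectation (\<lambda>\<omega>. Z \<omega> * (J (q m ?n) \<omega> - J (q m j) \<omega>)) = expectation (\<lambda>\<omega>. Z \<omega> * (I u \<omega> - I (q m j) \<omega>))"
      proof (rule integral_cong_AE)
        have "AE \<omega> in M. J (q m ?n) \<omega> = I u \<omega> - I s \<omega>" using J2[OF q, of ?n m] qn by simp
        then show "AE \<omega> in M. Z \<omega> * (J (q m ?n) \<omega> - J (q m j) \<omega>) = Z \<omega> * (I u \<omega> - I (q m j) \<omega>)"
          using J2[OF q[OF j]] by eventually_elim simp
        show "(\<lambda>\<omega>. Z \<omega> * (J (q m ?n) \<omega> - J (q m j) \<omega>)) \<in> borel_measurable M"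
          using measurable_F_M[OF Z(1)] J3[OF q[OF j]] J3[OF q, of ?n m] by auto
        show "(\<lambda>\<omega>. Z \<omega> * (I u \<omega> - I (q m j) \<omega>)) \<in> borel_measurable M"
          using measurable_F_M[OF Z(1)] measurable_I q[OF j] s by auto
      qed
      also have "\<dots> = 0"
        by (rule wiener_integral_orthogonal[OF wiener_increment _ f sq_norm_finite Z]) (use q[OF j] s s0 in auto)
      finally show "expectation (\<lambda>\<omega>. Z \<omega> * (J (q m ?n) \<omega> - J (q m j) \<omega>)) = 0" .
    next
      show "D \<in> sets (F (q m 0))" using D by (simp add: q_def)
    next
      show "sets (F (q m i)) \<subseteq> sets (F (q m j))" if "i \<le> j" for i j
        by (rule sets_F_mono[OF qmono[OF that]])
      show "sets (F (q m j)) \<subseteq> sets M" for j by (rule sets_F_subset)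
      show "J (q m j) \<in> borel_measurable (F (q m j))" "integrable M (\<lambda>\<omega>. (J (q m j) \<omega>)\<^sup>2)"
        if "j \<le> ?n" for j using J1[OF q[OF that]] Jsq[OF q[OF that]] .
    qed (simp_all add: pos)
    also have "\<dots> = expectation (\<lambda>\<omega>. indicator D \<omega> * (J u \<omega>)\<^sup>2)" by (simp only: qn)
    finally have le: "\<epsilon>\<^sup>2 * prob (D \<inter> Km m) \<le> expectation (\<lambda>\<omega>. indicator D \<omega> * (J u \<omega>)\<^sup>2)"
      unfolding Km_def .
    have "ennreal (expectation (\<lambda>\<omega>. indicator D \<omega> * (J u \<omega>)\<^sup>2)) = (\<integral>\<^sup>+\<omega>. ennreal (indicator D \<omega> * (J u \<omega>)\<^sup>2) \<partial>M)"
    proof (rule nn_integral_eq_integral[symmetric])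
      show "integrable M (\<lambda>\<omega>. indicator D \<omega> * (J u \<omega>)\<^sup>2)"
        using integrable_real_mult_indicator[OF DM Jsq[of u]] s by (simp add: mult.commute)
    qed simp
    also have "\<dots> = (\<integral>\<^sup>+\<omega>\<in>D. ennreal ((I u \<omega> - I s \<omega>)\<^sup>2) \<partial>M)"
    proof (rule nn_integral_cong_AE)
      have "AE \<omega> in M. J u \<omega> = I u \<omega> - I s \<omega>" using J2[of u] s by simp
      then show "AE \<omega> in M. ennreal (indicator D \<omega> * (J u \<omega>)\<^sup>2) = ennreal ((I u \<omega> - I s \<omega>)\<^sup>2) * indicator D \<omega>"
        by eventually_elim (auto simp: indicator_def)
    qed
    also have "\<dots> \<le> 4 * (emeasure M D * sq_norm (leb s u) f)"
      by (rule wiener_integral_second_moment[OF wiener_increment s0 D f]) (use s in auto)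
    also have "\<dots> \<le> 4 * (emeasure M D * ennreal V)"
      using V by (intro mult_left_mono) auto
    also have "\<dots> = ennreal (4 * (prob D * V))"
      using V by (simp add: emeasure_eq_measure ennreal_mult)
    finally have "expectation (\<lambda>\<omega>. indicator D \<omega> * (J u \<omega>)\<^sup>2) \<le> 4 * (prob D * V)"
      using V by (simp add: ennreal_le_iff)
    with le have "\<epsilon>\<^sup>2 * prob (D \<inter> Km m) \<le> 4 * (prob D * V)" by (rule order_trans)
    then show ?thesis using pos by (simp add: field_simps)
  qed
  have inc: "incseq (\<lambda>m. D \<inter> Km m)"
  proof (rule incseq_SucI, rule Int_mono[OF order_refl], rule subsetI)
    fix m \<omega> assume w: "\<omega> \<in> Km m"
    then obtain j where j: "j \<le> 2 ^ m" "\<epsilon> < \<bar>J (q m j) \<omega>\<bar>" unfolding Km_def by blast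
    have "q (Suc m) (2 * j) = q m j" by (simp add: q_def)
    with j have "2 * j \<le> 2 ^ Suc m \<and> \<epsilon> < \<bar>J (q (Suc m) (2 * j)) \<omega>\<bar>" by simp
    moreover have "\<omega> \<in> space M" using w by (simp add: Km_def)
    ultimately show "\<omega> \<in> Km (Suc m)" unfolding Km_def by blast
  qed
  define K where "K = (\<Union>m. Km m)"
  have KM: "K \<in> sets M" unfolding K_def using KmM by auto
  have "(\<lambda>m. prob (D \<inter> Km m)) \<longlonglongrightarrow> prob (\<Union>m. D \<inter> Km m)"
    by (rule finite_Lim_measure_incseq[OF _ inc]) (auto intro: sets.Int[OF DM KmM])
  then have "prob (\<Union>m. D \<inter> Km m) \<le> 4 * prob D * V / \<epsilon>\<^sup>2"
    by (rule LIMSEQ_le_const2) (blast intro: bound)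
  then have 1: "prob (D \<inter> K) \<le> 4 * prob D * V / \<epsilon>\<^sup>2" unfolding K_def by (simp only: Int_UN_distrib)
  have "AE \<omega> in M. \<forall>m j. j \<le> 2 ^ m \<longrightarrow> J (q m j) \<omega> = I (q m j) \<omega> - I s \<omega>"
    unfolding AE_all_countable
  proof (intro allI)
    fix m j :: nat
    show "AE \<omega> in M. j \<le> 2 ^ m \<longrightarrow> J (q m j) \<omega> = I (q m j) \<omega> - I s \<omega>"
      using J2[OF q, of j m] by (cases "j \<le> 2 ^ m") auto
  qed
  with cont AE_space have 2: "AE \<omega> in M. \<omega> \<notin> K \<longrightarrow> (\<forall>t\<in>{s..u}. \<bar>I t \<omega> - I s \<omega>\<bar> \<le> \<epsilon>)"
  proof eventually_elim
    case (elim \<omega>)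
    show ?case
    proof (intro impI ballI)
      fix t assume nK: "\<omega> \<notin> K" and t: "t \<in> {s..u}"
      have le: "\<bar>I (q m j) \<omega> - I s \<omega>\<bar> \<le> \<epsilon>" if j: "j \<le> 2 ^ m" for m j
      proof (rule ccontr)
        assume "\<not> \<bar>I (q m j) \<omega> - I s \<omega>\<bar> \<le> \<epsilon>"
        moreover have "J (q m j) \<omega> = I (q m j) \<omega> - I s \<omega>" using elim j by blast
        ultimately have "j \<le> 2 ^ m \<and> \<epsilon> < \<bar>J (q m j) \<omega>\<bar>" using j by simp
        then have "\<omega> \<in> Km m" using elim unfolding Km_def by blast
        with nK show False by (auto simp: K_def)
      qed
      define \<theta> where "\<theta> = (t - s) / (u - s)"
      have th: "0 \<le> \<theta>" "\<theta> \<le> 1" and tth: "t = s + (u - s) * \<theta>"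
        using t s by (auto simp: \<theta>_def divide_le_eq)
      define j where "j m = nat \<lfloor>2 ^ m * \<theta>\<rfloor>" for m :: nat
      have jr: "real (j m) = of_int \<lfloor>2 ^ m * \<theta>\<rfloor>" for m using th by (simp add: j_def)
      have j1: "real (j m) \<le> 2 ^ m * \<theta>" and j2: "2 ^ m * \<theta> - 1 \<le> real (j m)" for m
        unfolding jr by linarith+
      have jm: "j m \<le> 2 ^ m" for m
      proof -
        have "2 ^ m * \<theta> \<le> 2 ^ m * 1" using th by (intro mult_left_mono) auto
        with j1[of m] have "real (j m) \<le> 2 ^ m * 1" by (rule order_trans)
        then have "real (j m) \<le> real (2 ^ m)" by simp
        then show ?thesis by (simp only: of_nat_le_iff)
      qed
      have "(\<lambda>m. real (j m) / 2 ^ m) \<longlonglongrightarrow> \<theta>"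
      proof (rule tendsto_sandwich[of "\<lambda>m. \<theta> - (1/2) ^ m" _ _ "\<lambda>m. \<theta>"])
        show "\<forall>\<^sub>F m in sequentially. \<theta> - (1 / 2) ^ m \<le> real (j m) / 2 ^ m"
        proof (intro always_eventually allI)
          fix m show "\<theta> - (1 / 2) ^ m \<le> real (j m) / 2 ^ m"
          proof -
            have "(\<theta> - (1 / 2) ^ m) * 2 ^ m = 2 ^ m * \<theta> - 1"
              by (simp add: field_simps)
            with j2[of m] show ?thesis by (simp add: le_divide_eq)
          qed
        qed
        show "\<forall>\<^sub>F m in sequentially. real (j m) / 2 ^ m \<le> \<theta>"
          using j1 by (intro always_eventually allI) (simp add: divide_le_eq mult.commute)
        have "(\<lambda>m. \<theta> - (1 / 2) ^ m) \<longlonglongrightarrow> \<theta> - 0" by (intro tendsto_intros LIMSEQ_realpow_zero) auto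
        then show "(\<lambda>m. \<theta> - (1 / 2) ^ m) \<longlonglongrightarrow> \<theta>" by simp
      qed simp
      then have qt: "(\<lambda>m. q m (j m)) \<longlonglongrightarrow> t"
        unfolding tth q_def by (intro tendsto_intros)
      have "(\<lambda>m. I (q m (j m)) \<omega>) \<longlonglongrightarrow> I t \<omega>"
      proof (rule continuous_on_tendsto_compose[OF elim(1) qt])
        show "t \<in> {t0..}" using t s by simp
        show "\<forall>\<^sub>F m in sequentially. q m (j m) \<in> {t0..}"
          using q[OF jm] s(1) by (intro always_eventually allI) (auto intro: order_trans[OF s(1)])
      qed
      then have "(\<lambda>m. \<bar>I (q m (j m)) \<omega> - I s \<omega>\<bar>) \<longlonglongrightarrow> \<bar>I t \<omega> - I s \<omega>\<bar>" by (intro tendsto_intros)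
      then show "\<bar>I t \<omega> - I s \<omega>\<bar> \<le> \<epsilon>" by (rule LIMSEQ_le_const2) (blast intro: le[OF jm])
    qed
  qed
  show thesis by (rule that[OF KM 1 2])
qed

text \<open>On a short block the noise goes down with substantial probability: the increment of \<open>I\<close> is close to
\<open>f s\<close> times the increment of \<open>B\<close>, which is nonpositive with probability at least one half even
conditionally on the past.\<close>

lemma downward_block:
  assumes s: "t0 \<le> s" "s < u" and D: "D \<in> sets (F s)" "0 < prob D" and fs: "0 \<le> f s"
    and pos: "0 < \<eta>" "0 < \<kappa>"
    and V: "sq_norm (leb s u) f \<le> ennreal V" "0 \<le> V"
    and V': "sq_norm (leb s u) (\<lambda>t. f t - f s) \<le> ennreal V'" "0 \<le> V'"
    and small: "4 * V / \<eta>\<^sup>2 + 4 * V' / \<kappa>\<^sup>2 < 1 / 2"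
  obtains E where "E \<in> sets M" "E \<subseteq> D" "0 < prob E"
    "AE \<omega> in M. \<omega> \<in> E \<longrightarrow> (\<forall>t\<in>{s..u}. \<bar>I t \<omega> - I s \<omega>\<bar> \<le> \<eta>) \<and> I u \<omega> - I s \<omega> \<le> \<kappa>"
proof -
  have s0: "0 \<le> s" using s t0 by simp
  have DM: "D \<in> sets M" using D sets_F_subset by auto
  obtain K where K: "K \<in> sets M" "prob (D \<inter> K) \<le> 4 * prob D * V / \<eta>\<^sup>2"
    "AE \<omega> in M. \<omega> \<notin> K \<longrightarrow> (\<forall>t\<in>{s..u}. \<bar>I t \<omega> - I s \<omega>\<bar> \<le> \<eta>)"
    by (rule maximal_inequality[OF s D(1) pos(1) V])
  let ?R = "\<lambda>\<omega>. I u \<omega> - I s \<omega> - f s * (B u \<omega> - B s \<omega>)"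
  have R: "wiener_integral s u (\<lambda>t. f t - f s) ?R"
    using wiener_integral_minus_const[OF wiener_increment[of s u], of "f s"] s s0 by auto
  have Rm [measurable]: "?R \<in> borel_measurable M" using R by (auto simp: wiener_integral_def)
  define L where "L = {\<omega> \<in> space M. \<kappa> < \<bar>?R \<omega>\<bar>}"
  have LM: "L \<in> sets M" unfolding L_def by measurable
  have L: "prob (D \<inter> L) \<le> 4 * prob D * V' / \<kappa>\<^sup>2"
  proof -
    have "ennreal (\<kappa>\<^sup>2) * emeasure M (D \<inter> L) = (\<integral>\<^sup>+\<omega>. ennreal (\<kappa>\<^sup>2) * indicator (D \<inter> L) \<omega> \<partial>M)"
      using DM LM by (simp add: nn_integral_cmult_indicator)
    also have "\<dots> \<le> (\<integral>\<^sup>+\<omega>\<in>D. ennreal ((?R \<omega>)\<^sup>2) \<partial>M)"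
    proof (intro nn_integral_mono)
      fix \<omega>
      have "\<kappa>\<^sup>2 \<le> (?R \<omega>)\<^sup>2" if "\<omega> \<in> L"
        using power_mono[of \<kappa> "\<bar>?R \<omega>\<bar>" 2] that pos unfolding L_def by simp
      then show "ennreal (\<kappa>\<^sup>2) * indicator (D \<inter> L) \<omega> \<le> ennreal ((?R \<omega>)\<^sup>2) * indicator D \<omega>"
        by (auto simp: indicator_def intro: ennreal_leI)
    qed
    also have "\<dots> \<le> 4 * (emeasure M D * sq_norm (leb s u) (\<lambda>t. f t - f s))"
      by (rule wiener_integral_second_moment[OF R s0 D(1)]) (use f in auto)
    also have "\<dots> \<le> 4 * (emeasure M D * ennreal V')"
      using V' by (intro mult_left_mono) auto
    finally have "ennreal (\<kappa>\<^sup>2 * prob (D \<inter> L)) \<le> ennreal (4 * (prob D * V'))"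
      using V' by (simp add: emeasure_eq_measure ennreal_mult)
    then have "\<kappa>\<^sup>2 * prob (D \<inter> L) \<le> 4 * (prob D * V')" using V' by (simp add: ennreal_le_iff)
    then show ?thesis using pos by (simp add: field_simps)
  qed
  define N where "N = {\<omega> \<in> space M. B u \<omega> - B s \<omega> \<le> 0}"
  have NM: "N \<in> sets M" proof -
    have [measurable]: "B s \<in> borel_measurable M" "B u \<in> borel_measurable M"
      using s s0 by (auto intro: measurable_B_M)
    show ?thesis unfolding N_def by measurable
  qed
  define E where "E = D \<inter> N - K - L"
  have EM: "E \<in> sets M" unfolding E_def using DM NM K LM by auto
  have "prob D / 2 \<le> prob (D \<inter> N)"
    unfolding N_def by (rule half_le_prob_Int_increment_nonpos[OF s0 s(2) D(1)])
  also have "\<dots> \<le> prob (E \<union> ((D \<inter> K) \<union> (D \<inter> L)))"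
    using EM DM K LM by (intro finite_measure_mono) (auto simp: E_def)
  also have "\<dots> \<le> prob E + prob ((D \<inter> K) \<union> (D \<inter> L))"
    using EM DM K LM by (intro measure_Un_le) auto
  also have "\<dots> \<le> prob E + (prob (D \<inter> K) + prob (D \<inter> L))"
    using DM K LM by (intro add_left_mono measure_Un_le) auto
  also have "\<dots> \<le> prob E + prob D * (4 * V / \<eta>\<^sup>2 + 4 * V' / \<kappa>\<^sup>2)"
    using K L by (simp add: algebra_simps)
  also have "\<dots> < prob E + prob D * (1 / 2)"
    using small D by simp
  finally have "0 < prob E" by simp
  moreover have "AE \<omega> in M. \<omega> \<in> E \<longrightarrow> (\<forall>t\<in>{s..u}. \<bar>I t \<omega> - I s \<omega>\<bar> \<le> \<eta>) \<and> I u \<omega> - I s \<omega> \<le> \<kappa>"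
    using K(3) AE_space
  proof eventually_elim
    case (elim \<omega>)
    have "I u \<omega> - I s \<omega> \<le> \<kappa>" if "\<omega> \<in> E"
    proof -
      have "\<bar>?R \<omega>\<bar> \<le> \<kappa>" "B u \<omega> - B s \<omega> \<le> 0" using that elim unfolding E_def N_def L_def by auto
      moreover have "f s * (B u \<omega> - B s \<omega>) \<le> 0" using calculation(2) fs by (simp add: mult_nonneg_nonpos)
      ultimately show ?thesis by linarith
    qed
    with elim show ?case unfolding E_def by auto
  qed
  ultimately show thesis using that[OF EM] unfolding E_def by auto
qed

text \<open>A union bound over the blocks, relative to \<open>D\<close>.\<close>

lemma all_blocks_small:
  fixes s :: "nat \<Rightarrow> real"
  assumes s: "t0 \<le> s 0" "\<And>n. s n < s (Suc n)" and D: "D \<in> sets (F (s 0))" "0 < prob D"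
    and pos: "\<And>n. 0 < \<epsilon> n"
    and V: "\<And>n. sq_norm (leb (s n) (s (Suc n))) f \<le> ennreal (V n)" "\<And>n. 0 \<le> V n"
    and small: "summable (\<lambda>n. 4 * V n / (\<epsilon> n)\<^sup>2)" "(\<Sum>n. 4 * V n / (\<epsilon> n)\<^sup>2) < 1"
  obtains E where "E \<in> sets M" "E \<subseteq> D" "0 < prob E"
    "AE \<omega> in M. \<omega> \<in> E \<longrightarrow> (\<forall>n. \<forall>t\<in>{s n..s (Suc n)}. \<bar>I t \<omega> - I (s n) \<omega>\<bar> \<le> \<epsilon> n)"
proof -
  have smono: "s 0 \<le> s n" for n
  proof (induction n)
    case (Suc n)
    then show ?case using s(2)[of n] by linarith
  qed simp
  have DM: "D \<in> sets M" using D sets_F_subset by auto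
  define P where "P n K \<longleftrightarrow> K \<in> sets M \<and> prob (D \<inter> K) \<le> 4 * prob D * V n / (\<epsilon> n)\<^sup>2 \<and>
    (AE \<omega> in M. \<omega> \<notin> K \<longrightarrow> (\<forall>t\<in>{s n..s (Suc n)}. \<bar>I t \<omega> - I (s n) \<omega>\<bar> \<le> \<epsilon> n))" for n K
  have "\<exists>K. P n K" for n
  proof -
    have "t0 \<le> s n" "D \<in> sets (F (s n))" using s smono[of n] D sets_F_mono[OF smono[of n]] by auto
    then show ?thesis
      by (rule maximal_inequality[OF _ s(2)[of n] _ pos[of n] V[of n]]) (unfold P_def, blast)
  qed
  then obtain K where K: "\<And>n. P n (K n)" using choice[of P] by blast
  have KM: "K n \<in> sets M" and Kp: "prob (D \<inter> K n) \<le> 4 * prob D * V n / (\<epsilon> n)\<^sup>2"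
    and Kb: "AE \<omega> in M. \<omega> \<notin> K n \<longrightarrow> (\<forall>t\<in>{s n..s (Suc n)}. \<bar>I t \<omega> - I (s n) \<omega>\<bar> \<le> \<epsilon> n)" for n
    using K[of n] by (auto simp: P_def)
  have Kp': "prob (D \<inter> K n) \<le> prob D * (4 * V n / (\<epsilon> n)\<^sup>2)" for n
    using Kp[of n] by (simp add: algebra_simps)
  have sK: "summable (\<lambda>n. prob (D \<inter> K n))"
  proof (rule summable_comparison_test'[OF summable_mult[OF small(1), of "prob D"]])
    fix n
    show "norm (prob (D \<inter> K n)) \<le> prob D * (4 * V n / (\<epsilon> n)\<^sup>2)"
      using Kp'[of n] by (simp only: real_norm_def abs_of_nonneg[OF measure_nonneg])
  qed
  have "prob (D \<inter> (\<Union>n. K n)) = prob (\<Union>n. D \<inter> K n)" by (simp only: Int_UN_distrib)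
  also have "\<dots> \<le> (\<Sum>n. prob (D \<inter> K n))"
    by (rule finite_measure_subadditive_countably) (auto intro: sets.Int[OF DM KM] sK)
  also have "\<dots> \<le> (\<Sum>n. prob D * (4 * V n / (\<epsilon> n)\<^sup>2))"
    by (rule suminf_le[OF Kp' sK summable_mult[OF small(1)]])
  also have "\<dots> = prob D * (\<Sum>n. 4 * V n / (\<epsilon> n)\<^sup>2)" by (rule suminf_mult[OF small(1)])
  also have "\<dots> < prob D * 1" using small(2) D(2) by (intro mult_strict_left_mono)
  finally have lt: "prob (D \<inter> (\<Union>n. K n)) < prob D" by simp
  define E where "E = D - (\<Union>n. K n)"
  have EM: "E \<in> sets M" unfolding E_def using DM KM by auto
  have "prob E = prob D - prob (D \<inter> (\<Union>n. K n))"
    unfolding E_def by (rule finite_measure_Diff'[OF DM]) (rule sets.countable_UN, auto intro: KM)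
  with lt have E0: "0 < prob E" by simp
  have "AE \<omega> in M. \<forall>n. \<omega> \<notin> K n \<longrightarrow> (\<forall>t\<in>{s n..s (Suc n)}. \<bar>I t \<omega> - I (s n) \<omega>\<bar> \<le> \<epsilon> n)"
    unfolding AE_all_countable using Kb by (intro allI)
  then have "AE \<omega> in M. \<omega> \<in> E \<longrightarrow> (\<forall>n. \<forall>t\<in>{s n..s (Suc n)}. \<bar>I t \<omega> - I (s n) \<omega>\<bar> \<le> \<epsilon> n)"
  proof eventually_elim
    case (elim \<omega>)
    show ?case
    proof (intro impI allI)
      fix n assume "\<omega> \<in> E"
      then have "\<omega> \<notin> K n" unfolding E_def by blast
      with elim show "\<forall>t\<in>{s n..s (Suc n)}. \<bar>I t \<omega> - I (s n) \<omega>\<bar> \<le> \<epsilon> n" by blast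
    qed
  qed
  moreover have "E \<subseteq> D" unfolding E_def by blast
  ultimately show thesis using that EM E0 by blast
qed

end

section \<open>Single paths below a barrier\<close>

text \<open>At a first contact of \<open>z\<close> with the barrier, \<open>\<bar>g\<bar>\<close> is at most twice the height \<open>A t powr - r\<close> of the
barrier, so \<open>z\<close> has slope at most \<open>c (2 A)\<^sup>k t powr - (r k)\<close>. Since \<open>r k = r + 1\<close>, this has the same order
as the slope \<open>r A t powr (- r - 1)\<close> of the barrier, and smallness of \<open>A\<close> makes it smaller. So \<open>z\<close> would
have been above the barrier just before.\<close>

lemma barrier_comparison:
  fixes c k A :: real and g h z :: "real \<Rightarrow> real"
  assumes k: "1 < k" and c: "0 < c" and A: "0 < A"
    and small: "2 powr k * c * A powr (k - 1) < 1 / (k - 1)"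
    and s: "0 < s" "s \<le> v" and g: "continuous_on {s..v} g"
    and z: "\<And>t. t \<in> {s..v} \<Longrightarrow> z t = z s + integral {s..t} (\<lambda>x. c * \<bar>g x\<bar> powr k)"
    and gz: "\<And>t. t \<in> {s..v} \<Longrightarrow> g t = z t + h t"
    and h: "\<And>t. t \<in> {s..v} \<Longrightarrow> \<bar>h t\<bar> \<le> A * t powr (- (1 / (k - 1)))"
    and start: "z s < - A * s powr (- (1 / (k - 1)))"
    and t: "t \<in> {s..v}"
  shows "z t < - A * t powr (- (1 / (k - 1)))"
proof -
  define r where "r = 1 / (k - 1)"
  have r: "0 < r" "r * k = r + 1" using k by (auto simp: r_def field_simps)
  note h = h[folded r_def] and start = start[folded r_def] and small = small[folded r_def]
  define w where "w t = z t + A * t powr (- r)" for t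
  have deriv: "(w has_real_derivative (c * \<bar>g t\<bar> powr k + A * (- r * t powr (- r - 1)))) (at t within {s..v})"
    if t: "t \<in> {s..v}" for t
  proof -
    have "continuous_on {s..v} (\<lambda>x. c * \<bar>g x\<bar> powr k)"
      using k by (intro continuous_intros continuous_on_powr' g) auto
    from integral_has_real_derivative[OF this t]
    have "((\<lambda>t. integral {s..t} (\<lambda>x. c * \<bar>g x\<bar> powr k)) has_real_derivative c * \<bar>g t\<bar> powr k) (at t within {s..v})" .
    from DERIV_add[OF DERIV_const[of "z s"] this]
    have "((\<lambda>t. z s + integral {s..t} (\<lambda>x. c * \<bar>g x\<bar> powr k)) has_real_derivative c * \<bar>g t\<bar> powr k) (at t within {s..v})"
      by simp
    then have "(z has_real_derivative c * \<bar>g t\<bar> powr k) (at t within {s..v})"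
      by (rule has_field_derivative_transform_within[OF _ zero_less_one t]) (rule z[symmetric])
    moreover have "((\<lambda>t. A * t powr (- r)) has_real_derivative A * (- r * t powr (- r - 1))) (at t within {s..v})"
      using t s by (auto intro!: derivative_eq_intros)
    ultimately show ?thesis unfolding w_def by (rule DERIV_add)
  qed
  have cw: "continuous_on {s..v} w"
    using deriv by (meson DERIV_continuous continuous_on_eq_continuous_within)
  have ws: "w s < 0" using start by (simp add: w_def)
  have "w t < 0"
  proof (rule ccontr)
    assume "\<not> w t < 0"
    define Z where "Z = {x \<in> {s..v}. 0 \<le> w x}"
    have cZ: "closed Z" unfolding Z_def
      by (rule continuous_on_closed_Collect_le[OF continuous_on_const cw]) simp
    have tZ: "t \<in> Z" using \<open>\<not> w t < 0\<close> t by (simp add: Z_def)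
    have bZ: "bdd_below Z" unfolding Z_def by (rule bdd_belowI[of _ s]) auto
    define t1 where "t1 = Inf Z"
    have t1Z: "t1 \<in> Z" unfolding t1_def using closed_contains_Inf[OF _ bZ cZ] tZ by blast
    have t1: "t1 \<in> {s..v}" "0 \<le> w t1" using t1Z by (auto simp: Z_def)
    have before: "w x < 0" if "x \<in> {s..<t1}" for x
    proof (rule ccontr)
      assume "\<not> w x < 0"
      then have "x \<in> Z" using that t1 by (simp add: Z_def)
      then have "t1 \<le> x" unfolding t1_def by (rule cInf_lower[OF _ bZ])
      with that show False by simp
    qed
    have st1: "s < t1" using t1 ws by (cases "s = t1") auto
    have w0: "w t1 = 0"
    proof (rule ccontr)
      assume "w t1 \<noteq> 0"
      have "continuous_on {s..t1} w" using cw t1 by (elim continuous_on_subset) auto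
      then obtain x where "s \<le> x" "x \<le> t1" "w x = 0"
        using IVT'[of w s 0 t1] ws t1 st1 by auto
      then show False using before[of x] \<open>w t1 \<noteq> 0\<close> by (cases "x = t1") auto
    qed
    then have "z t1 = - A * t1 powr (- r)" by (simp add: w_def)
    then have "\<bar>g t1\<bar> \<le> 2 * A * t1 powr (- r)"
      using gz[OF t1(1)] h[OF t1(1)] A by (simp add: abs_le_iff)
    then have "\<bar>g t1\<bar> powr k \<le> (2 * A * t1 powr (- r)) powr k"
      using k by (intro powr_mono2) auto
    also have "\<dots> = 2 powr k * A powr k * t1 powr (- (r * k))"
      using A st1 s by (simp add: powr_mult powr_powr)
    also have "A powr k = A powr (k - 1) * A" using A by (simp add: powr_diff)
    finally have "c * \<bar>g t1\<bar> powr k \<le> c * (2 powr k * (A powr (k - 1) * A) * t1 powr (- (r * k)))"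
      using c by (intro mult_left_mono) auto
    also have "\<dots> = (2 powr k * c * A powr (k - 1)) * (A * t1 powr (- r - 1))"
    proof -
      have "- (r * k) = - r - 1" using r by simp
      then show ?thesis by (simp only: mult_ac)
    qed
    also have "\<dots> < r * (A * t1 powr (- r - 1))"
      using small A st1 s by (intro mult_strict_right_mono) auto
    finally have "c * \<bar>g t1\<bar> powr k + A * (- r * t1 powr (- r - 1)) < 0" by (simp add: algebra_simps)
    from has_real_derivative_neg_dec_left[OF deriv[OF t1(1)] this]
    obtain d where d: "0 < d" "\<And>e. 0 < e \<Longrightarrow> t1 - e \<in> {s..v} \<Longrightarrow> e < d \<Longrightarrow> w t1 < w (t1 - e)" by blast
    define e where "e = min (d / 2) (t1 - s)"
    have e: "0 < e" "t1 - e \<in> {s..v}" "e < d" "t1 - e \<in> {s..<t1}"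
      using d(1) st1 t1 unfolding e_def by (auto simp: min_def)
    show False using d(2)[OF e(1-3)] before[OF e(4)] w0 by simp
  qed
  then show ?thesis by (simp add: w_def r_def)
qed

lemma solution_path_real:
  assumes sol: "solution_path b t0 y x" and b: "continuous_on UNIV b" and s: "t0 \<le> s" "s \<le> v" and v: "ereal v < explosion_time t0 x"
  defines "X \<equiv> \<lambda>t. real_of_ereal (x t)"
  shows "continuous_on {t0..v} X"
    and "t \<in> {s..v} \<Longrightarrow> x t = ereal (X t)"
    and "t \<in> {s..v} \<Longrightarrow> X t - y t = X s - y s + integral {s..t} (\<lambda>r. b (X r))"
proof -
  have lt: "ereal t < explosion_time t0 x" if "t \<le> v" for t
    using that v by (meson ereal_less_eq(3) order_le_less_trans)
  have fin: "\<bar>x t\<bar> \<noteq> \<infinity>" if "t \<in> {t0..v}" for t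
    using sol lt[of t] that unfolding solution_path_def by simp
  have "continuous_on {t0..v} x"
    using sol lt unfolding solution_path_def by (elim conjE continuous_on_subset) auto
  then show cX: "continuous_on {t0..v} X"
    unfolding continuous_on_def X_def using fin by (auto intro!: lim_real_of_ereal simp: ereal_real)
  show "x t = ereal (X t)" if "t \<in> {s..v}" for t
    using fin[of t] that s by (simp add: X_def ereal_real)
  have cb: "continuous_on {t0..v} (\<lambda>r. b (X r))"
    by (rule continuous_on_compose2[OF b cX]) auto
  have eq: "X t = X t0 + integral {t0..t} (\<lambda>r. b (X r)) + y t" if t: "t \<in> {t0..v}" for t
  proof -
    have "continuous_on {t0..t} (\<lambda>r. b (X r))" using cb t by (elim continuous_on_subset) auto
    then have "set_integrable lborel {t0..t} (\<lambda>r. b (X r))" by (rule borel_integrable_atLeastAtMost')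
    from set_borel_integral_eq_integral(2)[OF this] show ?thesis
      using sol lt[of t] t unfolding solution_path_def X_def by simp
  qed
  show "X t - y t = X s - y s + integral {s..t} (\<lambda>r. b (X r))" if t: "t \<in> {s..v}" for t
  proof -
    have "(\<lambda>r. b (X r)) integrable_on {t0..t}"
      using cb t by (intro integrable_continuous_real) (elim continuous_on_subset, auto)
    then have "integral {t0..s} (\<lambda>r. b (X r)) + integral {s..t} (\<lambda>r. b (X r)) = integral {t0..t} (\<lambda>r. b (X r))"
      using t s by (intro Henstock_Kurzweil_Integration.integral_combine) auto
    then show ?thesis using eq[of t] eq[of s] t s by simp
  qed
qed

lemma continuous_drift: "0 < k \<Longrightarrow> continuous_on UNIV (\<lambda>x::real. c * \<bar>x\<bar> powr k)"
  by (intro continuous_intros continuous_on_powr') auto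

text \<open>Here \<open>m\<close> is a reference value of the noise: its value at the beginning of a short block, or its limit.
Explosion is excluded along the way, since a path that explodes is positive just before.\<close>

lemma solution_stays_below_barrier:
  fixes c k A :: real
  assumes k: "1 < k" and c: "0 < c" and A: "0 < A"
    and small: "2 powr k * c * A powr (k - 1) < 1 / (k - 1)"
    and sol: "solution_path (\<lambda>x. c * \<bar>x\<bar> powr k) t0 y x"
    and s: "t0 \<le> s" "0 < s" "s \<le> u" and alive: "ereal s < explosion_time t0 x"
    and y: "\<And>t. t \<in> {s..u} \<Longrightarrow> \<bar>y t - m\<bar> \<le> A * t powr (- (1 / (k - 1)))"
    and start: "real_of_ereal (x s) - (y s - m) < - A * s powr (- (1 / (k - 1)))"
  shows "ereal u < explosion_time t0 x"
    and "real_of_ereal (x u) - (y u - m) < - A * u powr (- (1 / (k - 1)))"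
proof -
  let ?E = "explosion_time t0 x" and ?X = "\<lambda>t. real_of_ereal (x t)"
  have b: "continuous_on UNIV (\<lambda>x::real. c * \<bar>x\<bar> powr k)" using k by (intro continuous_drift) simp
  have below: "?X v - (y v - m) < - A * v powr (- (1 / (k - 1)))" and xX: "x v = ereal (?X v)"
    if v: "v \<in> {s..u}" "ereal v < ?E" for v
  proof -
    have sv: "s \<le> v" using v by simp
    note sp = solution_path_real[OF sol b s(1) sv v(2)]
    show "x v = ereal (?X v)" using sp(2)[of v] sv by simp
    show "?X v - (y v - m) < - A * v powr (- (1 / (k - 1)))"
    proof (rule barrier_comparison[OF k c A small s(2) sv, where g = ?X and h = "\<lambda>t. y t - m"
          and z = "\<lambda>t. ?X t - (y t - m)"])
      show "continuous_on {s..v} ?X" using sp(1) s by (elim continuous_on_subset) auto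
      show "?X t - (y t - m) = ?X s - (y s - m) + integral {s..t} (\<lambda>x'. c * \<bar>?X x'\<bar> powr k)" if "t \<in> {s..v}" for t
        using sp(3)[OF that] by simp
    qed (use y start v in auto)
  qed
  show Eu: "ereal u < ?E"
  proof (rule ccontr)
    assume "\<not> ereal u < ?E"
    then obtain e where e: "?E = ereal e" "e \<le> u" using alive by (cases ?E) auto
    have se: "s < e" using alive e by simp
    have "(x \<longlongrightarrow> \<infinity>) (at_left e)" using sol e(1) unfolding solution_path_def by blast
    then have "\<forall>\<^sub>F t in at_left e. 0 < x t" by (rule order_tendstoD) simp
    moreover have "\<forall>\<^sub>F t in at_left e. t \<in> {s<..<e}" using eventually_at_left_real[OF se] .
    ultimately have "\<forall>\<^sub>F t in at_left e. False"
    proof eventually_elim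
      case (elim t)
      then have t: "t \<in> {s..u}" "ereal t < ?E" using e by auto
      have "?X t < 0" using below[OF t] y[OF t(1)] by (simp add: abs_le_iff)
      with elim(1) xX[OF t] show False by (metis ereal_less(1) less_asym ereal_less_eq(3) less_ereal.simps(1) zero_ereal_def)
    qed
    then show False by simp
  qed
  show "?X u - (y u - m) < - A * u powr (- (1 / (k - 1)))" using below[of u] Eu s by simp
qed

text \<open>The path minus its noise is negative and nondecreasing. If it stayed below some \<open>e < 0\<close>, then the drift
would eventually be bounded away from zero and push it up to zero after all.\<close>

lemma solution_tends_to_zero:
  fixes c k A :: real
  assumes k: "1 < k" and c: "0 < c" and A: "0 < A"
    and small: "2 powr k * c * A powr (k - 1) < 1 / (k - 1)"
    and sol: "solution_path (\<lambda>x. c * \<bar>x\<bar> powr k) t0 y x"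
    and s: "t0 \<le> s" "0 < s" and alive: "ereal s < explosion_time t0 x"
    and y: "\<And>t. s \<le> t \<Longrightarrow> \<bar>y t - m\<bar> \<le> A * t powr (- (1 / (k - 1)))"
    and start: "real_of_ereal (x s) - (y s - m) < - A * s powr (- (1 / (k - 1)))"
  shows "(x \<longlongrightarrow> 0) at_top"
proof -
  let ?X = "\<lambda>t. real_of_ereal (x t)"
  define w where "w t = ?X t - (y t - m)" for t
  have b: "continuous_on UNIV (\<lambda>x::real. c * \<bar>x\<bar> powr k)" using k by (intro continuous_drift) simp
  have alive': "ereal u < explosion_time t0 x" and w_neg: "w u < 0" if "s \<le> u" for u
  proof -
    note * = solution_stays_below_barrier[OF k c A small sol s that alive y start]
    show "ereal u < explosion_time t0 x" by (rule *(1)) simp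
    have "w u < - A * u powr (- (1 / (k - 1)))" unfolding w_def by (rule *(2)) simp
    also have "\<dots> \<le> 0" using A by simp
    finally show "w u < 0" .
  qed
  have wint: "w v = w u + integral {u..v} (\<lambda>r. c * \<bar>?X r\<bar> powr k)"
    and cint: "(\<lambda>r. c * \<bar>?X r\<bar> powr k) integrable_on {u..v}" if "s \<le> u" "u \<le> v" for u v
  proof -
    have sv: "s \<le> v" and t0u: "t0 \<le> u" using that s by auto
    note sp = solution_path_real[OF sol b t0u that(2) alive'[OF sv]]
    show "w v = w u + integral {u..v} (\<lambda>r. c * \<bar>?X r\<bar> powr k)"
      using sp(3)[of v] that by (simp add: w_def)
    have "continuous_on {u..v} ?X" using sp(1) t0u by (elim continuous_on_subset) auto
    then show "(\<lambda>r. c * \<bar>?X r\<bar> powr k) integrable_on {u..v}"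
      by (intro integrable_continuous_real continuous_on_compose2[OF b]) auto
  qed
  have w_mono: "w u \<le> w v" if "s \<le> u" "u \<le> v" for u v
  proof -
    have "0 \<le> integral {u..v} (\<lambda>r. c * \<bar>?X r\<bar> powr k)"
      by (rule integral_nonneg[OF cint[OF that]]) (use c in simp)
    with wint[OF that] show ?thesis by simp
  qed
  have "((\<lambda>t. t powr (- (1 / (k - 1)))) \<longlongrightarrow> 0) at_top"
    by (rule tendsto_neg_powr[OF _ filterlim_ident]) (use k in simp)
  from tendsto_mult[OF tendsto_const[of A] this]
  have env: "((\<lambda>t. A * t powr (- (1 / (k - 1)))) \<longlongrightarrow> 0) at_top" by simp
  have y0: "((\<lambda>t. y t - m) \<longlongrightarrow> 0) at_top"
  proof (rule Lim_null_comparison[OF _ env])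
    show "\<forall>\<^sub>F t in at_top. norm (y t - m) \<le> A * t powr (- (1 / (k - 1)))"
      by (rule eventually_mono[OF eventually_ge_at_top[of s]]) (simp only: real_norm_def y)
  qed
  have w0: "(w \<longlongrightarrow> 0) at_top"
  proof (rule order_tendstoI)
    fix e :: real assume e: "0 < e"
    show "\<forall>\<^sub>F t in at_top. w t < e"
      by (rule eventually_mono[OF eventually_ge_at_top[of s]]) (rule less_trans[OF w_neg e])
  next
    fix e :: real assume e: "e < 0"
    show "\<forall>\<^sub>F t in at_top. e < w t"
    proof (rule ccontr)
      assume n: "\<not> ?thesis"
      have we: "w t \<le> e" if "s \<le> t" for t
      proof (rule ccontr)
        assume "\<not> w t \<le> e"
        then have "\<forall>\<^sub>F v in at_top. e < w v"
          by (intro eventually_mono[OF eventually_ge_at_top[of t]]) (rule less_le_trans[OF _ w_mono[OF that]], simp)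
        with n show False by simp
      qed
      have "\<forall>\<^sub>F t in at_top. y t - m < - e / 2"
        by (rule order_tendstoD(2)[OF y0]) (use e in simp)
      then obtain T where T: "\<And>t. T \<le> t \<Longrightarrow> y t - m < - e / 2"
        unfolding eventually_at_top_linorder by blast
      define u where "u = max s T"
      define \<beta> where "\<beta> = c * (- e / 2) powr k"
      have \<beta>: "0 < \<beta>" using c e by (simp add: \<beta>_def)
      have low: "\<beta> \<le> c * \<bar>?X r\<bar> powr k" if "u \<le> r" for r
      proof -
        have "s \<le> r" "T \<le> r" using that by (simp_all add: u_def)
        with we[of r] T[of r] have "- e / 2 \<le> \<bar>?X r\<bar>" unfolding w_def by linarith
        then show ?thesis unfolding \<beta>_def using c k e by (intro mult_left_mono powr_mono2) auto
      qed
      \<comment> \<open>The time at which a path with slope at least \<open>\<beta>\<close> has climbed from \<open>w u\<close> to zero.\<close>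
      define v where "v = u + (- w u) / \<beta>"
      have su: "s \<le> u" by (simp add: u_def)
      have "0 \<le> (- w u) / \<beta>" using w_neg[OF su] \<beta> by (intro divide_nonneg_pos) simp_all
      then have uv: "u \<le> v" unfolding v_def by linarith
      have "- w u = integral {u..v} (\<lambda>r. \<beta>)" using \<beta> uv unfolding integral_const_real by (simp add: v_def)
      also have "\<dots> \<le> integral {u..v} (\<lambda>r. c * \<bar>?X r\<bar> powr k)"
        by (rule integral_le[OF integrable_const_ivl cint[OF su uv]]) (rule low, simp)
      also have "\<dots> = w v - w u" using wint[OF su uv] by simp
      finally have "0 \<le> w v" by simp
      with w_neg[of v] su uv show False by simp
    qed
  qed
  from tendsto_add[OF w0 y0] have "((\<lambda>t. w t + (y t - m)) \<longlongrightarrow> 0) at_top" by simp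
  then have "(?X \<longlongrightarrow> 0) at_top" by (simp add: w_def)
  then have lim: "((\<lambda>t. ereal (?X t)) \<longlongrightarrow> ereal 0) at_top" by (rule tendsto_ereal)
  have "\<forall>\<^sub>F t in at_top. ereal (?X t) = x t"
  proof (rule eventually_mono[OF eventually_ge_at_top[of s]])
    fix t assume t: "s \<le> t"
    then show "ereal (?X t) = x t"
      using solution_path_real(2)[OF sol b s(1) t alive'[OF t], of t] by simp
  qed
  from tendsto_cong[OF this] lim show ?thesis by (simp add: zero_ereal_def)
qed

text \<open>Oscillations on dyadic blocks that decrease geometrically sum up.\<close>

lemma limit_of_geometric_blocks:
  fixes y :: "real \<Rightarrow> real"
  assumes T: "0 < T" and r: "0 < r" and a: "0 < a"
    and y: "\<And>n t. t \<in> {T * 2 ^ n..T * 2 ^ Suc n} \<Longrightarrow>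
      \<bar>y t - y (T * 2 ^ n)\<bar> \<le> a * (2 powr - r * (1 - 2 powr - r) / 2) * (T * 2 ^ n) powr - r"
  obtains m where "\<And>t. T \<le> t \<Longrightarrow> \<bar>y t - m\<bar> \<le> a * t powr - r"
proof -
  define \<rho> where "\<rho> = 2 powr - r"
  have \<rho>: "0 < \<rho>" "\<rho> < 1" using r powr_less_mono[of "- r" 0 2] by (auto simp: \<rho>_def)
  define l where "l n = a * (\<rho> * (1 - \<rho>) / 2) * (T powr - r * \<rho> ^ n)" for n :: nat
  have pw: "(T * 2 ^ n) powr - r = T powr - r * \<rho> ^ n" for n
  proof -
    have "(T * 2 ^ n) powr - r = T powr - r * (2 ^ n) powr - r" using T by (simp add: powr_mult)
    also have "(2 ^ n :: real) powr - r = \<rho> ^ n"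
      by (simp add: \<rho>_def powr_realpow[symmetric] powr_powr mult.commute)
    finally show ?thesis .
  qed
  have yl: "\<bar>y t - y (T * 2 ^ n)\<bar> \<le> l n" if "t \<in> {T * 2 ^ n..T * 2 ^ Suc n}" for n t
    using y[OF that] unfolding pw l_def \<rho>_def[symmetric] .
  have lsum: "(\<lambda>j. l (j + n)) sums (l n / (1 - \<rho>))" for n
  proof -
    have "(\<lambda>j. l n * \<rho> ^ j) sums (l n * (1 / (1 - \<rho>)))"
      using \<rho> by (intro sums_mult geometric_sums) auto
    moreover have "l (j + n) = l n * \<rho> ^ j" for j by (simp add: l_def power_add mult_ac)
    ultimately show ?thesis by simp
  qed
  let ?d = "\<lambda>j. y (T * 2 ^ Suc j) - y (T * 2 ^ j)"
  have d: "norm (?d j) \<le> l j" for j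
    using yl[of "T * 2 ^ Suc j" j] T by simp
  have sl: "summable l" using lsum[of 0] by (auto simp: sums_iff)
  have sd: "summable ?d" by (rule summable_comparison_test'[OF sl d])
  define m where "m = (\<Sum>j. ?d j) + y (T * 2 ^ 0)"
  have tail: "\<bar>m - y (T * 2 ^ n)\<bar> \<le> l n / (1 - \<rho>)" for n
  proof -
    have "m - y (T * 2 ^ n) = (\<Sum>j. ?d (j + n))"
      using suminf_split_initial_segment[OF sd, of n] sum_lessThan_telescope[of "\<lambda>j. y (T * 2 ^ j)" n]
      by (simp add: m_def)
    also have "\<bar>\<dots>\<bar> \<le> (\<Sum>j. l (j + n))"
    proof -
      have s1: "summable (\<lambda>j. l (j + n))" using lsum[of n] by (simp add: sums_iff)
      have s2: "summable (\<lambda>j. norm (?d (j + n)))"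
        by (rule summable_comparison_test'[OF s1]) (use d in simp)
      have "norm (\<Sum>j. ?d (j + n)) \<le> (\<Sum>j. norm (?d (j + n)))" by (rule summable_norm[OF s2])
      also have "\<dots> \<le> (\<Sum>j. l (j + n))" by (rule suminf_le[OF d s2 s1])
      finally show ?thesis by simp
    qed
    also have "\<dots> = l n / (1 - \<rho>)" using lsum[of n] by (simp add: sums_iff)
    finally show ?thesis .
  qed
  show thesis
  proof (rule that[of m])
    fix t assume t: "T \<le> t"
    obtain N where N: "t < T * 2 ^ N"
      using real_arch_pow[of 2 "t / T"] T by (auto simp: divide_less_eq mult.commute)
    obtain n where n: "t \<in> {T * 2 ^ n..<T * 2 ^ Suc n}"
    proof -
      define n where "n = (LEAST n. t < T * 2 ^ Suc n)"
      have "T * 2 ^ N \<le> T * 2 ^ Suc N" using T by (intro mult_left_mono) auto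
      with N have ex: "t < T * 2 ^ Suc N" by (rule less_le_trans)
      have 1: "t < T * 2 ^ Suc n" unfolding n_def by (rule LeastI[of "\<lambda>n. t < T * 2 ^ Suc n", OF ex])
      have 2: "T * 2 ^ n \<le> t"
      proof (cases n)
        case (Suc j)
        then have "\<not> t < T * 2 ^ Suc j" using not_less_Least[of j "\<lambda>n. t < T * 2 ^ Suc n"] n_def by simp
        then show ?thesis using Suc by simp
      qed (use t in simp)
      show thesis using that[of n] 1 2 by simp
    qed
    have "\<bar>y t - m\<bar> \<le> \<bar>y t - y (T * 2 ^ n)\<bar> + \<bar>m - y (T * 2 ^ n)\<bar>" by simp
    also have "\<dots> \<le> l n + l n / (1 - \<rho>)"
      using yl[of t n] tail[of n] n by (intro add_mono) auto
    also have "\<dots> \<le> 2 * (l n / (1 - \<rho>))"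
    proof -
      have "0 \<le> l n" using \<rho> a by (simp add: l_def)
      then have "l n * (1 - \<rho>) \<le> l n * 1" using \<rho> by (intro mult_left_mono) auto
      then have "l n \<le> l n / (1 - \<rho>)" using \<rho> by (simp only: pos_le_divide_eq mult_1_right diff_gt_0_iff_gt)
      then show ?thesis by simp
    qed
    also have "\<dots> = a * (T powr - r * \<rho> ^ Suc n)"
      using \<rho> by (simp add: l_def field_simps)
    also have "\<dots> = a * (T * 2 ^ Suc n) powr - r" by (simp only: pw)
    also have "\<dots> \<le> a * t powr - r"
      using a n T t r by (intro mult_left_mono powr_mono2') auto
    finally show "\<bar>y t - m\<bar> \<le> a * t powr - r" .
  qed
qed

section \<open>Convergence as an event\<close>

text \<open>Convergence along the rationals is a measurable event. For a path that solves the equation it is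
  equivalent to convergence, because such a path is continuous until it explodes and stays infinite
  afterwards.\<close>

definition rationally_null :: "(real \<Rightarrow> ereal) \<Rightarrow> bool" where
  "rationally_null x \<longleftrightarrow> (\<forall>j::nat. \<exists>N::nat. \<forall>q::rat. real (Suc N) \<le> of_rat q \<longrightarrow>
     - ereal (1 / real (Suc j)) \<le> x (of_rat q) \<and> x (of_rat q) \<le> ereal (1 / real (Suc j)))"

lemma rationally_null_of_tendsto:
  assumes "(x \<longlongrightarrow> 0) at_top" shows "rationally_null x"
  unfolding rationally_null_def
proof
  fix j :: nat
  let ?e = "ereal (1 / real (Suc j))"
  have "- ?e < 0" "0 < ?e" by simp_all
  then have "\<forall>\<^sub>F t in at_top. - ?e < x t" "\<forall>\<^sub>F t in at_top. x t < ?e"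
    using order_tendstoD[OF assms] by blast+
  then have "\<forall>\<^sub>F t in at_top. - ?e \<le> x t \<and> x t \<le> ?e"
    by eventually_elim (simp add: less_imp_le)
  then obtain T where T: "\<And>t. T \<le> t \<Longrightarrow> - ?e \<le> x t \<and> x t \<le> ?e"
    unfolding eventually_at_top_linorder by blast
  obtain N :: nat where N: "T \<le> real N" using real_arch_simple by blast
  show "\<exists>N::nat. \<forall>q::rat. real (Suc N) \<le> of_rat q \<longrightarrow> - ?e \<le> x (of_rat q) \<and> x (of_rat q) \<le> ?e"
  proof (intro exI[of _ N] allI impI)
    fix q :: rat assume "real (Suc N) \<le> of_rat q"
    then have "T \<le> of_rat q" using N by simp
    then show "- ?e \<le> x (of_rat q) \<and> x (of_rat q) \<le> ?e" by (rule T)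
  qed
qed

lemma tendsto_of_rationally_null:
  assumes sol: "solution_path b 1 y x" and b: "continuous_on UNIV b" and x: "rationally_null x"
  shows "(x \<longlongrightarrow> 0) at_top"
proof -
  have alive: "ereal t < explosion_time 1 x" for t
  proof (rule ccontr)
    assume "\<not> ereal t < explosion_time 1 x"
    then have le: "explosion_time 1 x \<le> ereal t" by simp
    obtain N :: nat where N: "\<And>q::rat. real (Suc N) \<le> of_rat q \<Longrightarrow> x (of_rat q) \<le> ereal (1 / real (Suc 0))"
      using x unfolding rationally_null_def by blast
    obtain q :: rat where q: "max (real (Suc N)) t < of_rat q"
      using of_rat_dense[of "max (real (Suc N)) t" "max (real (Suc N)) t + 1"] by auto
    have "explosion_time 1 x \<le> ereal (of_rat q)" using q by (intro order_trans[OF le]) simp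
    moreover have "1 \<le> (of_rat q :: real)" using q by linarith
    ultimately have "x (of_rat q) = \<infinity>" using sol unfolding solution_path_def by blast
    moreover have "x (of_rat q) \<le> ereal (1 / real (Suc 0))" using q by (intro N) simp
    ultimately show False by simp
  qed
  let ?X = "\<lambda>t. real_of_ereal (x t)"
  have xX: "x t = ereal (?X t)" if "1 \<le> t" for t
    using solution_path_real(2)[OF sol b order_refl that alive, of t] that by simp
  have "(?X \<longlongrightarrow> 0) at_top"
  proof (rule tendstoI)
    fix e :: real assume "0 < e"
    then obtain j :: nat where j: "1 / real (Suc j) < e" using nat_approx_posE by blast
    define e' where "e' = 1 / real (Suc j)"
    obtain N :: nat where N: "\<And>q::rat. real (Suc N) \<le> of_rat q \<Longrightarrow>
        - ereal e' \<le> x (of_rat q) \<and> x (of_rat q) \<le> ereal e'"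
      using x unfolding rationally_null_def e'_def by blast
    have "\<bar>?X t\<bar> \<le> e'" if t: "real (Suc N) \<le> t" for t
    proof (rule ccontr)
      assume "\<not> \<bar>?X t\<bar> \<le> e'"
      then have gt: "e' < \<bar>?X t\<bar>" by simp
      have t1: "1 \<le> t" "1 \<le> t + 1" using t by simp_all
      have "continuous_on {1..t + 1} ?X" by (rule solution_path_real(1)[OF sol b order_refl t1(2) alive])
      then have "continuous_on {1..t + 1} (\<lambda>s. \<bar>?X s\<bar>)" by (rule continuous_on_rabs)
      moreover have "t \<in> {1..t + 1}" using t1 by simp
      ultimately have "((\<lambda>s. \<bar>?X s\<bar>) \<longlongrightarrow> \<bar>?X t\<bar>) (at t within {1..t + 1})"
        unfolding continuous_on_def by blast
      from order_tendstoD(1)[OF this gt]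
      obtain d where d: "0 < d" "\<And>s. s \<in> {1..t + 1} \<Longrightarrow> s \<noteq> t \<Longrightarrow> dist s t < d \<Longrightarrow> e' < \<bar>?X s\<bar>"
        unfolding eventually_at by blast
      obtain q :: rat where q: "t < of_rat q" "of_rat q < min (t + d) (t + 1)"
        using of_rat_dense[of t "min (t + d) (t + 1)"] d(1) by auto
      have q1: "1 \<le> (of_rat q :: real)" using q t1 by linarith
      have gt_q: "e' < \<bar>?X (of_rat q)\<bar>" using q q1 by (intro d(2)) (auto simp: dist_real_def)
      have "- ereal e' \<le> ereal (?X (of_rat q)) \<and> ereal (?X (of_rat q)) \<le> ereal e'"
        using N[of q] q t unfolding xX[OF q1, symmetric] by simp
      then have "- e' \<le> ?X (of_rat q)" "?X (of_rat q) \<le> e'" by simp_all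
      with gt_q show False by linarith
    qed
    then have le: "dist (?X t) 0 < e" if "real (Suc N) \<le> t" for t
      using that j unfolding e'_def dist_real_def diff_0_right by (meson le_less_trans)
    show "\<forall>\<^sub>F t in at_top. dist (?X t) 0 < e"
      by (rule eventually_mono[OF eventually_ge_at_top le])
  qed
  then have lim: "((\<lambda>t. ereal (?X t)) \<longlongrightarrow> ereal 0) at_top" by (rule tendsto_ereal)
  have "\<forall>\<^sub>F t in at_top. ereal (?X t) = x t"
    by (rule eventually_mono[OF eventually_ge_at_top[of 1]]) (rule xX[symmetric])
  from tendsto_cong[OF this] lim show ?thesis by (simp add: zero_ereal_def)
qed

lemma sets_rationally_null:
  assumes X: "\<And>t. 1 \<le> t \<Longrightarrow> X t \<in> borel_measurable M"
  shows "{\<omega> \<in> space M. rationally_null (\<lambda>t. X t \<omega>)} \<in> sets M"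
  unfolding rationally_null_def
proof (intro sets.sets_Collect_countable_All sets.sets_Collect_countable_Ex)
  fix j N :: nat and q :: rat
  show "{\<omega> \<in> space M. real (Suc N) \<le> of_rat q \<longrightarrow>
     - ereal (1 / real (Suc j)) \<le> X (of_rat q) \<omega> \<and> X (of_rat q) \<omega> \<le> ereal (1 / real (Suc j))} \<in> sets M"
  proof (cases "real (Suc N) \<le> of_rat q")
    case True
    then have "1 \<le> (of_rat q :: real)" by linarith
    then have [measurable]: "X (of_rat q) \<in> borel_measurable M" by (rule X)
    have "{\<omega> \<in> space M. - ereal (1 / real (Suc j)) \<le> X (of_rat q) \<omega> \<and> X (of_rat q) \<omega> \<le> ereal (1 / real (Suc j))} \<in> sets M"
      by measurable
    then show ?thesis using True by simp
  qed simp
qed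

lemma path_prob_tendsto_pos:
  assumes "prob_space M" and X: "\<And>t. 1 \<le> t \<Longrightarrow> X t \<in> borel_measurable M"
    and sol: "AE \<omega> in M. solution_path b 1 (\<lambda>t. Y t \<omega>) (\<lambda>t. X t \<omega>)" and b: "continuous_on UNIV b"
    and E: "E \<in> sets M" "0 < measure M E"
    and conv: "AE \<omega> in M. \<omega> \<in> E \<longrightarrow> ((\<lambda>t. X t \<omega>) \<longlongrightarrow> 0) at_top"
  shows "0 < path_prob M (\<lambda>\<omega>. ((\<lambda>t. X t \<omega>) \<longlongrightarrow> 0) at_top)"
proof -
  interpret prob_space M by fact
  let ?P = "{\<omega> \<in> space M. ((\<lambda>t. X t \<omega>) \<longlongrightarrow> 0) at_top}"
  let ?Q = "{\<omega> \<in> space M. rationally_null (\<lambda>t. X t \<omega>)}"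
  have Q: "?Q \<in> sets M" by (rule sets_rationally_null[OF X])
  have "AE \<omega> in M. \<omega> \<in> ?Q \<longleftrightarrow> \<omega> \<in> ?P"
    using sol
  proof eventually_elim
    case (elim \<omega>)
    show ?case
      using tendsto_of_rationally_null[OF elim b] rationally_null_of_tendsto[of "\<lambda>t. X t \<omega>"] by blast
  qed
  then have ae: "AE \<omega> in completion M. \<omega> \<in> ?Q \<longleftrightarrow> \<omega> \<in> ?P" by (rule AE_completion)
  have P: "?P \<in> sets (completion M)"
    by (rule completion.in_sets_AE[OF ae]) (use Q in auto)
  have "ennreal (prob E) = emeasure (completion M) E" using E by (simp add: emeasure_eq_measure)
  also have "\<dots> \<le> emeasure (completion M) ?P"
  proof (rule emeasure_mono_AE[OF _ P])
    have "AE \<omega> in M. \<omega> \<in> E \<longrightarrow> \<omega> \<in> ?P"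
      using conv AE_space by eventually_elim simp
    then show "AE \<omega> in completion M. \<omega> \<in> E \<longrightarrow> \<omega> \<in> ?P" by (rule AE_completion)
  qed
  finally have le: "ennreal (prob E) \<le> emeasure (completion M) ?P" .
  have "emeasure (completion M) ?P = ennreal (prob (main_part M ?P))"
    using P by (simp add: emeasure_eq_measure)
  then have fin: "emeasure (completion M) ?P = ennreal (measure (completion M) ?P)"
    by (simp add: measure_def)
  from le have "prob E \<le> measure (completion M) ?P"
    unfolding fin by (simp add: ennreal_le_iff)
  then show ?thesis using E(2) unfolding path_prob_def by linarith
qed

section \<open>Staying below the barrier with positive probability\<close>

lemma sq_norm_leb_le:
  assumes "s \<le> u" "0 \<le> C" "\<And>t. t \<in> {s..<u} \<Longrightarrow> \<bar>f t\<bar> \<le> C"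
  shows "sq_norm (leb s u) f \<le> ennreal ((u - s) * C\<^sup>2)"
proof -
  have "sq_norm (leb s u) f \<le> (\<integral>\<^sup>+t. ennreal (C\<^sup>2) * indicator {s..<u} t \<partial>lborel)"
    unfolding sq_norm_leb
  proof (intro nn_integral_mono)
    fix t
    show "ennreal ((f t)\<^sup>2) * indicator {s..<u} t \<le> ennreal (C\<^sup>2) * indicator {s..<u} t"
      using power_mono[OF assms(3) abs_ge_zero, of t 2] by (cases "t \<in> {s..<u}") (auto intro: ennreal_leI)
  qed
  also have "\<dots> = ennreal ((u - s) * C\<^sup>2)"
    using assms(1) by (subst nn_integral_cmult_indicator) (auto simp: ennreal_mult' mult.commute)
  finally show ?thesis .
qed

lemma powr_neg_lipschitz:
  fixes \<beta> :: real
  assumes "0 \<le> \<beta>" "1 \<le> s" "s \<le> t"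
  shows "\<bar>t powr (- \<beta>) - s powr (- \<beta>)\<bar> \<le> \<beta> * (t - s)"
proof (cases "s = t")
  case False
  then have st: "s < t" using assms by simp
  have der: "((\<lambda>x. x powr (- \<beta>)) has_real_derivative - \<beta> * x powr (- \<beta> - 1)) (at x)" if "s \<le> x" for x
    using that assms by (auto intro!: derivative_eq_intros)
  obtain z where z: "s < z" "z < t" "t powr (- \<beta>) - s powr (- \<beta>) = (t - s) * (- \<beta> * z powr (- \<beta> - 1))"
    using MVT2[OF st, of "\<lambda>x. x powr (- \<beta>)" "\<lambda>x. - \<beta> * x powr (- \<beta> - 1)"] der by blast
  have "z powr (- \<beta> - 1) \<le> 1 powr (- \<beta> - 1)" using z assms by (intro powr_mono2') auto
  then have "\<beta> * z powr (- \<beta> - 1) \<le> \<beta> * 1" using assms by (intro mult_left_mono) auto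
  then have "(t - s) * (\<beta> * z powr (- \<beta> - 1)) \<le> (t - s) * \<beta>" using st by (intro mult_left_mono) auto
  moreover have "\<bar>t powr (- \<beta>) - s powr (- \<beta>)\<bar> = (t - s) * (\<beta> * z powr (- \<beta> - 1))"
    unfolding z(3) using st assms by (simp add: abs_mult)
  ultimately show ?thesis by (simp add: mult.commute)
qed simp

text \<open>The setting of the theorem with the stochastic integral made explicit; \<open>noise_small\<close> is the hypothesis
on \<open>\<gamma>\<close>.\<close>

locale power_drift_sde = wiener_process M F B 1 "\<lambda>t. t powr (- \<beta>)" I
  for M :: "'a measure" and F :: "real \<Rightarrow> 'a measure" and B :: "real \<Rightarrow> 'a \<Rightarrow> real"
    and \<beta> :: real and I :: "real \<Rightarrow> 'a \<Rightarrow> real" +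
  fixes k c :: real and X :: "real \<Rightarrow> 'a \<Rightarrow> ereal"
  assumes k: "1 < k" and c: "0 < c"
    and noise_small: "2 * (1 / (k - 1)) < 2 * \<beta> - 1"
    and X: "\<And>t. 1 \<le> t \<Longrightarrow> X t \<in> borel_measurable (F t)"
    and sol: "AE \<omega> in M. solution_path (\<lambda>x. c * \<bar>x\<bar> powr k) 1 (\<lambda>t. I t \<omega>) (\<lambda>t. X t \<omega>)"
begin

definition r :: real where "r = 1 / (k - 1)"

lemma r: "0 < r"
  using k by (simp add: r_def)

lemma beta: "0 < \<beta>"
  using noise_small r unfolding r_def by linarith

definition below :: "real \<Rightarrow> real \<Rightarrow> 'a set" where
  "below A t = {\<omega> \<in> space M. X t \<omega> < ereal (- A * t powr - r)}"

lemma sets_below: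
  assumes "1 \<le> t" shows "below A t \<in> sets (F t)"
proof -
  have "{\<omega> \<in> space (F t). X t \<omega> < ereal (- A * t powr - r)} \<in> sets (F t)"
    by (rule borel_measurable_less[OF X[OF assms] borel_measurable_const])
  then show ?thesis by (simp only: below_def space_F)
qed

lemma below_alive:
  assumes "\<omega> \<in> below A t" "1 \<le> t"
    and "solution_path (\<lambda>x. c * \<bar>x\<bar> powr k) 1 (\<lambda>t. I t \<omega>) (\<lambda>t. X t \<omega>)"
  shows "ereal t < explosion_time 1 (\<lambda>t. X t \<omega>)" "real_of_ereal (X t \<omega>) < - A * t powr - r"
proof -
  have lt: "X t \<omega> < ereal (- A * t powr - r)" using assms(1) by (simp add: below_def)
  show alive: "ereal t < explosion_time 1 (\<lambda>t. X t \<omega>)"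
  proof (rule ccontr)
    assume "\<not> ?thesis"
    then have "X t \<omega> = \<infinity>" using assms(2,3) unfolding solution_path_def by simp
    with lt show False by simp
  qed
  have "\<bar>X t \<omega>\<bar> \<noteq> \<infinity>" using assms(2,3) alive unfolding solution_path_def by simp
  then show "real_of_ereal (X t \<omega>) < - A * t powr - r" using lt by (cases "X t \<omega>") auto
qed

text \<open>One short block costs a little of the height \<open>A\<close> of the barrier, namely the allowance \<open>\<kappa>\<close> for an increase of
the noise over the block.\<close>

lemma prob_below_step:
  assumes s: "1 \<le> s" "s < u" "u \<le> T" and A: "2 * a \<le> A" "A' \<le> A" and a: "0 < a"
    and A_small: "2 powr k * c * A powr (k - 1) < r"
    and pos: "0 < prob (below A s)"
    and \<kappa>: "0 < \<kappa>" "\<kappa> \<le> (A - A') * T powr - r"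
    and small: "4 * (u - s) / (2 * a * T powr - r)\<^sup>2 + 4 * ((u - s) * (\<beta> * (u - s))\<^sup>2) / \<kappa>\<^sup>2 < 1 / 2"
  shows "0 < prob (below A' u)"
proof -
  have T: "0 < T" using s by simp
  have V: "sq_norm (leb s u) (\<lambda>t. t powr (- \<beta>)) \<le> ennreal (u - s)"
  proof -
    have "t powr (- \<beta>) \<le> 1" if "s \<le> t" for t
      using powr_mono2'[of "- \<beta>" 1 t] beta s that by simp
    then show ?thesis using sq_norm_leb_le[of s u 1 "\<lambda>t. t powr (- \<beta>)"] s by simp
  qed
  have V': "sq_norm (leb s u) (\<lambda>t. t powr (- \<beta>) - s powr (- \<beta>)) \<le> ennreal ((u - s) * (\<beta> * (u - s))\<^sup>2)"
  proof (rule sq_norm_leb_le)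
    fix t assume t: "t \<in> {s..<u}"
    have "\<bar>t powr (- \<beta>) - s powr (- \<beta>)\<bar> \<le> \<beta> * (t - s)"
      using t s beta by (intro powr_neg_lipschitz) auto
    also have "\<dots> \<le> \<beta> * (u - s)" using t beta by (intro mult_left_mono) auto
    finally show "\<bar>t powr (- \<beta>) - s powr (- \<beta>)\<bar> \<le> \<beta> * (u - s)" .
  qed (use s beta in auto)
  obtain E where E: "E \<in> sets M" "E \<subseteq> below A s" "0 < prob E"
    and EI: "AE \<omega> in M. \<omega> \<in> E \<longrightarrow> (\<forall>t\<in>{s..u}. \<bar>I t \<omega> - I s \<omega>\<bar> \<le> 2 * a * T powr - r) \<and> I u \<omega> - I s \<omega> \<le> \<kappa>"
  proof (rule downward_block[OF s(1,2) sets_below[OF s(1)] pos _ _ \<kappa>(1) V _ V' _ small])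
    show "0 < 2 * a * T powr - r" using a T by simp
  qed (use s in auto)
  have "AE \<omega> in M. \<omega> \<in> E \<longrightarrow> \<omega> \<in> below A' u"
    using EI sol AE_space
  proof eventually_elim
    case (elim \<omega>)
    show ?case
    proof
      assume wE: "\<omega> \<in> E"
      let ?x = "\<lambda>t. X t \<omega>"
      have osc: "\<bar>I t \<omega> - I s \<omega>\<bar> \<le> 2 * a * T powr - r" if "t \<in> {s..u}" for t
        using elim(1) wE that by blast
      have inc: "I u \<omega> - I s \<omega> \<le> \<kappa>" using elim(1) wE by blast
      have "\<omega> \<in> below A s" using wE E(2) by blast
      note alive = below_alive[OF this s(1) elim(2)]
      have osc': "\<bar>I t \<omega> - I s \<omega>\<bar> \<le> A * t powr (- (1 / (k - 1)))" if t: "t \<in> {s..u}" for t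
      proof -
        have "T powr - r \<le> t powr - r" using t s r by (intro powr_mono2') auto
        then have "2 * a * T powr - r \<le> A * t powr - r" using A a by (intro mult_mono) auto
        with osc[OF t] show ?thesis by (simp add: r_def)
      qed
      have A0: "0 < A" using A a by simp
      have s0: "0 < s" "s \<le> u" using s by simp_all
      have st: "real_of_ereal (?x s) - (I s \<omega> - I s \<omega>) < - A * s powr (- (1 / (k - 1)))"
        using alive(2) by (simp add: r_def)
      note barrier = solution_stays_below_barrier[OF k c A0 A_small[unfolded r_def] elim(2) s(1) s0 alive(1) osc' st]
      have "real_of_ereal (?x u) < - A * u powr - r + \<kappa>"
        using barrier(2) inc by (simp add: r_def)
      also have "\<dots> \<le> - A * u powr - r + (A - A') * u powr - r"
      proof -
        have "T powr - r \<le> u powr - r" using s r by (intro powr_mono2') auto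
        then have "(A - A') * T powr - r \<le> (A - A') * u powr - r" using A by (intro mult_left_mono) auto
        with \<kappa>(2) show ?thesis by simp
      qed
      also have "\<dots> = - A' * u powr - r" by (simp add: algebra_simps)
      finally have lt: "real_of_ereal (?x u) < - A' * u powr - r" .
      have "\<bar>?x u\<bar> \<noteq> \<infinity>" using elim(2) barrier(1) s unfolding solution_path_def by simp
      then have "?x u < ereal (- A' * u powr - r)" using lt by (cases "?x u") auto
      then show "\<omega> \<in> below A' u" using elim(3) by (simp add: below_def)
    qed
  qed
  moreover have "below A' u \<in> sets M" using sets_below[of u A'] s sets_F_subset by fastforce
  ultimately have "prob E \<le> prob (below A' u)" by (intro finite_measure_mono_AE) auto
  with E(3) show ?thesis by simp
qed

text \<open>With \<open>n\<close> blocks of length of order \<open>1 / n\<close> and an allowance of order \<open>1 / n\<close> for each of them, the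
two error probabilities per block are of order \<open>1 / n\<close>, while the total loss of height stays \<open>2 a\<close>.\<close>

lemma prob_below_propagates:
  assumes T: "1 < T" and a: "0 < a"
    and A_small: "\<And>A. 0 < A \<Longrightarrow> A \<le> 4 * a \<Longrightarrow> 2 powr k * c * A powr (k - 1) < r"
    and pos: "0 < prob (below (4 * a) 1)"
  shows "0 < prob (below (2 * a) T)"
proof -
  define \<eta> where "\<eta> = 2 * a * T powr - r"
  have \<eta>: "0 < \<eta>" using T a by (simp add: \<eta>_def)
  \<comment> \<open>With \<open>n\<close> blocks, the error bound of \<open>prob_below_step\<close> is exactly \<open>C / n\<close>.\<close>
  define C where "C = 4 * (T - 1) / \<eta>\<^sup>2 + 4 * ((T - 1) * (\<beta> * (T - 1))\<^sup>2) / \<eta>\<^sup>2"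
  obtain n0 :: nat where n0: "2 * C < real n0" using reals_Archimedean2 by blast
  define n where "n = Suc n0"
  have n: "0 < real n" "2 * C < real n" using n0 by (auto simp: n_def)
  define \<Delta> where "\<Delta> = (T - 1) / real n"
  have \<Delta>: "0 < \<Delta>" using T n by (simp add: \<Delta>_def)
  define s where "s i = 1 + \<Delta> * real i" for i :: nat
  define A where "A i = 4 * a - 2 * a * (real i / real n)" for i :: nat
  have sn: "s n = T" "A n = 2 * a" using n by (auto simp: s_def A_def \<Delta>_def)
  have "0 < prob (below (A i) (s i))" if "i \<le> n" for i
    using that
  proof (induction i)
    case 0 then show ?case using pos by (simp add: s_def A_def)
  next
    case (Suc i)
    have step: "s (Suc i) - s i = \<Delta>" by (simp add: s_def algebra_simps)
    have frac: "real i / real n \<le> 1" "0 \<le> real i / real n" using Suc.prems n by auto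
    show ?case
    proof (rule prob_below_step[where A = "A i" and s = "s i" and T = T and a = a and \<kappa> = "\<eta> / real n"])
      show "1 \<le> s i" using \<Delta> by (simp add: s_def)
      show "s i < s (Suc i)" using step \<Delta> by simp
      have "s (Suc i) \<le> s n" unfolding s_def using \<Delta> Suc.prems by (intro add_left_mono mult_left_mono) auto
      then show "s (Suc i) \<le> T" by (simp add: sn)
      have "2 * a * (real i / real n) \<le> 2 * a * 1" using frac a by (intro mult_left_mono) auto
      then show Ai: "2 * a \<le> A i" by (simp add: A_def)
      have "real i / real n \<le> real (Suc i) / real n" using n by (intro divide_right_mono) auto
      then have "2 * a * (real i / real n) \<le> 2 * a * (real (Suc i) / real n)" using a by (intro mult_left_mono) auto
      then show "A (Suc i) \<le> A i" unfolding A_def by linarith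
      show "0 < a" by fact
      show "2 powr k * c * A i powr (k - 1) < r"
      proof (rule A_small)
        show "0 < A i" using Ai a by linarith
        have "0 \<le> 2 * a * (real i / real n)" using a frac by (intro mult_nonneg_nonneg) auto
        then show "A i \<le> 4 * a" unfolding A_def by linarith
      qed
      show "0 < prob (below (A i) (s i))" using Suc by simp
      show "0 < \<eta> / real n" using \<eta> n by simp
      have "(A i - A (Suc i)) = 2 * a / real n" using n by (simp add: A_def field_simps)
      then show "\<eta> / real n \<le> (A i - A (Suc i)) * T powr - r" by (simp add: \<eta>_def)
      have "4 * (s (Suc i) - s i) / (2 * a * T powr - r)\<^sup>2
          + 4 * ((s (Suc i) - s i) * (\<beta> * (s (Suc i) - s i))\<^sup>2) / (\<eta> / real n)\<^sup>2 = C / real n"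
        unfolding step \<eta>_def[symmetric] C_def \<Delta>_def using n(1) \<eta> by (simp add: field_simps power2_eq_square)
      also have "\<dots> < 1 / 2" using n by (simp add: divide_less_eq)
      finally show "4 * (s (Suc i) - s i) / (2 * a * T powr - r)\<^sup>2
          + 4 * ((s (Suc i) - s i) * (\<beta> * (s (Suc i) - s i))\<^sup>2) / (\<eta> / real n)\<^sup>2 < 1 / 2" .
    qed
  qed
  from this[of n] show ?thesis by (simp add: sn)
qed

text \<open>On the block \<open>[T 2\<^sup>n, T 2\<^bsup>n+1\<^esup>]\<close> the variance of the noise over the square of the permitted
oscillation is of order \<open>(T 2\<^sup>n) powr - d\<close> with \<open>d = 2\<beta> - 1 - 2r > 0\<close>. The sum over \<open>n\<close> is finite and tends to
zero as \<open>T\<close> grows. That \<open>d\<close> is positive is the hypothesis on \<open>\<gamma>\<close>.\<close>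

lemma tail_noise_small:
  assumes a: "0 < a"
  obtains T0 where "\<And>T D. T0 \<le> T \<Longrightarrow> 1 < T \<Longrightarrow> D \<in> sets (F T) \<Longrightarrow> 0 < prob D \<Longrightarrow>
    \<exists>E. E \<in> sets M \<and> E \<subseteq> D \<and> 0 < prob E \<and>
      (AE \<omega> in M. \<omega> \<in> E \<longrightarrow> (\<exists>m. \<forall>t\<ge>T. \<bar>I t \<omega> - m\<bar> \<le> a * t powr - r))"
proof -
  define d where "d = 2 * \<beta> - 1 - 2 * r"
  have d: "0 < d" using noise_small by (simp add: d_def r_def)
  \<comment> \<open>The constant that \<open>limit_of_geometric_blocks\<close> asks for.\<close>
  define b where "b = a * (2 powr - r * (1 - 2 powr - r) / 2)"
  have "2 powr - r < (1::real)" using r powr_less_mono[of "- r" 0 2] by simp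
  then have b: "0 < b" using a by (simp add: b_def)
  define q where "q = 2 powr - d"
  have q: "0 < q" "q < 1" using d powr_less_mono[of "- d" 0 2] by (auto simp: q_def)
  have "((\<lambda>T. T powr - d) \<longlongrightarrow> 0) at_top" by (rule tendsto_neg_powr[OF _ filterlim_ident]) (use d in simp)
  then have "\<forall>\<^sub>F T in at_top. T powr - d < (1 - q) * b\<^sup>2 / 4"
    by (rule order_tendstoD(2)) (use q b in simp)
  then obtain T0 where T0: "\<And>T. T0 \<le> T \<Longrightarrow> T powr - d < (1 - q) * b\<^sup>2 / 4"
    unfolding eventually_at_top_linorder by blast
  show thesis
  proof (rule that[of T0])
    fix T D assume T: "T0 \<le> T" "1 < T" and D: "D \<in> sets (F T)" "0 < prob D"
    define s where "s n = T * 2 ^ n" for n :: nat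
    define V where "V n = s n * (s n powr - \<beta>)\<^sup>2" for n
    define l where "l n = b * s n powr - r" for n
    have s1: "1 \<le> s n" for n
    proof -
      have "1 * 1 \<le> T * 2 ^ n" using T by (intro mult_mono) auto
      then show ?thesis by (simp add: s_def)
    qed
    have s0: "0 < s n" for n using s1[of n] by simp
    have sS: "s (Suc n) = 2 * s n" for n by (simp add: s_def)
    have term_eq: "4 * V n / (l n)\<^sup>2 = 4 * T powr - d / b\<^sup>2 * q ^ n" for n
    proof -
      have "V n = s n powr (1 + - \<beta> + - \<beta>)"
        using s0[of n] by (simp only: V_def powr_add powr_one less_imp_le power2_eq_square mult.assoc)
      moreover have "(l n)\<^sup>2 = b\<^sup>2 * s n powr (- r + - r)"
        by (simp only: l_def powr_add power2_eq_square mult_ac)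
      ultimately have "V n / (l n)\<^sup>2 = (s n powr (1 + - \<beta> + - \<beta>) / s n powr (- r + - r)) / b\<^sup>2"
        by simp
      also have "s n powr (1 + - \<beta> + - \<beta>) / s n powr (- r + - r) = s n powr (1 + - \<beta> + - \<beta> - (- r + - r))"
        by (rule powr_diff[symmetric])
      also have "1 + - \<beta> + - \<beta> - (- r + - r) = - d" by (simp add: d_def)
      also have "s n powr - d = T powr - d * (2 ^ n) powr - d"
        using T by (simp add: s_def powr_mult)
      also have "(2 ^ n :: real) powr - d = q ^ n"
        by (simp add: q_def powr_realpow[symmetric] powr_powr mult.commute)
      finally show ?thesis by simp
    qed
    have sums: "(\<lambda>n. 4 * V n / (l n)\<^sup>2) sums (4 * T powr - d / b\<^sup>2 * (1 / (1 - q)))"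
      unfolding term_eq using q by (intro sums_mult geometric_sums) auto
    have lt1: "4 * T powr - d / b\<^sup>2 * (1 / (1 - q)) < 1"
      using T0[OF T(1)] q b by (simp add: field_simps)
    obtain E where E: "E \<in> sets M" "E \<subseteq> D" "0 < prob E"
      and EI: "AE \<omega> in M. \<omega> \<in> E \<longrightarrow> (\<forall>n. \<forall>t\<in>{s n..s (Suc n)}. \<bar>I t \<omega> - I (s n) \<omega>\<bar> \<le> l n)"
    proof (rule all_blocks_small[of s D l V])
      show "D \<in> sets (F (s 0))" using D by (simp add: s_def)
      show "sq_norm (leb (s n) (s (Suc n))) (\<lambda>t. t powr - \<beta>) \<le> ennreal (V n)" for n
      proof -
        have "\<bar>t powr - \<beta>\<bar> \<le> s n powr - \<beta>" if "t \<in> {s n..<s (Suc n)}" for t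
          using that s0[of n] beta by (simp add: powr_mono2')
        then have "sq_norm (leb (s n) (s (Suc n))) (\<lambda>t. t powr - \<beta>) \<le> ennreal ((s (Suc n) - s n) * (s n powr - \<beta>)\<^sup>2)"
          using s0[of n] by (intro sq_norm_leb_le) (auto simp: sS)
        then show ?thesis by (simp add: sS V_def)
      qed
      show "summable (\<lambda>n. 4 * V n / (l n)\<^sup>2)" using sums by (rule sums_summable)
      show "(\<Sum>n. 4 * V n / (l n)\<^sup>2) < 1" using sums lt1 by (simp only: sums_unique[symmetric])
      show "0 < prob D" by fact
      show "s n < s (Suc n)" for n using s0[of n] by (simp add: sS)
      show "0 < l n" "0 \<le> V n" for n using s0[of n] b by (simp_all add: l_def V_def)
    qed (use s1 in auto)
    have "AE \<omega> in M. \<omega> \<in> E \<longrightarrow> (\<exists>m. \<forall>t\<ge>T. \<bar>I t \<omega> - m\<bar> \<le> a * t powr - r)"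
      using EI
    proof eventually_elim
      case (elim \<omega>)
      show ?case
      proof
        assume "\<omega> \<in> E"
        with elim have le: "\<bar>I t \<omega> - I (s n) \<omega>\<bar> \<le> l n" if "t \<in> {s n..s (Suc n)}" for n t
          using that by blast
        have T': "0 < T" using T by simp
        show "\<exists>m. \<forall>t\<ge>T. \<bar>I t \<omega> - m\<bar> \<le> a * t powr - r"
        proof (rule limit_of_geometric_blocks[OF T' r a, of "\<lambda>t. I t \<omega>"])
          fix n t assume "t \<in> {T * 2 ^ n..T * 2 ^ Suc n}"
          then show "\<bar>I t \<omega> - I (T * 2 ^ n) \<omega>\<bar> \<le> a * (2 powr - r * (1 - 2 powr - r) / 2) * (T * 2 ^ n) powr - r"
            by (rule le[unfolded s_def l_def b_def])
        next
          fix m assume "\<And>t. T \<le> t \<Longrightarrow> \<bar>I t \<omega> - m\<bar> \<le> a * t powr - r"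
          then show "\<exists>m. \<forall>t\<ge>T. \<bar>I t \<omega> - m\<bar> \<le> a * t powr - r" by blast
        qed
      qed
    qed
    then show "\<exists>E. E \<in> sets M \<and> E \<subseteq> D \<and> 0 < prob E \<and>
      (AE \<omega> in M. \<omega> \<in> E \<longrightarrow> (\<exists>m. \<forall>t\<ge>T. \<bar>I t \<omega> - m\<bar> \<le> a * t powr - r))"
      using E by blast
  qed
qed

lemma small_barriers:
  obtains A0 where "0 < A0" "\<And>A. 0 < A \<Longrightarrow> A \<le> A0 \<Longrightarrow> 2 powr k * c * A powr (k - 1) < r"
proof -
  define R where "R = r / (2 powr k * c)"
  have R: "0 < R" using r c by (simp add: R_def)
  \<comment> \<open>\<open>A powr (k - 1)\<close> increases with \<open>A\<close> and has the value \<open>R / 2\<close> at \<open>A0\<close>.\<close>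
  define A0 where "A0 = (R / 2) powr (1 / (k - 1))"
  have "2 powr k * c * A powr (k - 1) < r" if A: "0 < A" "A \<le> A0" for A
  proof -
    have "A powr (k - 1) \<le> A0 powr (k - 1)" using A k by (intro powr_mono2) auto
    also have "\<dots> = R / 2" unfolding A0_def using k R by (simp add: powr_powr)
    also have "\<dots> < R" using R by simp
    finally show ?thesis using c by (simp add: R_def field_simps)
  qed
  moreover have "0 < A0" using R by (simp add: A0_def)
  ultimately show thesis using that by blast
qed

text \<open>\<open>X 1\<close> is random and need not be bounded away from zero, so a level must be found that it is below with positive
probability.\<close>

lemma prob_initially_below_pos:
  assumes "AE \<omega> in M. X 1 \<omega> < 0"
  obtains A where "0 < A" "0 < prob (below A 1)"
proof -
  let ?A = "\<lambda>n::nat. 1 / real (Suc n)"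
  have m: "below A 1 \<in> sets M" for A using sets_below[of 1 A] sets_F_subset by fastforce
  have "\<exists>n. prob (below (?A n) 1) \<noteq> 0"
  proof (rule ccontr)
    assume "\<not> ?thesis"
    then have "AE \<omega> in M. \<omega> \<notin> below (?A n) 1" for n
      using prob_eq_0[OF m] by blast
    then have "AE \<omega> in M. \<forall>n. \<omega> \<notin> below (?A n) 1" unfolding AE_all_countable by (intro allI)
    then have "AE \<omega> in M. False"
      using assms AE_space
    proof eventually_elim
      case (elim \<omega>)
      obtain y where y: "X 1 \<omega> < ereal y" "y < 0"
        using ereal_dense2[OF elim(2)] unfolding zero_ereal_def less_ereal.simps(1) by blast
      have "0 < - y" using y(2) by simp
      then obtain n where n: "?A n < - y" by (rule nat_approx_posE)
      have "X 1 \<omega> < ereal (- ?A n)" by (rule less_trans[OF y(1)]) (use n in simp)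
      then have "\<omega> \<in> below (?A n) 1" using elim(3) by (simp add: below_def)
      with elim(1) show False by blast
    qed
    then show False by simp
  qed
  then obtain n where "prob (below (?A n) 1) \<noteq> 0" by blast
  then have "0 < prob (below (?A n) 1)" by (simp add: zero_less_measure_iff)
  then show thesis by (rule that[rotated]) simp
qed

lemma converges_with_positive_probability:
  assumes start: "AE \<omega> in M. X 1 \<omega> < 0"
  obtains E where "E \<in> sets M" "0 < prob E" "AE \<omega> in M. \<omega> \<in> E \<longrightarrow> ((\<lambda>t. X t \<omega>) \<longlongrightarrow> 0) at_top"
proof -
  obtain \<delta> where \<delta>: "0 < \<delta>" "0 < prob (below \<delta> 1)" by (rule prob_initially_below_pos[OF start])
  obtain A0 where A0: "0 < A0" "\<And>A. 0 < A \<Longrightarrow> A \<le> A0 \<Longrightarrow> 2 powr k * c * A powr (k - 1) < r"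
    by (rule small_barriers) blast
  define a where "a = min \<delta> A0 / 4"
  have a: "0 < a" "4 * a \<le> \<delta>" "4 * a \<le> A0" using \<delta> A0 by (auto simp: a_def)
  have "below \<delta> 1 \<subseteq> below (4 * a) 1"
    using a(2) by (auto simp: below_def intro: less_le_trans)
  moreover have "below (4 * a) 1 \<in> sets M" using sets_below[of 1 "4 * a"] sets_F_subset by fastforce
  ultimately have "prob (below \<delta> 1) \<le> prob (below (4 * a) 1)" by (rule finite_measure_mono)
  then have pos1: "0 < prob (below (4 * a) 1)" using \<delta>(2) by simp
  obtain T0 where T0: "\<And>T D. T0 \<le> T \<Longrightarrow> 1 < T \<Longrightarrow> D \<in> sets (F T) \<Longrightarrow> 0 < prob D \<Longrightarrow>
    \<exists>E. E \<in> sets M \<and> E \<subseteq> D \<and> 0 < prob E \<and>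
      (AE \<omega> in M. \<omega> \<in> E \<longrightarrow> (\<exists>m. \<forall>t\<ge>T. \<bar>I t \<omega> - m\<bar> \<le> a * t powr - r))"
    using tail_noise_small[OF a(1)] by blast
  define T where "T = max 2 T0"
  have T: "T0 \<le> T" "1 < T" "1 \<le> T" "0 < T" by (auto simp: T_def)
  have "0 < prob (below (2 * a) T)"
    by (rule prob_below_propagates[OF T(2) a(1) A0(2) pos1]) (use a(3) in auto)
  from T0[OF T(1,2) sets_below[OF T(3)] this]
  obtain E where E: "E \<in> sets M" "E \<subseteq> below (2 * a) T" "0 < prob E"
    and EI: "AE \<omega> in M. \<omega> \<in> E \<longrightarrow> (\<exists>m. \<forall>t\<ge>T. \<bar>I t \<omega> - m\<bar> \<le> a * t powr - r)"
    by blast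
  have "AE \<omega> in M. \<omega> \<in> E \<longrightarrow> ((\<lambda>t. X t \<omega>) \<longlongrightarrow> 0) at_top"
    using EI sol
  proof eventually_elim
    case (elim \<omega>)
    show ?case
    proof
      assume wE: "\<omega> \<in> E"
      then obtain m where m: "\<And>t. T \<le> t \<Longrightarrow> \<bar>I t \<omega> - m\<bar> \<le> a * t powr - r" using elim(1) by blast
      have "\<omega> \<in> below (2 * a) T" using wE E(2) by blast
      note alive = below_alive[OF this T(3) elim(2)]
      show "((\<lambda>t. X t \<omega>) \<longlongrightarrow> 0) at_top"
      proof (rule solution_tends_to_zero[OF k c a(1) _ elim(2) T(3,4) alive(1), where m = m])
        show "2 powr k * c * a powr (k - 1) < 1 / (k - 1)" using A0(2)[of a] a by (simp add: r_def)
        show "\<bar>I t \<omega> - m\<bar> \<le> a * t powr - (1 / (k - 1))" if "T \<le> t" for t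
          using m[OF that] by (simp add: r_def)
        show "real_of_ereal (X T \<omega>) - (I T \<omega> - m) < - a * T powr - (1 / (k - 1))"
          using alive(2) m[of T] by (simp add: r_def abs_le_iff)
      qed
    qed
  qed
  then show thesis by (rule that[OF E(1,3)])
qed

end

theorem theorem4p4:
  fixes M :: "'a measure" and F :: "real \<Rightarrow> 'a measure"
    and B :: "real \<Rightarrow> 'a \<Rightarrow> real" and X :: "real \<Rightarrow> 'a \<Rightarrow> ereal"
    and k \<gamma> c :: real
  assumes "k > 1" and "1/2 < \<gamma>" and "\<gamma> < 1" and "1/2 + 1/(2*k) < \<gamma>" and "c > 0"
    and "brownian_motion M F B"
    and "sde_solution M F B (\<lambda>x. c * \<bar>x\<bar> powr k)
           (\<lambda>t. t powr (- (\<gamma> / (2 * (1 - \<gamma>))))) 1 X"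
    and "AE \<omega> in M. X 1 \<omega> < 0"
  shows "path_prob M (\<lambda>\<omega>. ((\<lambda>t. X t \<omega>) \<longlongrightarrow> 0) at_top) > 0"
proof -
  define \<beta> where "\<beta> = \<gamma> / (2 * (1 - \<gamma>))"
  interpret prob_space M using assms(6) by (simp add: brownian_motion_def)
  interpret brownian M F B by unfold_locales (rule assms(6))
  have XF: "X t \<in> borel_measurable (F t)" if "1 \<le> t" for t
    using assms(7) that by (simp add: sde_solution_def)
  obtain I where I: "\<And>t. 1 \<le> t \<Longrightarrow> has_ito_integral M F B (\<lambda>s \<omega>. s powr (- \<beta>)) 1 t (I t)"
    "AE \<omega> in M. continuous_on {1..} (\<lambda>t. I t \<omega>)"
    "AE \<omega> in M. solution_path (\<lambda>x. c * \<bar>x\<bar> powr k) 1 (\<lambda>t. I t \<omega>) (\<lambda>t. X t \<omega>)"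
    using assms(7) unfolding sde_solution_def \<beta>_def[symmetric] by blast
  have noise: "2 * (1 / (k - 1)) < 2 * \<beta> - 1"
  proof -
    have "1 < k * (2 * \<gamma> - 1)" using assms(1,4) by (simp add: field_simps)
    then have "2 * (1 - \<gamma>) < (2 * \<gamma> - 1) * (k - 1)" by (simp add: algebra_simps)
    then have "2 / (k - 1) < (2 * \<gamma> - 1) / (1 - \<gamma>)"
      using assms(1,3) by (simp add: divide_less_eq less_divide_eq mult.commute)
    also have "\<dots> = 2 * \<beta> - 1" using assms(3) by (simp add: \<beta>_def field_simps)
    finally show ?thesis by simp
  qed
  have "0 < 2 * (1 / (k - 1))" using assms(1) by simp
  with noise have \<beta>: "0 < \<beta>" by linarith
  have meas: "(\<lambda>t::real. t powr (- \<beta>)) \<in> borel_measurable borel" by measurable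
  interpret power_drift_sde M F B \<beta> I k c X
  proof
    show "sq_norm (leb 1 u) (\<lambda>t. t powr (- \<beta>)) < \<infinity>" for u
    proof (cases "1 \<le> u")
      case True
      have "t powr (- \<beta>) \<le> 1" if "1 \<le> t" for t
        using powr_mono2'[of "- \<beta>" 1 t] \<beta> that by simp
      then have "sq_norm (leb 1 u) (\<lambda>t. t powr (- \<beta>)) \<le> ennreal ((u - 1) * 1\<^sup>2)"
        using True by (intro sq_norm_leb_le) auto
      then show ?thesis by (rule order_le_less_trans) simp
    next
      case False
      then show ?thesis unfolding sq_norm_leb by simp
    qed
    show "wiener_integral 1 t (\<lambda>t. t powr (- \<beta>)) (I t)" if "1 \<le> t" for t
      by (rule wiener_integral_of_ito[OF I(1)[OF that] _ meas]) simp
    show "X t \<in> borel_measurable (F t)" if "1 \<le> t" for t by (rule XF[OF that])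
  qed (rule assms I(2,3) noise meas | simp)+
  obtain E where E: "E \<in> sets M" "0 < prob E" "AE \<omega> in M. \<omega> \<in> E \<longrightarrow> ((\<lambda>t. X t \<omega>) \<longlongrightarrow> 0) at_top"
    by (rule converges_with_positive_probability[OF assms(8)])
  show ?thesis
  proof (rule path_prob_tendsto_pos[OF _ _ I(3) _ E])
    show "prob_space M" by (rule prob_space_axioms)
    show "X t \<in> borel_measurable M" if "1 \<le> t" for t
      by (rule measurable_from_subalg[OF _ XF[OF that]]) (simp add: subalgebra_def sets_F_subset)
    show "continuous_on UNIV (\<lambda>x. c * \<bar>x\<bar> powr k)" by (rule continuous_drift[OF less_trans[OF zero_less_one assms(1)]])
  qed
qed

end
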